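(* Let $\mathcal{W}$ be a separable Banach space, let $\mathbf{B}=(\mathbf{B}(t))_{t\ge 0}$ be a $\mathcal{W}$-valued Brownian motion with $\mathbf{B}(0)=0$ whose law at time $1$, $\mu=\mathrm{Law}(\mathbf{B}(1))$, is a centered non-degenerate Gaussian measure on $\mathcal{W}$, let $\mathcal{H}_\mu\subseteq\mathcal{W}$ be the Cameron-Martin space of $\mu$, and let $x\in\mathcal{W}$ with $x\neq 0$. Then $\mathbf{B}$ can be coupled with another Brownian motion $\widetilde{\mathbf{B}}$ corresponding to $\mu$ with $\widetilde{\mathbf{B}}(0)=x$ (that is, there exists a coupling $(\mathbf{B},\widetilde{\mathbf{B}})$ which with positive probability meets within finite time) if and only if $x\in\mathcal{H}_\mu$. Moreover, if $x\in\mathcal{H}_\mu$, then there is a coupling for which $\mathbf{B}$ and $\widetilde{\mathbf{B}}$ almost surely meet within finite time and which is maximal. Such a maximal coupling is produced by the Cameron-Martin reflection based on $x$, namely $$\widetilde{\mathbf{B}}(t)=\begin{cases} x+\mathbf{B}(t)-2\,\dfrac{\langle x,\mathbf{B}(t)\rangle_{\mathcal{H}_\mu}}{\|x\|_{\mathcal{H}_\mu}^2}\,x, & t<T,\\[2mm] \mathbf{B}(t), & t\ge T,\end{cases}$$ where $T$ is the first time at which $\langle x,\mathbf{B}(T)\rangle_{\mathcal{H}_\mu}=\tfrac12\|x\|_{\mathcal{H}_\mu}^2$, and its coupling time has the distribution of $T$.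
   Context: Gaussian measures. A centered Gaussian measure $\mu$ on a separable real Banach space $\mathcal{W}$ (norm $\|\cdot\|_{\mathcal{W}}$) is a Borel probability measure whose push-forward $\ell\#\mu$ under every continuous linear functional $\ell\in\mathcal{W}^*$ is a mean-zero Gaussian measure on $\mathbb{R}$; it is non-degenerate if $\ell\#\mu$ is non-degenerate for every $\ell\neq 0$. Its covariance is $\mathrm{Cov}_\mu(\ell_1,\ell_2)=\int_{\mathcal{W}}\ell_1(w)\ell_2(w)\,\mu(dw)$ for $\ell_1,\ell_2\in\mathcal{W}^*$. Cameron-Martin space. Let $\mathring{\mathcal{H}}_\mu$ be the set of $h\in\mathcal{W}$ for which there is $h^*\in\mathcal{W}^*$ with $\mathrm{Cov}_\mu(h^*,\ell)=\ell(h)$ for all $\ell\in\mathcal{W}^*$, with inner product $\langle h,k\rangle_{\mathcal{H}_\mu}=\mathrm{Cov}_\mu(h^*,k^* )$. The Cameron-Martin space $\mathcal{H}_\mu$ is its Hilbert-space completion, which embeds continuously, injectively and densely in $\mathcal{W}$ and is identified with a subset of $\mathcal{W}$; its norm is $\|\cdot\|_{\mathcal{H}_\mu}$. Brownian motion. A $\mathcal{W}$-valued Brownian motion corresponding to $\mu$ is a $\mathcal{W}$-valued process with continuous sample paths and stationary Gaussian increments independent of the past, where $\mathbf{B}(t)-\mathbf{B}(s)$ (for $s<t$) has the law of $\sqrt{t-s}\,Z$ with $Z\sim\mu$. Pairing. For $x\in\mathcal{H}_\mu$, $\langle x,\mathbf{B}(t)\rangle_{\mathcal{H}_\mu}$ denotes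 the Paley-Wiener extension: for $x\in\mathring{\mathcal{H}}_\mu$ it is $x^*(\mathbf{B}(t))$, and for general $x\in\mathcal{H}_\mu$ it is the $L^2$-limit of $x_n^*(\mathbf{B}(t))$ where $x_n\in\mathring{\mathcal{H}}_\mu$ and $x_n\to x$ in $\mathcal{H}_\mu$, taken in its continuous version in $t$ (a real Brownian motion of variance $\|x\|_{\mathcal{H}_\mu}^2$ per unit time). Coupling. A coupling of $\mathbf{B}$ and $\widetilde{\mathbf{B}}$ is a pair of such Brownian motions (with the prescribed starting points) defined on one probability space. They meet by time $t$ if there is a random time $\tau\le t$ with $\mathbf{B}(\tau+s)=\widetilde{\mathbf{B}}(\tau+s)$ for all $s\ge 0$; they meet within finite time if this holds for some $t<\infty$. The coupling time is the first such $\tau$ ($\infty$ if there is none). A coupling is maximal if, for all $t$, $\mathbb{P}[\widetilde{\mathbf{B}}\text{ meets }\mathbf{B}\text{ by time }t]=1-\mathrm{dist}_{\mathrm{TV}}(\mathrm{Law}(\widetilde{\mathbf{B}}(t)),\mathrm{Law}(\mathbf{B}(t)))$, where $\mathrm{dist}_{\mathrm{TV}}(\nu,\nu')=\sup_A|\nu(A)-\nu'(A)|$ over Borel sets $A$. *)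

theory Defs
  imports "HOL-Probability.Probability"
begin

section \<open>Gaussian measures\<close>

definition centered_normal :: "real \<Rightarrow> real measure" where
  "centered_normal \<sigma> =
     (if \<sigma> = 0 then return borel 0 else density lborel (normal_density 0 \<sigma>))"

definition centered_gaussian ::
  "'a::{banach,second_countable_topology} measure \<Rightarrow> bool" where
  "centered_gaussian \<mu> \<longleftrightarrow> prob_space \<mu> \<and> sets \<mu> = sets borel \<and>
     (\<forall>l::'a \<Rightarrow>\<^sub>L real. \<exists>\<sigma>\<ge>0. distr \<mu> borel (blinfun_apply l) = centered_normal \<sigma>)"

definition nondegenerate_gaussian ::
  "'a::{banach,second_countable_topology} measure \<Rightarrow> bool" where
  "nondegenerate_gaussian \<mu> \<longleftrightarrow> centered_gaussian \<mu> \<and>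
     (\<forall>l::'a \<Rightarrow>\<^sub>L real. l \<noteq> 0 \<longrightarrow>
        (\<exists>\<sigma>>0. distr \<mu> borel (blinfun_apply l) = centered_normal \<sigma>))"

definition Cov ::
  "'a::{banach,second_countable_topology} measure \<Rightarrow> ('a \<Rightarrow>\<^sub>L real) \<Rightarrow> ('a \<Rightarrow>\<^sub>L real) \<Rightarrow> real" where
  "Cov \<mu> k l = (LINT w|\<mu>. blinfun_apply k w * blinfun_apply l w)"


section \<open>The Cameron-Martin space\<close>

definition represents ::
  "'a::{banach,second_countable_topology} measure \<Rightarrow> ('a \<Rightarrow>\<^sub>L real) \<Rightarrow> 'a \<Rightarrow> bool" where
  "represents \<mu> k h \<longleftrightarrow> (\<forall>l. Cov \<mu> k l = blinfun_apply l h)"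

definition pre_cm_space :: "'a::{banach,second_countable_topology} measure \<Rightarrow> 'a set" where
  "pre_cm_space \<mu> = {h. \<exists>k. represents \<mu> k h}"

text \<open>The functional \<open>h\<^sup>*\<close>. It is unique if \<open>\<mu>\<close> is non-degenerate, and
  \<open>pre_cm_inner\<close> below does not depend on the choice in any case.\<close>

definition cm_star ::
  "'a::{banach,second_countable_topology} measure \<Rightarrow> 'a \<Rightarrow> 'a \<Rightarrow>\<^sub>L real" where
  "cm_star \<mu> h = (SOME k. represents \<mu> k h)"

definition pre_cm_inner ::
  "'a::{banach,second_countable_topology} measure \<Rightarrow> 'a \<Rightarrow> 'a \<Rightarrow> real" where
  "pre_cm_inner \<mu> h k = Cov \<mu> (cm_star \<mu> h) (cm_star \<mu> k)"

definition pre_cm_norm :: "'a::{banach,second_countable_topology} measure \<Rightarrow> 'a \<Rightarrow> real" where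
  "pre_cm_norm \<mu> h = sqrt (pre_cm_inner \<mu> h h)"

text \<open>The Hilbert-space completion consists of the classes of Cauchy sequences of the
  pre-Hilbert space \<open>pre_cm_space \<mu>\<close>. The inclusion into the Banach space extends to an injection
  of the completion, which sends the class of a Cauchy sequence to its limit in the Banach space.
  The completion is identified with the range of this injection; the norm of a class is the limit
  of the norms along any of its representatives.\<close>

definition cm_cauchy_to ::
  "'a::{banach,second_countable_topology} measure \<Rightarrow> (nat \<Rightarrow> 'a) \<Rightarrow> 'a \<Rightarrow> bool" where
  "cm_cauchy_to \<mu> u h \<longleftrightarrow> (\<forall>n. u n \<in> pre_cm_space \<mu>) \<and>
     (\<forall>e>0. \<exists>n0. \<forall>m\<ge>n0. \<forall>n\<ge>n0. pre_cm_norm \<mu> (u m - u n) < e) \<and>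
     u \<longlonglongrightarrow> h"

definition cm_space :: "'a::{banach,second_countable_topology} measure \<Rightarrow> 'a set" where
  "cm_space \<mu> = {h. \<exists>u. cm_cauchy_to \<mu> u h}"

definition cm_norm :: "'a::{banach,second_countable_topology} measure \<Rightarrow> 'a \<Rightarrow> real" where
  "cm_norm \<mu> h = (THE r. \<exists>u. cm_cauchy_to \<mu> u h \<and> (\<lambda>n. pre_cm_norm \<mu> (u n)) \<longlonglongrightarrow> r)"


section \<open>Brownian motion and the Paley-Wiener pairing\<close>

text \<open>Processes are functions of \<open>t :: real\<close>, of which only the values at \<open>t \<ge> 0\<close> matter.
  All sample paths are continuous; the starting point is prescribed almost surely.\<close>

definition past_sets ::
  "'w measure \<Rightarrow> (real \<Rightarrow> 'w \<Rightarrow> 'a::topological_space) \<Rightarrow> real \<Rightarrow> 'w set set" where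
  "past_sets M B s =
     sigma_sets (space M) {B u -` A \<inter> space M | u A. 0 \<le> u \<and> u \<le> s \<and> A \<in> sets borel}"

definition brownian_motion ::
  "'w measure \<Rightarrow> 'a::{banach,second_countable_topology} measure \<Rightarrow> 'a \<Rightarrow>
     (real \<Rightarrow> 'w \<Rightarrow> 'a) \<Rightarrow> bool" where
  "brownian_motion M \<mu> x B \<longleftrightarrow>
     prob_space M \<and>
     (\<forall>t\<ge>0. B t \<in> borel_measurable M) \<and>
     (\<forall>\<omega>\<in>space M. continuous_on {0..} (\<lambda>t. B t \<omega>)) \<and>
     (AE \<omega> in M. B 0 \<omega> = x) \<and>
     (\<forall>s t. 0 \<le> s \<and> s < t \<longrightarrow>
        distr M borel (\<lambda>\<omega>. B t \<omega> - B s \<omega>) = distr \<mu> borel (\<lambda>z. sqrt (t - s) *\<^sub>R z) \<and>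
        prob_space.indep_set M
          {(\<lambda>\<omega>. B t \<omega> - B s \<omega>) -` A \<inter> space M | A. A \<in> sets borel}
          (past_sets M B s))"

text \<open>\<open>paley_wiener M \<mu> B x N\<close>: the process \<open>N\<close> is a continuous version of the pairing of \<open>x\<close>
  with \<open>B\<close>. The limit does not depend on the approximating sequence; for \<open>x\<close> in
  \<open>pre_cm_space \<mu>\<close> the constant sequence gives \<open>N t = cm_star \<mu> x \<circ> B t\<close> almost surely.\<close>

definition paley_wiener ::
  "'w measure \<Rightarrow> 'a::{banach,second_countable_topology} measure \<Rightarrow> (real \<Rightarrow> 'w \<Rightarrow> 'a) \<Rightarrow> 'a \<Rightarrow>
     (real \<Rightarrow> 'w \<Rightarrow> real) \<Rightarrow> bool" where
  "paley_wiener M \<mu> B x N \<longleftrightarrow>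
     (\<forall>t\<ge>0. N t \<in> borel_measurable M) \<and>
     (\<forall>\<omega>\<in>space M. continuous_on {0..} (\<lambda>t. N t \<omega>)) \<and>
     (\<exists>u. (\<forall>n. u n \<in> pre_cm_space \<mu>) \<and> (\<lambda>n. cm_norm \<mu> (u n - x)) \<longlonglongrightarrow> 0 \<and>
        (\<forall>t\<ge>0. (\<lambda>n. \<integral>\<^sup>+\<omega>. ennreal ((blinfun_apply (cm_star \<mu> (u n)) (B t \<omega>) - N t \<omega>)\<^sup>2) \<partial>M)
                 \<longlonglongrightarrow> 0))"


section \<open>Couplings\<close>

definition tv_dist :: "'a::topological_space measure \<Rightarrow> 'a measure \<Rightarrow> real" where
  "tv_dist \<nu> \<nu>' = (SUP A\<in>sets borel. \<bar>measure \<nu> A - measure \<nu>' A\<bar>)"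

text \<open>The two starting points are \<open>x\<close> and \<open>x'\<close>. A theorem that is polymorphic in the sample type \<open>'w\<close>
  and quantifies over couplings on \<open>'w\<close> covers couplings on every probability space.\<close>

definition coupling ::
  "'w measure \<Rightarrow> 'a::{banach,second_countable_topology} measure \<Rightarrow>
     (real \<Rightarrow> 'w \<Rightarrow> 'a) \<Rightarrow> 'a \<Rightarrow> (real \<Rightarrow> 'w \<Rightarrow> 'a) \<Rightarrow> 'a \<Rightarrow> bool" where
  "coupling M \<mu> B x B' x' \<longleftrightarrow> brownian_motion M \<mu> x B \<and> brownian_motion M \<mu> x' B'"

definition meet_times :: "(real \<Rightarrow> 'w \<Rightarrow> 'a) \<Rightarrow> (real \<Rightarrow> 'w \<Rightarrow> 'a) \<Rightarrow> 'w \<Rightarrow> real set" where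
  "meet_times B B' \<omega> = {\<tau>. 0 \<le> \<tau> \<and> (\<forall>s\<ge>0. B (\<tau> + s) \<omega> = B' (\<tau> + s) \<omega>)}"

definition meets_by ::
  "(real \<Rightarrow> 'w \<Rightarrow> 'a) \<Rightarrow> (real \<Rightarrow> 'w \<Rightarrow> 'a) \<Rightarrow> real \<Rightarrow> 'w \<Rightarrow> bool" where
  "meets_by B B' t \<omega> \<longleftrightarrow> (\<exists>\<tau>\<in>meet_times B B' \<omega>. \<tau> \<le> t)"

definition meets_in_finite_time ::
  "(real \<Rightarrow> 'w \<Rightarrow> 'a) \<Rightarrow> (real \<Rightarrow> 'w \<Rightarrow> 'a) \<Rightarrow> 'w \<Rightarrow> bool" where
  "meets_in_finite_time B B' \<omega> \<longleftrightarrow> (\<exists>t. meets_by B B' t \<omega>)"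

text \<open>For continuous paths the set of meeting times is closed, so that the infimum is attained
  unless it is \<open>\<infinity>\<close>; likewise for \<open>hitting_time\<close>.\<close>

definition coupling_time ::
  "(real \<Rightarrow> 'w \<Rightarrow> 'a) \<Rightarrow> (real \<Rightarrow> 'w \<Rightarrow> 'a) \<Rightarrow> 'w \<Rightarrow> ereal" where
  "coupling_time B B' \<omega> = Inf (ereal ` meet_times B B' \<omega>)"

definition maximal_coupling ::
  "'w measure \<Rightarrow> 'a::{banach,second_countable_topology} measure \<Rightarrow>
     (real \<Rightarrow> 'w \<Rightarrow> 'a) \<Rightarrow> 'a \<Rightarrow> (real \<Rightarrow> 'w \<Rightarrow> 'a) \<Rightarrow> 'a \<Rightarrow> bool" where
  "maximal_coupling M \<mu> B x B' x' \<longleftrightarrow> coupling M \<mu> B x B' x' \<and>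
     (\<forall>t\<ge>0. measure M {\<omega>\<in>space M. meets_by B B' t \<omega>}
              = 1 - tv_dist (distr M borel (B' t)) (distr M borel (B t)))"


section \<open>The Cameron-Martin reflection\<close>

definition hitting_time :: "(real \<Rightarrow> 'w \<Rightarrow> real) \<Rightarrow> real \<Rightarrow> 'w \<Rightarrow> ereal" where
  "hitting_time N a \<omega> = Inf (ereal ` {t. 0 \<le> t \<and> N t \<omega> = a})"

definition cm_reflection_time ::
  "'a::{banach,second_countable_topology} measure \<Rightarrow> 'a \<Rightarrow> (real \<Rightarrow> 'w \<Rightarrow> real) \<Rightarrow> 'w \<Rightarrow> ereal" where
  "cm_reflection_time \<mu> x N = hitting_time N ((cm_norm \<mu> x)\<^sup>2 / 2)"

definition cm_reflection ::
  "'a::{banach,second_countable_topology} measure \<Rightarrow> 'a \<Rightarrow> (real \<Rightarrow> 'w \<Rightarrow> real) \<Rightarrow>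
     (real \<Rightarrow> 'w \<Rightarrow> 'a) \<Rightarrow> real \<Rightarrow> 'w \<Rightarrow> 'a" where
  "cm_reflection \<mu> x N B t \<omega> =
     (if ereal t < cm_reflection_time \<mu> x N \<omega>
      then x + B t \<omega> - (2 * (N t \<omega> / (cm_norm \<mu> x)\<^sup>2)) *\<^sub>R x
      else B t \<omega>)"

end

theory Submission
  imports Defs
begin

text \<open>If a coupling meets with positive probability, Chebyshev's inequality for \<open>l (B t)\<close> gives
  \<open>l x \<le> C sd l\<close> for all functionals \<open>l\<close>, where \<open>sd l\<close> is the standard deviation of \<open>l\<close> under \<open>\<mu>\<close>;
  this boundedness characterises the Cameron-Martin space.

  Conversely, let \<open>k n\<close> be functionals which represent a sequence converging fast to \<open>x\<close> in the
  Cameron-Martin norm \<open>c\<close>. Almost everywhere they converge to a measurable functional \<open>g\<close>, the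
  reflection \<open>w \<mapsto> w - 2 g w / c\<^sup>2 *\<^sub>R x\<close> preserves \<open>\<mu>\<close>, and the pairing \<open>N t\<close> equals \<open>g (B t)\<close>
  almost surely. The reflected process is \<open>B t + x - (2 N (min t T) / c\<^sup>2) *\<^sub>R x\<close>. Rounding \<open>T\<close>
  up to a grid turns it into a process in which each increment is reflected or not depending on the
  past, hence with unchanged joint law; refining the grid transfers the finite-dimensional
  distributions. This avoids the strong Markov property. Finally, the half space \<open>g \<ge> c\<^sup>2 / 2\<close> has
  mass differing by exactly \<open>P (T > t)\<close> under the two laws at time \<open>t\<close>, which with the coupling
  inequality gives maximality.\<close>

section \<open>Norming functionals\<close>

text \<open>A general \<open>x\<close> in the Cameron-Martin space has no representing continuous
  functional, so \<open>g\<close> exists only as an almost everywhere limit. Under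
  \<open>\<mu>\<close> it has variance \<open>c\<^sup>2\<close> and covariance \<open>l x\<close>
  with \<open>l\<close>; hence subtracting \<open>2 * l x / c\<^sup>2\<close> times \<open>g\<close>
  from \<open>l\<close> leaves the variance of \<open>l\<close> unchanged, and this is why the
  reflection preserves \<open>\<mu>\<close>. The pairing is fixed only up to a null set for each
  time, while the past of \<open>B\<close> is not completed. Whether \<open>T\<close> has been
  passed is therefore decided from the values \<open>g (B u)\<close> at countably many times: this
  event lies in the past and is almost surely the right one. As \<open>g x = c\<^sup>2\<close>, the
  reflection exchanges the two sides of the level \<open>c\<^sup>2 / 2\<close>. Since the reflected
  value has the law of \<open>x + B t\<close>, the event \<open>T > t\<close> has the probability
  that \<open>N t\<close> lies in an interval around 0; the bounded normal density makes this of
  order \<open>1 / sqrt t\<close>, so \<open>T\<close> is finite almost surely.\<close>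

definition sublinear :: "('a::real_normed_vector \<Rightarrow> real) \<Rightarrow> bool" where
  "sublinear p \<longleftrightarrow> (\<forall>x y. p (x + y) \<le> p x + p y) \<and> (\<forall>x. \<forall>r>0. p (r *\<^sub>R x) = r * p x) \<and> (\<forall>x. p x \<le> norm x)"

text \<open>The bound by the norm is part of \<open>sublinear\<close> so that such functionals are
  bounded below too; this keeps the infima below, over shifts and over chains, finite.\<close>

lemma sublinear_lower:
  assumes "sublinear p"
  shows "- norm x \<le> p x"
proof -
  have "p (2 *\<^sub>R 0) = 2 * p 0" using assms unfolding sublinear_def by (meson zero_less_numeral)
  then have "p 0 = 0" by simp
  have "p (x + - x) \<le> p x + p (-x)" "p (-x) \<le> norm (-x)"
    using assms unfolding sublinear_def by blast+
  with \<open>p 0 = 0\<close> show ?thesis by simp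
qed

text \<open>Lowers \<open>p\<close> in the direction \<open>- y\<close>: at \<open>- y\<close> the
  choice \<open>t = 1\<close> gives at most \<open>- p y\<close>. A sublinear functional that no
  such shift lowers must be odd.\<close>

definition sublinear_shift :: "('a::real_normed_vector \<Rightarrow> real) \<Rightarrow> 'a \<Rightarrow> 'a \<Rightarrow> real" where
  "sublinear_shift p y x = (INF t\<in>{0..}. p (x + t *\<^sub>R y) - t * p y)"

lemma sublinear_shift:
  fixes p :: "'a::real_normed_vector \<Rightarrow> real"
  assumes p: "sublinear p"
  shows sublinear_sublinear_shift: "sublinear (sublinear_shift p y)"
    and sublinear_shift_le: "t \<ge> 0 \<Longrightarrow> sublinear_shift p y x \<le> p (x + t *\<^sub>R y) - t * p y"
    and sublinear_shift_le_self: "sublinear_shift p y x \<le> p x"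
proof -
  have add: "p (x + y) \<le> p x + p y" for x y using p by (auto simp: sublinear_def)
  have scale: "p (r *\<^sub>R x) = r * p x" if "r \<ge> 0" for r x
  proof (cases "r = 0")
    case True
    have "p (2 *\<^sub>R 0) = 2 * p 0" using p unfolding sublinear_def by (meson zero_less_numeral)
    then show ?thesis using True by simp
  next
    case False then show ?thesis using p that by (auto simp: sublinear_def)
  qed
  have ub: "p x \<le> norm x" for x using p by (auto simp: sublinear_def)
  have low: "- norm x \<le> p (x + t *\<^sub>R y) - t * p y" if "t \<ge> 0" for t x
  proof -
    have "p (t *\<^sub>R y) \<le> p (x + t *\<^sub>R y) + p (-x)" using add[of "x + t *\<^sub>R y" "-x"] by simp
    then show ?thesis using scale[OF that] ub[of "-x"] by simp
  qed
  have bdd: "bdd_below ((\<lambda>t. p (x + t *\<^sub>R y) - t * p y) ` {0..})" for x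
    by (rule bdd_belowI2[of _ "- norm x"]) (use low in auto)
  show le: "sublinear_shift p y x \<le> p (x + t *\<^sub>R y) - t * p y" if "t \<ge> 0" for t x
    unfolding sublinear_shift_def by (rule cINF_lower[OF bdd]) (use that in auto)
  show le0: "sublinear_shift p y x \<le> p x" for x using le[of 0 x] by simp
  have addq: "sublinear_shift p y (u + v) \<le> sublinear_shift p y u + sublinear_shift p y v" for u v
  proof -
    have 1: "sublinear_shift p y (u + v) \<le> (p (u + s *\<^sub>R y) - s * p y) + (p (v + t *\<^sub>R y) - t * p y)"
      if "s \<ge> 0" "t \<ge> 0" for s t
      using le[of "s + t" "u + v"] add[of "u + s *\<^sub>R y" "v + t *\<^sub>R y"] that
      by (simp add: algebra_simps)
    have "sublinear_shift p y (u + v) - (p (u + s *\<^sub>R y) - s * p y) \<le> sublinear_shift p y v" if "s \<ge> 0" for s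
      unfolding sublinear_shift_def[of p y v]
      by (rule cINF_greatest) (use 1[OF that] in \<open>auto simp: algebra_simps\<close>)
    then have "sublinear_shift p y (u + v) - sublinear_shift p y v \<le> sublinear_shift p y u"
      unfolding sublinear_shift_def[of p y u]
      by (intro cINF_greatest) (auto simp: algebra_simps)
    then show ?thesis by simp
  qed
  have scale_le: "sublinear_shift p y (r *\<^sub>R u) \<le> r * sublinear_shift p y u" if "r > 0" for r u
  proof -
    have "sublinear_shift p y (r *\<^sub>R u) / r \<le> p (u + t *\<^sub>R y) - t * p y" if t: "t \<ge> 0" for t
    proof -
      have "sublinear_shift p y (r *\<^sub>R u) \<le> p (r *\<^sub>R (u + t *\<^sub>R y)) - (r * t) * p y"
        using le[of "r * t" "r *\<^sub>R u"] t \<open>r > 0\<close> by (simp add: scaleR_add_right)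
      also have "\<dots> = r * (p (u + t *\<^sub>R y) - t * p y)"
        using scale[of r] \<open>r > 0\<close> by (simp add: algebra_simps del: scaleR_add_right)
      finally show ?thesis using \<open>r > 0\<close> by (simp add: field_simps)
    qed
    then have "sublinear_shift p y (r *\<^sub>R u) / r \<le> sublinear_shift p y u"
      unfolding sublinear_shift_def[of p y u] by (intro cINF_greatest) auto
    then show ?thesis using \<open>r > 0\<close> by (simp add: field_simps)
  qed
  have "sublinear_shift p y (r *\<^sub>R u) = r * sublinear_shift p y u" if "r > 0" for r u
  proof -
    have "sublinear_shift p y ((1/r) *\<^sub>R (r *\<^sub>R u)) \<le> 1/r * sublinear_shift p y (r *\<^sub>R u)"
      by (rule scale_le) (use that in auto)
    then have "r * sublinear_shift p y u \<le> sublinear_shift p y (r *\<^sub>R u)" using that by (simp add: field_simps)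
    with scale_le[OF that] show ?thesis by (simp add: order_antisym)
  qed
  with addq le0 ub show "sublinear (sublinear_shift p y)"
    unfolding sublinear_def by (meson order_trans)
qed

text \<open>A minimal functional agrees with all its shifts, which makes it additive.\<close>

lemma minimal_sublinear_linear:
  assumes p: "sublinear p" and min: "\<And>q. sublinear q \<Longrightarrow> (\<forall>x. q x \<le> p x) \<Longrightarrow> q = p"
  shows "bounded_linear p" "\<And>x. \<bar>p x\<bar> \<le> norm x"
proof -
  show bd: "\<bar>p x\<bar> \<le> norm x" for x
    using sublinear_lower[OF p, of x] p by (auto simp: sublinear_def abs_le_iff)
  have "sublinear_shift p y = p" for y
    by (rule min) (use sublinear_shift[OF p] in auto)
  then have "p x \<le> p (x + y) - p y" for x y
    using sublinear_shift_le[OF p, of 1 y x] by simp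
  then have add: "p (x + y) = p x + p y" for x y
    using p unfolding sublinear_def by (smt (verit))
  have pos: "p (r *\<^sub>R x) = r * p x" if "r > 0" for r x using p that by (auto simp: sublinear_def)
  have zero: "p 0 = 0" using add[of 0 0] by simp
  have neg: "p (- x) = - p x" for x using add[of x "-x"] zero by simp
  have "p (r *\<^sub>R x) = r * p x" for r x
  proof (cases "r < 0")
    case True
    then have "p ((-r) *\<^sub>R (-x)) = (-r) * p (-x)" by (intro pos) simp
    then show ?thesis using neg by simp
  next
    case False
    then show ?thesis using pos zero by (cases "r = 0") auto
  qed
  then show "bounded_linear p"
    by (intro bounded_linear_intro[of _ 1]) (use add bd in auto)
qed

text \<open>The Hahn-Banach theorem in the form without subspaces: Zorn's lemma produces a minimal
  sublinear functional below \<open>p0\<close>, and minimality already forces linearity.\<close>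

theorem ex_norming_functional:
  fixes w :: "'a::real_normed_vector"
  obtains l :: "'a \<Rightarrow>\<^sub>L real" where "blinfun_apply l w = norm w" "\<And>v. \<bar>blinfun_apply l v\<bar> \<le> norm v"
proof -
  \<comment> \<open>Shifting the norm by \<open>w\<close> first forces every minorant to be at most
    \<open>- norm w\<close> at \<open>- w\<close>, so that the linear one attains
    \<open>norm w\<close> at \<open>w\<close>.\<close>
  define p0 where "p0 = sublinear_shift norm w"
  have sn: "sublinear (norm :: 'a \<Rightarrow> real)" by (auto simp: sublinear_def norm_triangle_ineq)
  have p0: "sublinear p0" unfolding p0_def by (rule sublinear_sublinear_shift[OF sn])
  define S where "S = {p. sublinear p \<and> (\<forall>x. p x \<le> p0 x)}"
  \<comment> \<open>The order is reversed: \<open>q\<close> lies above \<open>p\<close> if it is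
    pointwise smaller, so that maximal elements are minimal functionals and a chain is bounded by
    its infimum.\<close>
  define r where "r = {(p, q). p \<in> S \<and> q \<in> S \<and> (\<forall>x. q x \<le> p x)}"
  have Fr: "Field r = S" unfolding Field_def r_def by auto
  have "\<exists>m\<in>Field r. \<forall>a\<in>Field r. (m, a) \<in> r \<longrightarrow> a = m"
  proof (rule Zorns_po_lemma)
    show "Partial_order r"
      unfolding partial_order_on_def preorder_on_def Fr
      by (auto simp: refl_on_def r_def trans_def antisym_def intro: order_trans)
         (metis ext order_antisym)
    fix C assume C: "C \<in> Chains r"
    show "\<exists>u\<in>Field r. \<forall>a\<in>C. (a, u) \<in> r"
    proof (cases "C = {}")
      case True
      then show ?thesis using p0 Fr S_def by auto
    next
      case False
      have CS: "C \<subseteq> S" using C by (auto simp: Chains_def r_def)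
      have tot: "(\<forall>x. p x \<le> q x) \<or> (\<forall>x. q x \<le> p x)" if "p \<in> C" "q \<in> C" for p q
        using C that by (auto simp: Chains_def r_def)
      define u where "u x = (INF p\<in>C. p x)" for x
      have bdd: "bdd_below ((\<lambda>p. p x) ` C)" for x
        by (rule bdd_belowI2[of _ "- norm x"]) (use CS sublinear_lower in \<open>auto simp: S_def\<close>)
      have le: "u x \<le> p x" if "p \<in> C" for p x
        unfolding u_def by (rule cINF_lower[OF bdd that])
      have add: "u (x + y) \<le> u x + u y" for x y
      proof -
        \<comment> \<open>Subadditivity of the infimum needs one functional for both arguments; in a
          chain the smaller of \<open>p\<close> and \<open>q\<close> serves.\<close>
        have *: "u (x + y) \<le> p x + q y" if "p \<in> C" "q \<in> C" for p q
        proof -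
          have "p (x+y) \<le> p x + p y" "q (x+y) \<le> q x + q y"
            using that CS by (auto simp: S_def sublinear_def)
          with tot[OF that] le[OF that(1), of "x+y"] le[OF that(2), of "x+y"] show ?thesis
            by (smt (verit))
        qed
        have "u (x + y) - p x \<le> u y" if "p \<in> C" for p
          unfolding u_def[of y] by (rule cINF_greatest[OF False]) (use *[OF that] in \<open>auto simp: algebra_simps\<close>)
        then have "u (x + y) - u y \<le> u x"
          unfolding u_def[of x] by (intro cINF_greatest[OF False]) (auto simp: algebra_simps)
        then show ?thesis by simp
      qed
      have sc: "u (r *\<^sub>R x) = r * u x" if "r > 0" for r x
      proof -
        have e: "p (r *\<^sub>R x) = r * p x" if "p \<in> C" for p
          using that CS \<open>r > 0\<close> by (auto simp: S_def sublinear_def)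
        have "u (r *\<^sub>R x) / r \<le> u x" unfolding u_def[of x]
        proof (rule cINF_greatest[OF False])
          fix p assume "p \<in> C"
          then show "u (r *\<^sub>R x) / r \<le> p x" using le[of p "r *\<^sub>R x"] e[of p] that by (simp add: field_simps)
        qed
        moreover have "r * u x \<le> u (r *\<^sub>R x)" unfolding u_def[of "r *\<^sub>R x"]
        proof (rule cINF_greatest[OF False])
          fix p assume "p \<in> C"
          then show "r * u x \<le> p (r *\<^sub>R x)" using le[of p x] e[of p] that by simp
        qed
        ultimately show ?thesis using that by (simp add: field_simps)
      qed
      obtain p where "p \<in> C" using False by auto
      then have pS: "p \<in> S" using CS by blast
      have "p x \<le> p0 x" "p x \<le> norm x" for x using pS by (simp_all add: S_def sublinear_def)
      then have "u x \<le> p0 x" "u x \<le> norm x" for x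
        using le[OF \<open>p \<in> C\<close>, of x] order_trans by blast+
      then have "u \<in> S" unfolding S_def sublinear_def using add sc by auto
      moreover have "(a, u) \<in> r" if "a \<in> C" for a
        using \<open>u \<in> S\<close> le that CS by (auto simp: r_def)
      ultimately show ?thesis unfolding Fr by blast
    qed
  qed
  then obtain m where m: "m \<in> S" "\<And>q. q \<in> S \<Longrightarrow> (\<forall>x. q x \<le> m x) \<Longrightarrow> q = m"
    unfolding Fr by (auto simp: r_def)
  have sm: "sublinear m" using m(1) by (simp add: S_def)
  have mini: "q = m" if "sublinear q" "\<forall>x. q x \<le> m x" for q
    by (rule m(2)) (use that m(1) in \<open>auto simp: S_def intro: order_trans\<close>)
  note lin = minimal_sublinear_linear[OF sm mini]
  have bl: "bounded_linear m" and ab: "\<And>x. \<bar>m x\<bar> \<le> norm x" using lin by auto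
  have "m (-w) \<le> p0 (-w)" using m(1) by (simp add: S_def)
  also have "\<dots> \<le> - norm w" unfolding p0_def using sublinear_shift_le[OF sn, of 1 w "-w"] by simp
  finally have "m w \<ge> norm w" using linear_neg[OF bounded_linear.linear[OF bl], of w] by simp
  with ab[of w] have "m w = norm w" by simp
  then show thesis
    using that[of "Blinfun m"] ab bounded_linear_Blinfun_apply[OF bl] by simp
qed

lemma functional_separates:
  fixes x y :: "'a::real_normed_vector"
  assumes "\<And>l::'a \<Rightarrow>\<^sub>L real. blinfun_apply l x = blinfun_apply l y"
  shows "x = y"
proof -
  obtain l :: "'a \<Rightarrow>\<^sub>L real" where "blinfun_apply l (x - y) = norm (x - y)"
    by (rule ex_norming_functional)
  then show ?thesis using assms[of l] by (simp add: blinfun.diff_right)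
qed

lemma norm_le_functional:
  fixes x :: "'a::real_normed_vector"
  assumes "\<And>l::'a \<Rightarrow>\<^sub>L real. (\<And>v. \<bar>blinfun_apply l v\<bar> \<le> norm v) \<Longrightarrow> blinfun_apply l x \<le> b"
  shows "norm x \<le> b"
  by (metis assms ex_norming_functional)

section \<open>Measures are determined by their characteristic functionals\<close>

text \<open>By separability, closed balls are countable intersections of half spaces given by
  norming functionals, and an open set is a countable union of closed balls with rational radii and
  centres in a dense set.\<close>

lemma open_in_sets_if_functionals_measurable:
  fixes M :: "'a::{real_normed_vector,second_countable_topology} measure"
  assumes sp: "space M = UNIV" and l: "\<And>l :: 'a \<Rightarrow>\<^sub>L real. blinfun_apply l \<in> borel_measurable M"
    and U: "open U"
  shows "U \<in> sets M"
proof -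
  obtain D :: "'a set" where D: "countable D" "\<And>X. open X \<Longrightarrow> X \<noteq> {} \<Longrightarrow> \<exists>d\<in>D. d \<in> X"
    by (rule countable_dense_setE) blast
  have "\<exists>l :: 'a \<Rightarrow>\<^sub>L real. blinfun_apply l w = norm w \<and> (\<forall>v. \<bar>blinfun_apply l v\<bar> \<le> norm v)" for w
    by (metis ex_norming_functional)
  then obtain L :: "'a \<Rightarrow> 'a \<Rightarrow>\<^sub>L real"
    where L: "\<And>w. blinfun_apply (L w) w = norm w" "\<And>w v. \<bar>blinfun_apply (L w) v\<bar> \<le> norm v" by metis
  \<comment> \<open>The functionals that norm the points of a dense set suffice, since all of them
    are 1-Lipschitz.\<close>
  have norming: "norm w \<le> r" if *: "\<And>d. d \<in> D \<Longrightarrow> blinfun_apply (L d) w \<le> r" for w r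
  proof (rule field_le_epsilon)
    fix e :: real assume "e > 0"
    obtain d where d: "d \<in> D" "d \<in> ball w (e/2)" using D(2)[of "ball w (e/2)"] \<open>e > 0\<close> by auto
    have "norm w \<le> norm d + norm (w - d)" by norm
    also have "norm d = L d w + L d (d - w)" using L(1)[of d] by (simp add: blinfun.diff_right)
    also have "\<dots> \<le> r + norm (w - d)" using *[OF d(1)] L(2)[of d "d - w"] by (simp add: norm_minus_commute)
    finally show "norm w \<le> r + e" using d(2) by (simp add: dist_norm)
  qed
  have cb: "cball c r \<in> sets M" for c r
  proof -
    have "cball c r = {w \<in> space M. \<forall>d\<in>D. blinfun_apply (L d) w - blinfun_apply (L d) c \<le> r}"
    proof (intro set_eqI iffI)
      fix w assume "w \<in> cball c r"
      moreover have "L d w - L d c \<le> norm (w - c)" for d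
        using L(2)[of d "w - c"] by (simp add: blinfun.diff_right)
      ultimately show "w \<in> {w \<in> space M. \<forall>d\<in>D. blinfun_apply (L d) w - blinfun_apply (L d) c \<le> r}"
        by (force simp: sp dist_norm norm_minus_commute intro: order_trans)
    next
      fix w assume "w \<in> {w \<in> space M. \<forall>d\<in>D. blinfun_apply (L d) w - blinfun_apply (L d) c \<le> r}"
      then have "norm (w - c) \<le> r" by (intro norming) (auto simp: blinfun.diff_right)
      then show "w \<in> cball c r" by (simp add: dist_norm norm_minus_commute)
    qed
    also have "\<dots> \<in> sets M" using D(1) l by measurable
    finally show ?thesis .
  qed
  define J where "J = {(d, q). d \<in> D \<and> q \<in> \<rat> \<and> cball d q \<subseteq> U}"
  have "countable J"
    by (rule countable_subset[of _ "D \<times> \<rat>"]) (auto simp: J_def D(1) countable_rat)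
  have "U = (\<Union>(d, q)\<in>J. cball d q)"
  proof (intro set_eqI iffI)
    fix w assume "w \<in> U"
    then obtain e where e: "e > 0" "ball w e \<subseteq> U" using U open_contains_ball by blast
    \<comment> \<open>Centre within \<open>e/3\<close> of \<open>w\<close>, radius between
      \<open>e/3\<close> and \<open>e/2\<close>: the ball contains \<open>w\<close> and stays within
      \<open>5/6 * e\<close> of it.\<close>
    obtain d where d: "d \<in> D" "d \<in> ball w (e/3)" using D(2)[of "ball w (e/3)"] \<open>e > 0\<close> by auto
    obtain q where q: "q \<in> \<rat>" "e/3 < q" "q < e/2"
      using Rats_dense_in_real[of "e/3" "e/2"] \<open>e > 0\<close> by auto
    have "cball d q \<subseteq> ball w e"
    proof
      fix v assume "v \<in> cball d q"
      then show "v \<in> ball w e" using d q dist_triangle[of w v d] by auto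
    qed
    then have "(d, q) \<in> J" "w \<in> cball d q" using d q e by (auto simp: J_def dist_commute)
    then show "w \<in> (\<Union>(d, q)\<in>J. cball d q)" by blast
  qed (auto simp: J_def)
  then show ?thesis using \<open>countable J\<close> cb by (auto intro!: sets.countable_UN')
qed

text \<open>Normalising the masses reduces this to Levy's uniqueness theorem; the phase
  \<open>\<psi>\<close> supplies sine and cosine, so the hypothesis stays real-valued. The zero
  measure cannot be normalised and is treated first.\<close>

lemma finite_measure_eqI_cos:
  fixes M N :: "real measure"
  assumes "finite_measure M" "finite_measure N" and sets[measurable_cong, simp]: "sets M = sets borel" "sets N = sets borel"
    and eq: "\<And>\<theta> \<psi>. (LINT x|M. cos (\<theta> * x + \<psi>)) = (LINT x|N. cos (\<theta> * x + \<psi>))"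
  shows "M = N"
proof -
  interpret M: finite_measure M by fact
  interpret N: finite_measure N by fact
  have sp: "space M = UNIV" "space N = UNIV" using sets sets_eq_imp_space_eq by force+
  define m where "m = measure M UNIV"
  have m: "measure N UNIV = m" using eq[of 0 0] by (simp add: m_def sp)
  show ?thesis
  proof (cases "m = 0")
    case True
    then have "emeasure M A = 0" "emeasure N A = 0" for A
      using m M.emeasure_eq_measure N.emeasure_eq_measure M.bounded_measure[of A] N.bounded_measure[of A]
      by (auto simp: m_def sp measure_le_0_iff)
    then show ?thesis by (intro measure_eqI) auto
  next
    case False
    then have "m > 0" by (simp add: m_def zero_less_measure_iff)
    define M' N' where "M' = density M (\<lambda>_. ennreal (1/m))" and "N' = density N (\<lambda>_. ennreal (1/m))"
    have intM: "(LINT x|M'. f x) = (LINT x|M. f x) / m" if "f \<in> borel_measurable borel" for f :: "real \<Rightarrow> complex"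
      using that \<open>m > 0\<close> by (simp add: M'_def integral_density scaleR_conv_of_real)
    have intN: "(LINT x|N'. f x) = (LINT x|N. f x) / m" if "f \<in> borel_measurable borel" for f :: "real \<Rightarrow> complex"
      using that \<open>m > 0\<close> by (simp add: N'_def integral_density scaleR_conv_of_real)
    have one: "ennreal (1/m) * ennreal m = 1"
      using \<open>m > 0\<close> by (subst ennreal_mult[symmetric]) auto
    have "prob_space M'"
      by (rule prob_spaceI) (use one in \<open>simp add: M'_def emeasure_density_const M.emeasure_eq_measure sp m_def[symmetric]\<close>)
    moreover have "prob_space N'"
      by (rule prob_spaceI) (use one in \<open>simp add: N'_def emeasure_density_const N.emeasure_eq_measure sp m\<close>)
    ultimately have rd: "real_distribution M'" "real_distribution N'"
      by (auto intro!: real_distribution.intro real_distribution_axioms.intro simp: M'_def N'_def)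
    have c: "(LINT x|K. iexp (t * x)) = complex_of_real (LINT x|K. cos (t * x)) + \<i> * complex_of_real (LINT x|K. sin (t * x))"
      if K: "finite_measure K" "sets K = sets borel" for K :: "real measure" and t
    proof -
      have [measurable_cong]: "sets K = sets borel" by fact
      interpret finite_measure K by fact
      have i: "integrable K (\<lambda>x. cos (t * x))" "integrable K (\<lambda>x. sin (t * x))"
        by (auto intro!: integrable_const_bound[where B=1] simp: measurable_cong_sets[OF K(2) refl])
      have "(LINT x|K. iexp (t * x)) = (LINT x|K. complex_of_real (cos (t * x)) + \<i> * complex_of_real (sin (t * x)))"
        by (intro Bochner_Integration.integral_cong refl) (simp add: complex_eq_iff Re_exp Im_exp)
      also have "\<dots> = complex_of_real (LINT x|K. cos (t * x)) + \<i> * complex_of_real (LINT x|K. sin (t * x))"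
        using i by (subst Bochner_Integration.integral_add) auto
      finally show ?thesis .
    qed
    have s: "(LINT x|M. sin (t * x)) = (LINT x|N. sin (t * x))" for t
      using eq[of t "-pi/2"] by (simp add: cos_diff)
    have "char M' t = char N' t" for t
    proof -
      have "char M' t = (LINT x|M. iexp (t * x)) / m" unfolding char_def by (rule intM) measurable
      also have "(LINT x|M. iexp (t * x)) = (LINT x|N. iexp (t * x))"
        using eq[of t 0] s[of t] c[OF M.finite_measure_axioms] c[OF N.finite_measure_axioms] by simp
      also have "\<dots> / m = char N' t" unfolding char_def by (rule intN[symmetric]) measurable
      finally show ?thesis .
    qed
    then have "M' = N'" by (intro Levy_uniqueness rd) auto
    have undo_scale: "density (density K (\<lambda>_. ennreal (1/m))) (\<lambda>_. ennreal m) = K" for K :: "real measure"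
      using one by (subst density_density_eq) (auto simp: density_1)
    show ?thesis
    proof -
      have "M = density M' (\<lambda>_. ennreal m)" unfolding M'_def by (rule undo_scale[symmetric])
      also have "\<dots> = N" unfolding \<open>M' = N'\<close> N'_def by (rule undo_scale)
      finally show ?thesis .
    qed
  qed
qed

text \<open>Cosines with arbitrary phase carry both the real and the imaginary part of the
  characteristic functional, and a product of two of them is again a sum of such cosines.\<close>

definition same_cf :: "'a::real_normed_vector measure \<Rightarrow> 'a measure \<Rightarrow> bool" where
  "same_cf M N \<longleftrightarrow> finite_measure M \<and> finite_measure N \<and> sets M = sets borel \<and> sets N = sets borel \<and>
     (\<forall>(l::'a \<Rightarrow>\<^sub>L real) \<phi>. (LINT w|M. cos (blinfun_apply l w + \<phi>)) = (LINT w|N. cos (blinfun_apply l w + \<phi>)))"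

lemma measurable_blinfun_apply_borel[measurable]:
  "blinfun_apply (l :: 'a::real_normed_vector \<Rightarrow>\<^sub>L real) \<in> borel_measurable borel"
  by (intro borel_measurable_continuous_onI linear_continuous_on blinfun.bounded_linear_right)

text \<open>The densities \<open>1 + cos (k + \<phi>)\<close> are non-negative, so the one-dimensional uniqueness theorem
  applies to their push-forwards under \<open>l\<close>.\<close>

lemma same_cf_restrict:
  fixes l :: "'a::real_normed_vector \<Rightarrow>\<^sub>L real"
  assumes cf: "same_cf M N" and A[measurable]: "A \<in> sets borel"
  shows "same_cf (density M (indicator (l -` A))) (density N (indicator (l -` A)))"
proof -
  have [measurable_cong, simp]: "sets M = sets borel" "sets N = sets borel" using cf by (auto simp: same_cf_def)
  interpret M: finite_measure M using cf by (simp add: same_cf_def)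
  interpret N: finite_measure N using cf by (simp add: same_cf_def)
  have sp[simp]: "space M = UNIV" "space N = UNIV" using sets_eq_imp_space_eq[of M borel] sets_eq_imp_space_eq[of N borel] by auto
  have eq: "(LINT w|M. cos (blinfun_apply k w + \<phi>)) = (LINT w|N. cos (blinfun_apply k w + \<phi>))" for k :: "'a \<Rightarrow>\<^sub>L real" and \<phi>
    using cf by (simp add: same_cf_def)
  have lA[measurable]: "l -` A \<in> sets borel"
    using measurable_sets[OF measurable_blinfun_apply_borel[of l] A] by simp
  have nn: "0 \<le> 1 + cos t" for t :: real using cos_ge_minus_one[of t] by linarith
  define \<nu> where "\<nu> K k \<phi> = distr (density K (\<lambda>w. ennreal (1 + cos (blinfun_apply k w + \<phi>)))) borel (blinfun_apply l)"
    for K :: "'a measure" and k :: "'a \<Rightarrow>\<^sub>L real" and \<phi>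
  have \<nu>int: "(LINT x|\<nu> K k \<phi>. f x) = (LINT w|K. (1 + cos (blinfun_apply k w + \<phi>)) * f (l w))"
    if "sets K = sets borel" "f \<in> borel_measurable borel" for K k \<phi> and f :: "real \<Rightarrow> real"
  proof -
    have [measurable_cong]: "sets K = sets borel" by fact
    note [measurable] = that(2)
    show ?thesis unfolding \<nu>_def
      by (subst integral_distr, simp, simp) (subst integral_density; simp add: nn)
  qed
  have \<nu>fin: "finite_measure (\<nu> K k \<phi>)" if "finite_measure K" "sets K = sets borel" for K k \<phi>
  proof -
    interpret finite_measure K by fact
    have [measurable_cong]: "sets K = sets borel" by fact
    have "space K = UNIV" using sets_eq_imp_space_eq[OF that(2)] by simp
    have "emeasure (\<nu> K k \<phi>) UNIV = (\<integral>\<^sup>+w. ennreal (1 + cos (blinfun_apply k w + \<phi>)) \<partial>K)"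
      unfolding \<nu>_def by (simp add: emeasure_distr emeasure_density \<open>space K = UNIV\<close>)
    also have "\<dots> \<le> (\<integral>\<^sup>+w. ennreal 2 \<partial>K)"
      by (intro nn_integral_mono ennreal_leI) (use cos_le_one in \<open>simp add: add.commute\<close>)
    also have "\<dots> < \<infinity>" by (simp add: ennreal_mult_less_top emeasure_eq_measure)
    finally show ?thesis by (intro finite_measureI) (simp add: \<nu>_def)
  qed
  have "\<nu> M k \<phi> = \<nu> N k \<phi>" for k \<phi>
  proof (rule finite_measure_eqI_cos)
    show "finite_measure (\<nu> M k \<phi>)" "finite_measure (\<nu> N k \<phi>)"
      by (rule \<nu>fin, use M.finite_measure_axioms N.finite_measure_axioms in simp_all)+
    fix \<theta> \<psi> :: real
    \<comment> \<open>The product formula for cosines turns the density times the test function into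
      cosines of the functionals \<open>\<theta> l\<close> and
      \<open>\<theta> l \<plusminus> k\<close>, whose integrals agree by assumption.\<close>
    have split: "(LINT w|K. (1 + cos (blinfun_apply k w + \<phi>)) * cos (\<theta> * l w + \<psi>)) =
       (LINT w|K. cos (blinfun_apply (\<theta> *\<^sub>R l) w + \<psi>)) + ((LINT w|K. cos (blinfun_apply (\<theta> *\<^sub>R l + k) w + (\<psi> + \<phi>)))
        + (LINT w|K. cos (blinfun_apply (\<theta> *\<^sub>R l - k) w + (\<psi> - \<phi>)))) / 2"
      if "finite_measure K" "sets K = sets borel" for K
    proof -
      interpret finite_measure K by fact
      have i: "integrable K (\<lambda>w. cos (blinfun_apply j w + \<alpha>))" for j :: "'a \<Rightarrow>\<^sub>L real" and \<alpha>
        by (auto intro!: integrable_const_bound[where B=1] simp: measurable_cong_sets[OF that(2) refl])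
      have "(LINT w|K. (1 + cos (blinfun_apply k w + \<phi>)) * cos (\<theta> * l w + \<psi>)) =
        (LINT w|K. cos (blinfun_apply (\<theta> *\<^sub>R l) w + \<psi>) + (cos (blinfun_apply (\<theta> *\<^sub>R l + k) w + (\<psi> + \<phi>))
        + cos (blinfun_apply (\<theta> *\<^sub>R l - k) w + (\<psi> - \<phi>))) / 2)"
      proof (intro Bochner_Integration.integral_cong refl)
        fix w
        have "cos (blinfun_apply k w + \<phi>) * cos (\<theta> * l w + \<psi>) =
          (cos ((\<theta> * l w + \<psi>) - (k w + \<phi>)) + cos ((\<theta> * l w + \<psi>) + (k w + \<phi>))) / 2"
          by (simp add: cos_add cos_diff)
        also have "(\<theta> * l w + \<psi>) - (k w + \<phi>) = blinfun_apply (\<theta> *\<^sub>R l - k) w + (\<psi> - \<phi>)"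
          by (simp add: blinfun.bilinear_simps)
        also have "(\<theta> * l w + \<psi>) + (k w + \<phi>) = blinfun_apply (\<theta> *\<^sub>R l + k) w + (\<psi> + \<phi>)"
          by (simp add: blinfun.bilinear_simps)
        finally show "(1 + cos (blinfun_apply k w + \<phi>)) * cos (\<theta> * l w + \<psi>) = cos (blinfun_apply (\<theta> *\<^sub>R l) w + \<psi>)
           + (cos (blinfun_apply (\<theta> *\<^sub>R l + k) w + (\<psi> + \<phi>)) + cos (blinfun_apply (\<theta> *\<^sub>R l - k) w + (\<psi> - \<phi>))) / 2"
          by (simp add: ring_distribs blinfun.bilinear_simps add.commute)
      qed
      also have "\<dots> = (LINT w|K. cos (blinfun_apply (\<theta> *\<^sub>R l) w + \<psi>)) + ((LINT w|K. cos (blinfun_apply (\<theta> *\<^sub>R l + k) w + (\<psi> + \<phi>)))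
        + (LINT w|K. cos (blinfun_apply (\<theta> *\<^sub>R l - k) w + (\<psi> - \<phi>)))) / 2"
        by (subst Bochner_Integration.integral_add, (auto intro!: i Bochner_Integration.integrable_add)[2])
           (simp add: Bochner_Integration.integral_add[OF i i])
      finally show ?thesis .
    qed
    show "(LINT x|\<nu> M k \<phi>. cos (\<theta> * x + \<psi>)) = (LINT x|\<nu> N k \<phi>. cos (\<theta> * x + \<psi>))"
      by (simp add: \<nu>int split[OF M.finite_measure_axioms] split[OF N.finite_measure_axioms] eq)
  qed (simp_all add: \<nu>_def)
  then have I: "(LINT w|M. (1 + cos (blinfun_apply k w + \<phi>)) * indicator A (l w)) = (LINT w|N. (1 + cos (blinfun_apply k w + \<phi>)) * indicator A (l w))" for k :: "'a \<Rightarrow>\<^sub>L real" and \<phi>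
    using \<nu>int[of M "indicator A" k \<phi>] \<nu>int[of N "indicator A" k \<phi>] by simp
  have two: "(LINT w|K. (1 + cos (blinfun_apply k w + \<phi>)) * indicator A (l w)) =
      (LINT w|K. indicator A (l w)) + (LINT w|density K (indicator (l -` A)). cos (blinfun_apply k w + \<phi>))"
    if "finite_measure K" "sets K = sets borel" for K and k :: "'a \<Rightarrow>\<^sub>L real" and \<phi>
  proof -
    interpret finite_measure K by fact
    note [measurable_cong] = that(2)
    have "integrable K (\<lambda>w. cos (blinfun_apply k w + \<phi>) * indicator A (l w))" "integrable K (\<lambda>w. indicator A (l w) :: real)"
      by (auto intro!: integrable_const_bound[where B=1] simp: indicator_def)
    then have "(LINT w|K. (1 + cos (blinfun_apply k w + \<phi>)) * indicator A (l w)) =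
      (LINT w|K. indicator A (l w)) + (LINT w|K. cos (blinfun_apply k w + \<phi>) * indicator A (l w))"
      by (simp add: ring_distribs)
    also have "(LINT w|K. cos (blinfun_apply k w + \<phi>) * indicator A (l w)) = (LINT w|density K (\<lambda>w. ennreal (indicator (l -` A) w)). cos (blinfun_apply k w + \<phi>))"
      by (subst integral_density) (auto simp: indicator_def intro!: Bochner_Integration.integral_cong)
    also have "density K (\<lambda>w. ennreal (indicator (l -` A) w)) = density K (indicator (l -` A))"
      by (simp add: ennreal_indicator)
    finally show ?thesis .
  qed
  note tM = two[OF M.finite_measure_axioms \<open>sets M = sets borel\<close>]
  note tN = two[OF N.finite_measure_axioms \<open>sets N = sets borel\<close>]
  \<comment> \<open>With \<open>k = 0\<close> and \<open>\<phi> = 0\<close> the density is the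
    constant 2, so the part without cosine agrees and can be subtracted.\<close>
  have base: "(LINT w|M. indicator A (l w) :: real) = (LINT w|N. indicator A (l w))"
    using I[of 0 0] by simp
  have "(LINT w|density M (indicator (l -` A)). cos (blinfun_apply k w + \<phi>)) = (LINT w|density N (indicator (l -` A)). cos (blinfun_apply k w + \<phi>))" for k :: "'a \<Rightarrow>\<^sub>L real" and \<phi>
    using I[of k \<phi>] base unfolding tM tN by simp
  moreover have "finite_measure (density M (indicator (l -` A)))" "finite_measure (density N (indicator (l -` A)))"
    by (auto intro!: finite_measureI simp: emeasure_restricted M.emeasure_eq_measure N.emeasure_eq_measure)
  ultimately show ?thesis by (simp add: same_cf_def)
qed

text \<open>The joint law of several functionals is reached by restricting the measures along one
  functional after the other, so that only the one-dimensional uniqueness theorem is used. The base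
  case is equality of the total masses.\<close>

lemma same_cf_cylinder:
  fixes L :: "('a::real_normed_vector \<Rightarrow>\<^sub>L real) list" and A :: "('a \<Rightarrow>\<^sub>L real) \<Rightarrow> real set"
  assumes "same_cf M N" "\<And>l. l \<in> set L \<Longrightarrow> A l \<in> sets borel"
  shows "emeasure M (\<Inter>l\<in>set L. blinfun_apply l -` A l) = emeasure N (\<Inter>l\<in>set L. blinfun_apply l -` A l)"
  using assms
proof (induction L arbitrary: M N)
  case Nil
  then have sp: "space M = UNIV" "space N = UNIV" using sets_eq_imp_space_eq[of M borel] sets_eq_imp_space_eq[of N borel] by (auto simp: same_cf_def)
  interpret M: finite_measure M using Nil by (simp add: same_cf_def)
  interpret N: finite_measure N using Nil by (simp add: same_cf_def)
  have "(LINT w|M. cos (blinfun_apply (0 :: 'a \<Rightarrow>\<^sub>L real) w + 0)) = (LINT w|N. cos (blinfun_apply (0 :: 'a \<Rightarrow>\<^sub>L real) w + 0))"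
    using Nil unfolding same_cf_def by blast
  then show ?case by (simp add: M.emeasure_eq_measure N.emeasure_eq_measure sp)
next
  case (Cons l L)
  have s[measurable_cong]: "sets M = sets borel" "sets N = sets borel" using Cons by (auto simp: same_cf_def)
  have m[measurable]: "(\<Inter>k\<in>set L. blinfun_apply k -` A k) \<in> sets borel" "blinfun_apply l -` A l \<in> sets borel"
  proof -
    have "blinfun_apply k -` A k \<in> sets borel" if "k \<in> set (l # L)" for k
      using measurable_sets[OF measurable_blinfun_apply_borel[of k] Cons.prems(2)[OF that]] by simp
    then show "(\<Inter>k\<in>set L. blinfun_apply k -` A k) \<in> sets borel" "blinfun_apply l -` A l \<in> sets borel"
      by (cases "L = []"; force intro!: sets.finite_INT)+
  qed
  have "emeasure K (\<Inter>k\<in>set (l # L). blinfun_apply k -` A k) = emeasure (density K (indicator (l -` A l))) (\<Inter>k\<in>set L. blinfun_apply k -` A k)"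
    if "sets K = sets borel" for K
    using m by (subst emeasure_restricted) (auto simp: that Int_commute)
  then show ?case
    using Cons.IH[OF same_cf_restrict[OF Cons.prems(1)], of "A l" l] Cons.prems(2) s by simp
qed

text \<open>Cylinders over finitely many functionals are stable under intersection and, by
  separability, generate the Borel sets.\<close>

theorem measure_eqI_cf:
  fixes M N :: "'a::{real_normed_vector,second_countable_topology} measure"
  assumes cf: "same_cf M N"
  shows "M = N"
proof -
  define cyl :: "('a \<Rightarrow>\<^sub>L real) list \<Rightarrow> (('a \<Rightarrow>\<^sub>L real) \<Rightarrow> real set) \<Rightarrow> 'a set"
    where "cyl L A = (\<Inter>l\<in>set L. blinfun_apply l -` A l)" for L A
  define E where "E = {cyl L A | L A. \<forall>l. A l \<in> sets borel}"
  have sb: "sets M = sets borel" "sets N = sets borel" using cf by (auto simp: same_cf_def)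
  interpret M: finite_measure M using cf by (simp add: same_cf_def)
  have Eb: "E \<subseteq> sets borel"
  proof
    fix X assume "X \<in> E"
    then obtain L A where X: "X = cyl L A" "\<forall>l. A l \<in> sets borel" unfolding E_def by blast
    have "blinfun_apply k -` A k \<in> sets borel" for k
      using measurable_sets[OF measurable_blinfun_apply_borel[of k]] X(2) by simp
    then show "X \<in> sets borel" unfolding X cyl_def by (cases "L = []") (auto intro!: sets.finite_INT)
  qed
  have lm: "blinfun_apply l \<in> borel_measurable (sigma UNIV E)" for l :: "'a \<Rightarrow>\<^sub>L real"
  proof (rule measurableI)
    fix A :: "real set" assume "A \<in> sets borel"
    moreover have "blinfun_apply l -` A = cyl [l] (\<lambda>_. A)" by (simp add: cyl_def)
    ultimately have "blinfun_apply l -` A \<in> E" unfolding E_def by blast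
    then show "blinfun_apply l -` A \<inter> space (sigma UNIV E) \<in> sets (sigma UNIV E)" by auto
  qed auto
  have "sets borel = sigma_sets UNIV E"
  proof
    show "sets borel \<subseteq> sigma_sets UNIV E"
      unfolding borel_def using open_in_sets_if_functionals_measurable[of "sigma UNIV E"] lm
      by (auto simp: sets_measure_of intro!: sigma_sets_mono)
    show "sigma_sets UNIV E \<subseteq> sets borel" using sets.sigma_sets_subset[OF Eb] by simp
  qed
  show ?thesis
  proof (rule measure_eqI_generator_eq[where E=E and A="\<lambda>_. UNIV" and \<Omega>=UNIV])
    show "Int_stable E"
    proof (rule Int_stableI)
      fix X Y assume "X \<in> E" "Y \<in> E"
      then obtain L A L' A' where X: "X = cyl L A" "\<forall>l. A l \<in> sets borel"
       and Y: "Y = cyl L' A'" "\<forall>l. A' l \<in> sets borel" unfolding E_def by blast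
      \<comment> \<open>The two lists may overlap; a functional that occurs in only one of them gets
        \<open>UNIV\<close> from the other.\<close>
      define A'' where "A'' l = (if l \<in> set L then A l else UNIV) \<inter> (if l \<in> set L' then A' l else UNIV)" for l
      have "X \<inter> Y = cyl (L @ L') A''"
        unfolding X Y cyl_def by (auto simp: A''_def split: if_splits)
      moreover have "\<forall>l. A'' l \<in> sets borel" using X Y by (auto simp: A''_def)
      ultimately show "X \<inter> Y \<in> E" unfolding E_def by blast
    qed
    show "emeasure M X = emeasure N X" if X: "X \<in> E" for X
    proof -
      obtain L A where "X = cyl L A" "\<forall>l. A l \<in> sets borel" using X unfolding E_def by blast
      then show ?thesis using same_cf_cylinder[OF cf] by (simp add: cyl_def)
    qed
    have "UNIV = cyl [] (\<lambda>_. UNIV)" by (simp add: cyl_def)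
    then have "UNIV \<in> E" unfolding E_def by (intro CollectI exI conjI) auto
    then show "range (\<lambda>_. UNIV) \<subseteq> E" by auto
  qed (use \<open>sets borel = _\<close> sb in \<open>auto simp: M.emeasure_eq_measure\<close>)
qed

section \<open>Centered Gaussian measures\<close>

text \<open>Used for the Cauchy-Schwarz inequality and, with \<open>F = 0\<close>, to conclude in a
  minimisation that the first variation vanishes. The sign of \<open>G\<close> follows from the
  hypothesis by letting \<open>t\<close> be large.\<close>

lemma quadratic_nonneg_discriminant:
  fixes F I G :: real
  assumes "\<And>t. 0 \<le> F + 2 * t * I + t\<^sup>2 * G"
  shows "I\<^sup>2 \<le> F * G"
proof (cases "G = 0")
  case True
  have "I = 0"
  proof (rule ccontr)
    assume "I \<noteq> 0"
    \<comment> \<open>At this \<open>t\<close> the linear function takes the value -1.\<close>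
    then show False using assms[of "-(F+1)/(2*I)"] True by (simp add: field_simps)
  qed
  then show ?thesis using True by simp
next
  case False
  have "G > 0"
  proof (rule ccontr)
    assume "\<not> G > 0"
    with False have "G < 0" by simp
    \<comment> \<open>At least 1, and so large that \<open>s * - G\<close> exceeds
      \<open>\<bar>F\<bar> + 2 * \<bar>I\<bar>\<close>; then the quadratic term dominates.\<close>
    define s where "s = (\<bar>F\<bar> + 2 * \<bar>I\<bar> + 1) / -G + 1"
    have "s \<ge> 1" "s * -G \<ge> \<bar>F\<bar> + 2 * \<bar>I\<bar> + 1"
      using \<open>G < 0\<close> by (auto simp: s_def field_simps divide_nonneg_neg)
    then have "s * (s * -G) \<ge> s * (\<bar>F\<bar> + 2 * \<bar>I\<bar> + 1)" by (intro mult_left_mono) auto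
    also have "s * (\<bar>F\<bar> + 2 * \<bar>I\<bar> + 1) \<ge> \<bar>F\<bar> + s * (2 * \<bar>I\<bar>) + 1"
      using \<open>s \<ge> 1\<close> mult_right_mono[of 1 s "\<bar>F\<bar> + 1"] by (simp add: algebra_simps)
    finally have "s\<^sup>2 * -G \<ge> \<bar>F\<bar> + s * (2 * \<bar>I\<bar>) + 1" by (simp add: power2_eq_square)
    moreover have "2 * s * I \<le> s * (2 * \<bar>I\<bar>)" using \<open>s \<ge> 1\<close> by simp
    moreover have "F \<le> \<bar>F\<bar>" by simp
    ultimately show False using assms[of s] by (simp add: algebra_simps)
  qed
  then have "F + 2 * (-I/G) * I + (-I/G)\<^sup>2 * G = F - I\<^sup>2 / G"
    by (simp add: field_simps power2_eq_square)
  with assms[of "-I/G"] have "I\<^sup>2 / G \<le> F" by simp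
  then show ?thesis using \<open>G > 0\<close> by (simp add: field_simps)
qed

lemma Cauchy_Schwarz_integral:
  fixes f g :: "'b \<Rightarrow> real"
  assumes [measurable]: "f \<in> borel_measurable M" "g \<in> borel_measurable M"
    and f2: "integrable M (\<lambda>x. (f x)\<^sup>2)" and g2: "integrable M (\<lambda>x. (g x)\<^sup>2)"
  shows "integrable M (\<lambda>x. f x * g x)"
    and "\<bar>LINT x|M. f x * g x\<bar> \<le> sqrt (LINT x|M. (f x)\<^sup>2) * sqrt (LINT x|M. (g x)\<^sup>2)"
proof -
  show fg: "integrable M (\<lambda>x. f x * g x)"
  proof (rule Bochner_Integration.integrable_bound)
    show "integrable M (\<lambda>x. (f x)\<^sup>2 + (g x)\<^sup>2)" using f2 g2 by simp
    have "\<bar>a * b\<bar> \<le> a\<^sup>2 + b\<^sup>2" for a b :: real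
    proof -
      have "2 * (\<bar>a\<bar> * \<bar>b\<bar>) \<le> \<bar>a\<bar>\<^sup>2 + \<bar>b\<bar>\<^sup>2" using sum_squares_bound[of "\<bar>a\<bar>" "\<bar>b\<bar>"] by simp
      moreover have "0 \<le> \<bar>a\<bar> * \<bar>b\<bar>" by simp
      ultimately show ?thesis unfolding abs_mult power2_abs by linarith
    qed
    then show "AE x in M. norm (f x * g x) \<le> norm ((f x)\<^sup>2 + (g x)\<^sup>2)" by simp
  qed simp
  have "0 \<le> (LINT x|M. (f x)\<^sup>2) + 2 * t * (LINT x|M. f x * g x) + t\<^sup>2 * (LINT x|M. (g x)\<^sup>2)" for t
  proof -
    have "0 \<le> (LINT x|M. (f x + t * g x)\<^sup>2)" by simp
    also have "\<dots> = (LINT x|M. ((f x)\<^sup>2 + (2 * t) * (f x * g x)) + t\<^sup>2 * (g x)\<^sup>2)"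
      by (intro Bochner_Integration.integral_cong) (auto simp: power2_eq_square algebra_simps)
    also have "\<dots> = (LINT x|M. (f x)\<^sup>2) + 2 * t * (LINT x|M. f x * g x) + t\<^sup>2 * (LINT x|M. (g x)\<^sup>2)"
      using f2 g2 fg by simp
    finally show ?thesis .
  qed
  then have "(LINT x|M. f x * g x)\<^sup>2 \<le> (LINT x|M. (f x)\<^sup>2) * (LINT x|M. (g x)\<^sup>2)"
    by (rule quadratic_nonneg_discriminant)
  then have "sqrt ((LINT x|M. f x * g x)\<^sup>2) \<le> sqrt ((LINT x|M. (f x)\<^sup>2) * (LINT x|M. (g x)\<^sup>2))"
    by (rule real_sqrt_le_mono)
  then show "\<bar>LINT x|M. f x * g x\<bar> \<le> sqrt (LINT x|M. (f x)\<^sup>2) * sqrt (LINT x|M. (g x)\<^sup>2)"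
    by (simp add: real_sqrt_mult)
qed

section \<open>One-dimensional centered normal laws, including the degenerate one\<close>

lemma centered_normal_eq_distr:
  assumes "\<sigma> \<ge> 0"
  shows "centered_normal \<sigma> = distr std_normal_distribution borel (\<lambda>x. \<sigma> * x)"
proof -
  interpret real_distribution std_normal_distribution by (rule real_dist_normal_dist)
  show ?thesis
  proof (cases "\<sigma> = 0")
    case True
    then show ?thesis by (simp add: centered_normal_def distr_const)
  next
    case False
    then have "\<sigma> > 0" using assms by simp
    have "distributed std_normal_distribution lborel (\<lambda>x. x) std_normal_density"
      unfolding distributed_def by (simp add: distr_id2)
    then have "distributed std_normal_distribution lborel (\<lambda>x. \<sigma> * x) (normal_density 0 \<sigma>)"
      using normal_standard_normal_convert[OF \<open>\<sigma> > 0\<close>, of "\<lambda>x. \<sigma> * x" 0] \<open>\<sigma> > 0\<close> by simp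
    then have "distr std_normal_distribution lborel (\<lambda>x. \<sigma> * x) = density lborel (normal_density 0 \<sigma>)"
      by (simp add: distributed_def)
    moreover have "distr std_normal_distribution lborel (\<lambda>x. \<sigma> * x) = distr std_normal_distribution borel (\<lambda>x. \<sigma> * x)"
      by (intro distr_cong) auto
    ultimately show ?thesis using False by (simp add: centered_normal_def)
  qed
qed

lemma centered_normal_second_moment:
  assumes "\<sigma> \<ge> 0"
  shows "integrable (centered_normal \<sigma>) (\<lambda>x. x\<^sup>2)" "(LINT x|centered_normal \<sigma>. x\<^sup>2) = \<sigma>\<^sup>2"
proof -
  have s: "integrable std_normal_distribution (\<lambda>x. x\<^sup>2)" "(LINT x|std_normal_distribution. x\<^sup>2) = 1"
    using std_normal_distribution_even_moments[of 1] by auto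
  show "integrable (centered_normal \<sigma>) (\<lambda>x. x\<^sup>2)"
    unfolding centered_normal_eq_distr[OF assms] by (subst integrable_distr_eq) (auto simp: power_mult_distrib s)
  show "(LINT x|centered_normal \<sigma>. x\<^sup>2) = \<sigma>\<^sup>2"
    unfolding centered_normal_eq_distr[OF assms] by (subst integral_distr) (auto simp: power_mult_distrib s)
qed

lemma centered_normal_cos:
  assumes "\<sigma> \<ge> 0"
  shows "(LINT x|centered_normal \<sigma>. cos (x + \<phi>)) = exp (- \<sigma>\<^sup>2 / 2) * cos \<phi>"
proof -
  interpret real_distribution std_normal_distribution by (rule real_dist_normal_dist)
  have i: "integrable std_normal_distribution (\<lambda>x. cos (\<sigma> * x))" "integrable std_normal_distribution (\<lambda>x. sin (\<sigma> * x))"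
    by (auto intro!: integrable_const_bound[where B=1])
  have ii: "integrable std_normal_distribution (\<lambda>x. iexp (\<sigma> * x))"
    by (auto intro!: integrable_const_bound[where B=1])
  have c: "(LINT x|std_normal_distribution. iexp (\<sigma> * x)) = complex_of_real (exp (- \<sigma>\<^sup>2 / 2))"
    using char_std_normal_distribution by (simp add: char_def fun_eq_iff)
  have "(LINT x|std_normal_distribution. cos (\<sigma> * x)) = Re (LINT x|std_normal_distribution. iexp (\<sigma> * x))"
    by (subst integral_Re[OF ii, symmetric]) (simp add: Re_exp)
  moreover have "(LINT x|std_normal_distribution. sin (\<sigma> * x)) = Im (LINT x|std_normal_distribution. iexp (\<sigma> * x))"
    by (subst integral_Im[OF ii, symmetric]) (simp add: Im_exp)
  ultimately have "(LINT x|std_normal_distribution. cos (\<sigma> * x)) = exp (- \<sigma>\<^sup>2 / 2)" "(LINT x|std_normal_distribution. sin (\<sigma> * x)) = 0"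
    unfolding c by (simp_all only: Re_complex_of_real Im_complex_of_real)
  then show ?thesis
    unfolding centered_normal_eq_distr[OF assms]
    by (subst integral_distr) (auto simp: cos_add i)
qed

text \<open>The density is at most \<open>1 / (2 * \<sigma>)\<close> and the interval has length
  \<open>2 * r\<close>. The product form also covers \<open>\<sigma> = 0\<close>.\<close>

lemma centered_normal_small_ball:
  assumes "\<sigma> \<ge> 0" "r \<ge> 0"
  shows "\<sigma> * measure (centered_normal \<sigma>) {-r..r} \<le> r"
proof (cases "\<sigma> = 0")
  case True then show ?thesis using assms by simp
next
  case False
  then have "\<sigma> > 0" using assms by simp
  have "2\<^sup>2 \<le> 2 * pi" using pi_gt3 by simp
  then have s2: "2 \<le> sqrt (2 * pi)" by (rule real_le_rsqrt)
  have d: "normal_density 0 \<sigma> x \<le> 1 / (2 * \<sigma>)" for x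
  proof -
    have "2 * \<sigma> \<le> sqrt (2 * pi * \<sigma>\<^sup>2)" using s2 \<open>\<sigma> > 0\<close> by (simp add: real_sqrt_mult)
    then have "1 / sqrt (2 * pi * \<sigma>\<^sup>2) \<le> 1 / (2 * \<sigma>)" using \<open>\<sigma> > 0\<close> by (intro divide_left_mono) auto
    moreover have "exp (- (x - 0)\<^sup>2 / (2 * \<sigma>\<^sup>2)) \<le> 1" by simp
    ultimately have "1 / sqrt (2 * pi * \<sigma>\<^sup>2) * exp (- (x - 0)\<^sup>2 / (2 * \<sigma>\<^sup>2)) \<le> 1 / (2 * \<sigma>) * 1"
      using \<open>\<sigma> > 0\<close> by (intro mult_mono) auto
    then show ?thesis by (simp add: normal_density_def)
  qed
  have "emeasure (centered_normal \<sigma>) {-r..r} = (\<integral>\<^sup>+x. ennreal (normal_density 0 \<sigma> x) * indicator {-r..r} x \<partial>lborel)"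
    using False by (simp add: centered_normal_def emeasure_density)
  also have "\<dots> \<le> (\<integral>\<^sup>+x. ennreal (1 / (2 * \<sigma>)) * indicator {-r..r} x \<partial>lborel)"
    by (intro nn_integral_mono mult_right_mono ennreal_leI d) auto
  also have "\<dots> = ennreal (1 / (2 * \<sigma>)) * ennreal (2 * r)"
    using assms by (subst nn_integral_cmult_indicator) auto
  also have "\<dots> = ennreal (r / \<sigma>)"
    using assms \<open>\<sigma> > 0\<close> by (subst ennreal_mult[symmetric]) auto
  finally have "measure (centered_normal \<sigma>) {-r..r} \<le> r / \<sigma>"
    unfolding measure_def using assms \<open>\<sigma> > 0\<close> by (intro enn2real_leI) auto
  then show ?thesis using \<open>\<sigma> > 0\<close> by (simp add: field_simps)
qed

section \<open>The covariance form on the dual space\<close>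

definition sd :: "'a::{banach,second_countable_topology} measure \<Rightarrow> ('a \<Rightarrow>\<^sub>L real) \<Rightarrow> real" where
  "sd \<mu> l = sqrt (Cov \<mu> l l)"

locale nondegenerate_gaussian_measure =
  fixes \<mu> :: "'a::{banach,second_countable_topology} measure"
  assumes nondegenerate: "nondegenerate_gaussian \<mu>"
begin

sublocale prob_space \<mu>
  using nondegenerate by (simp add: nondegenerate_gaussian_def centered_gaussian_def)

lemma sets_gaussian[measurable_cong, simp]: "sets \<mu> = sets borel"
  using nondegenerate by (simp add: nondegenerate_gaussian_def centered_gaussian_def)

lemma space_gaussian[simp]: "space \<mu> = UNIV"
  using sets_eq_imp_space_eq[OF sets_gaussian] by simp

lemma functional_second_moment: "integrable \<mu> (\<lambda>w. (blinfun_apply l w)\<^sup>2)"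
  and distr_functional: "distr \<mu> borel (blinfun_apply l) = centered_normal (sd \<mu> l)"
  and Cov_self_nonneg: "Cov \<mu> l l \<ge> 0"
proof -
  obtain \<sigma> where \<sigma>: "\<sigma> \<ge> 0" "distr \<mu> borel (blinfun_apply l) = centered_normal \<sigma>"
  proof -
    have "\<forall>l::'a \<Rightarrow>\<^sub>L real. \<exists>\<sigma>\<ge>0. distr \<mu> borel (blinfun_apply l) = centered_normal \<sigma>"
      using nondegenerate unfolding nondegenerate_gaussian_def centered_gaussian_def by (elim conjE)
    from this[rule_format, of l] show ?thesis using that by (elim exE conjE)
  qed
  have "integrable (distr \<mu> borel (blinfun_apply l)) (\<lambda>x. x\<^sup>2)"
    using \<sigma> centered_normal_second_moment by simp
  then show "integrable \<mu> (\<lambda>w. (blinfun_apply l w)\<^sup>2)"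
    by (subst (asm) integrable_distr_eq) auto
  have "Cov \<mu> l l = (LINT x|distr \<mu> borel (blinfun_apply l). x\<^sup>2)"
    by (subst integral_distr) (auto simp: Cov_def power2_eq_square)
  then have "Cov \<mu> l l = \<sigma>\<^sup>2" using \<sigma> centered_normal_second_moment by simp
  then show "distr \<mu> borel (blinfun_apply l) = centered_normal (sd \<mu> l)" "Cov \<mu> l l \<ge> 0"
    using \<sigma> by (auto simp: sd_def)
qed

lemma integrable_functional_mult:
  fixes k l :: "'a \<Rightarrow>\<^sub>L real"
  shows "integrable \<mu> (\<lambda>w. blinfun_apply k w * blinfun_apply l w)"
  by (rule Cauchy_Schwarz_integral(1)[OF _ _ functional_second_moment functional_second_moment]) auto

lemma sd_nonneg: "sd \<mu> l \<ge> 0" and sd_power2: "(sd \<mu> l)\<^sup>2 = Cov \<mu> l l"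
  using Cov_self_nonneg[of l] by (auto simp: sd_def)

lemma sd_power2': "(sd \<mu> l)\<^sup>2 = (LINT w|\<mu>. (blinfun_apply l w)\<^sup>2)"
  unfolding sd_power2 by (simp add: Cov_def power2_eq_square)

lemma Cov_sym: "Cov \<mu> k l = Cov \<mu> l k"
  by (simp add: Cov_def mult.commute)

lemma Cov_add_left: "Cov \<mu> (k + k') l = Cov \<mu> k l + Cov \<mu> k' l"
  by (simp add: Cov_def blinfun.bilinear_simps ring_distribs integrable_functional_mult)

lemma Cov_diff_left: "Cov \<mu> (k - k') l = Cov \<mu> k l - Cov \<mu> k' l"
  by (simp add: Cov_def blinfun.bilinear_simps left_diff_distrib integrable_functional_mult)

lemma Cov_scaleR_left: "Cov \<mu> (r *\<^sub>R k) l = r * Cov \<mu> k l"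
  by (simp add: Cov_def blinfun.bilinear_simps mult.assoc)

lemma Cov_add_right: "Cov \<mu> l (k + k') = Cov \<mu> l k + Cov \<mu> l k'"
  by (metis Cov_sym Cov_add_left)

lemma Cov_diff_right: "Cov \<mu> l (k - k') = Cov \<mu> l k - Cov \<mu> l k'"
  by (metis Cov_sym Cov_diff_left)

lemma Cov_scaleR_right: "Cov \<mu> l (r *\<^sub>R k) = r * Cov \<mu> l k"
  by (metis Cov_sym Cov_scaleR_left)

lemmas Cov_bilinear = Cov_add_left Cov_add_right Cov_diff_left Cov_diff_right Cov_scaleR_left Cov_scaleR_right

lemma abs_Cov_le: "\<bar>Cov \<mu> k l\<bar> \<le> sd \<mu> k * sd \<mu> l"
  using Cauchy_Schwarz_integral(2)[OF _ _ functional_second_moment functional_second_moment, of k l]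
  by (simp add: Cov_def sd_def power2_eq_square)

lemma sd_triangle: "sd \<mu> (k + l) \<le> sd \<mu> k + sd \<mu> l"
proof (rule power2_le_imp_le)
  have "(sd \<mu> (k + l))\<^sup>2 = Cov \<mu> k k + 2 * Cov \<mu> k l + Cov \<mu> l l"
    by (simp add: sd_power2 Cov_bilinear Cov_sym)
  also have "\<dots> \<le> (sd \<mu> k + sd \<mu> l)\<^sup>2"
    using abs_Cov_le[of k l] by (simp add: power2_sum sd_power2)
  finally show "(sd \<mu> (k + l))\<^sup>2 \<le> (sd \<mu> k + sd \<mu> l)\<^sup>2" .
qed (simp add: sd_nonneg)

lemma sd_scaleR: "sd \<mu> (r *\<^sub>R l) = \<bar>r\<bar> * sd \<mu> l"
proof -
  have "sd \<mu> (r *\<^sub>R l) = sqrt (r\<^sup>2 * Cov \<mu> l l)" by (simp add: sd_def Cov_bilinear power2_eq_square mult.assoc)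
  then show ?thesis by (simp add: real_sqrt_mult sd_def)
qed

lemma sd_minus_commute: "sd \<mu> (k - l) = sd \<mu> (l - k)"
  using sd_scaleR[of "-1" "k - l"] by simp

lemma sd_diff_triangle: "sd \<mu> (k - l) \<le> sd \<mu> (k - m) + sd \<mu> (m - l)"
  using sd_triangle[of "k - m" "m - l"] by simp

lemma sd_diff_le: "\<bar>sd \<mu> k - sd \<mu> l\<bar> \<le> sd \<mu> (k - l)"
  using sd_triangle[of "k - l" l] sd_triangle[of "l - k" k] sd_minus_commute[of k l] by simp

text \<open>Non-degeneracy enters here: it makes \<open>Cov\<close> an inner product on the dual
  space, so that a vector is represented by one functional only.\<close>

lemma sd_eq_0_iff: "sd \<mu> l = 0 \<longleftrightarrow> l = 0"
proof
  assume "sd \<mu> l = 0"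
  show "l = 0"
  proof (rule ccontr)
    assume "l \<noteq> 0"
    then obtain \<sigma> where \<sigma>: "\<sigma> > 0" "distr \<mu> borel (blinfun_apply l) = centered_normal \<sigma>"
    proof -
      have "\<forall>l::'a \<Rightarrow>\<^sub>L real. l \<noteq> 0 \<longrightarrow> (\<exists>\<sigma>>0. distr \<mu> borel (blinfun_apply l) = centered_normal \<sigma>)"
        using nondegenerate unfolding nondegenerate_gaussian_def by (elim conjE)
      from this[rule_format, OF \<open>l \<noteq> 0\<close>] show ?thesis using that by (elim exE conjE)
    qed
    then have "centered_normal \<sigma> = centered_normal 0" using distr_functional[of l] \<open>sd \<mu> l = 0\<close> by simp
    then show False
      using centered_normal_second_moment(2)[of \<sigma>] centered_normal_second_moment(2)[of 0] \<sigma>(1) by simp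
  qed
qed (simp add: sd_def Cov_def)

lemma integral_cos_functional:
  "(LINT w|\<mu>. cos (blinfun_apply l w + \<phi>)) = exp (- Cov \<mu> l l / 2) * cos \<phi>"
proof -
  have "(LINT w|\<mu>. cos (blinfun_apply l w + \<phi>)) = (LINT x|distr \<mu> borel (blinfun_apply l). cos (x + \<phi>))"
    by (subst integral_distr) auto
  then show ?thesis
    using centered_normal_cos[OF sd_nonneg, of l \<phi>] by (simp add: distr_functional sd_power2)
qed

lemma small_ball_functional:
  assumes "r \<ge> 0"
  shows "sd \<mu> l * measure \<mu> {w. \<bar>blinfun_apply l w\<bar> \<le> r} \<le> r"
proof -
  have "{w. \<bar>blinfun_apply l w\<bar> \<le> r} = blinfun_apply l -` {-r..r} \<inter> space \<mu>" by auto
  then have "measure \<mu> {w. \<bar>blinfun_apply l w\<bar> \<le> r} = measure (centered_normal (sd \<mu> l)) {-r..r}"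
    by (simp add: distr_functional[symmetric] measure_distr)
  then show ?thesis using centered_normal_small_ball[OF sd_nonneg assms, of l] by simp
qed

text \<open>Weak second moments are uniformly bounded by tightness alone, without Fernique's theorem.\<close>

lemma sd_bounded: "\<exists>C>0. \<forall>l. (\<forall>v. \<bar>blinfun_apply l v\<bar> \<le> norm v) \<longrightarrow> sd \<mu> l \<le> C"
proof -
  have "(\<lambda>n. measure \<mu> (cball 0 (real n))) \<longlonglongrightarrow> measure \<mu> (\<Union>n. cball 0 (real n))"
    by (intro finite_Lim_measure_incseq) (auto simp: incseq_def intro: order_trans)
  moreover have "(\<Union>n. cball (0::'a) (real n)) = space \<mu>" using real_arch_simple by auto
  ultimately have "(\<lambda>n. measure \<mu> (cball 0 (real n))) \<longlonglongrightarrow> 1" using prob_space by simp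
  then have "eventually (\<lambda>n. measure \<mu> (cball 0 (real n)) > 1/2) sequentially"
    by (rule order_tendstoD) simp
  then obtain n where n: "measure \<mu> (cball 0 (real n)) > 1/2" by (auto simp: eventually_sequentially)
  \<comment> \<open>A ball of mass above \<open>1/2\<close> bounds half of \<open>sd\<close> by its
    radius; the additional 1 makes the constant positive.\<close>
  have "sd \<mu> l \<le> 2 * real n + 1" if "\<forall>v. \<bar>blinfun_apply l v\<bar> \<le> norm v" for l
  proof -
    have "measure \<mu> (cball 0 (real n)) \<le> measure \<mu> {w. \<bar>blinfun_apply l w\<bar> \<le> real n}"
      by (rule finite_measure_mono) (use that in \<open>auto intro: order_trans\<close>)
    then have "sd \<mu> l * (1/2) \<le> sd \<mu> l * measure \<mu> {w. \<bar>blinfun_apply l w\<bar> \<le> real n}"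
      using n sd_nonneg by (intro mult_left_mono) auto
    then show ?thesis using small_ball_functional[of "real n" l] by simp
  qed
  then show ?thesis by (intro exI[of _ "2 * real n + 1"]) auto
qed

text \<open>The vector is the mean of \<open>l w *\<^sub>R w\<close>, obtained as the limit of its
  truncations to balls. Tested against \<open>k\<close>, the truncation error is at most
  \<open>sd \<mu> k\<close> times the mean-square tail of \<open>l\<close>, and
  \<open>sd_bounded\<close> makes this uniform over the unit ball of the dual space.\<close>

lemma ex_represents: "\<exists>h. represents \<mu> l h"
proof -
  obtain C where C: "C > 0" "\<And>k. (\<And>v. \<bar>blinfun_apply k v\<bar> \<le> norm v) \<Longrightarrow> sd \<mu> k \<le> C"
    using sd_bounded by metis
  \<comment> \<open>Truncation to a ball bounds the integrand by \<open>n * \<bar>l w\<bar>\<close>,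
    so that the Bochner integral exists.\<close>
  define f where "f n w = (indicator (cball 0 (real n)) w * blinfun_apply l w) *\<^sub>R w" for n :: nat and w
  have l1: "integrable \<mu> (blinfun_apply l)"
    using Cauchy_Schwarz_integral(1)[of "blinfun_apply l" \<mu> "\<lambda>_. 1"] functional_second_moment by simp
  have int: "integrable \<mu> (f n)" for n
  proof (rule Bochner_Integration.integrable_bound)
    show "integrable \<mu> (\<lambda>w. real n * blinfun_apply l w)" using l1 by simp
    have "f n \<in> borel_measurable borel" unfolding f_def
      by (intro borel_measurable_scaleR borel_measurable_times borel_measurable_indicator
          measurable_blinfun_apply_borel measurable_ident_sets) auto
    then show "f n \<in> borel_measurable \<mu>" by (simp add: measurable_cong_sets[OF sets_gaussian refl])
    show "AE w in \<mu>. norm (f n w) \<le> norm (real n * blinfun_apply l w)"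
      by (auto simp: f_def indicator_def abs_mult mult.commute intro!: mult_right_mono)
  qed
  have [measurable]: "cball (0::'a) (real n) \<in> sets borel" for n by (rule borel_closed) simp
  define h where "h n = (LINT w|\<mu>. f n w)" for n
  define T where "T n = (LINT w|\<mu>. (indicator (- cball 0 (real n)) w * blinfun_apply l w)\<^sup>2)" for n :: nat
  have kh: "blinfun_apply k (h n) = (LINT w|\<mu>. (indicator (cball 0 (real n)) w * blinfun_apply l w) * blinfun_apply k w)" for k n
    unfolding h_def using integral_bounded_linear[OF blinfun.bounded_linear_right int, of k n]
    by (simp add: f_def blinfun.scaleR_right)
  have i2: "integrable \<mu> (\<lambda>w. (indicator A w * blinfun_apply l w)\<^sup>2)" if [measurable]: "A \<in> sets borel" for A
    by (rule Bochner_Integration.integrable_bound[OF functional_second_moment[of l]])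
       (auto simp: indicator_def)
  have tail: "\<bar>Cov \<mu> l k - blinfun_apply k (h n)\<bar> \<le> sqrt (T n) * sd \<mu> k" for k n
  proof -
    have int1: "integrable \<mu> (\<lambda>w. (indicator (cball 0 (real n)) w * blinfun_apply l w) * blinfun_apply k w)"
      by (rule Cauchy_Schwarz_integral(1)[OF _ _ i2 functional_second_moment]) auto
    have "Cov \<mu> l k - blinfun_apply k (h n) = (LINT w|\<mu>. (indicator (- cball 0 (real n)) w * blinfun_apply l w) * blinfun_apply k w)"
      unfolding Cov_def kh
      by (subst Bochner_Integration.integral_diff[OF integrable_functional_mult int1, symmetric])
         (auto intro!: Bochner_Integration.integral_cong simp: indicator_def)
    also have "\<bar>\<dots>\<bar> \<le> sqrt (T n) * sqrt (LINT w|\<mu>. (blinfun_apply k w)\<^sup>2)"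
      unfolding T_def by (intro Cauchy_Schwarz_integral(2) i2 functional_second_moment) auto
    finally show ?thesis by (simp add: sd_def Cov_def power2_eq_square)
  qed
  have "T \<longlonglongrightarrow> (LINT w|\<mu>. 0)"
    unfolding T_def
  proof (rule integral_dominated_convergence[where w="\<lambda>w. (blinfun_apply l w)\<^sup>2"])
    show "AE w in \<mu>. (\<lambda>n. (indicator (- cball 0 (real n)) w * blinfun_apply l w)\<^sup>2) \<longlonglongrightarrow> 0"
    proof (rule AE_I2)
      fix w :: 'a
      obtain n0 :: nat where n0: "norm w \<le> real n0" using real_arch_simple by blast
      show "(\<lambda>n. (indicator (- cball 0 (real n)) w * blinfun_apply l w)\<^sup>2) \<longlonglongrightarrow> 0"
        by (rule tendsto_eventually, rule eventually_sequentiallyI[of n0]) (use n0 in \<open>auto simp: indicator_def\<close>)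
    qed
  qed (auto simp: functional_second_moment indicator_def)
  then have T0: "(\<lambda>n. sqrt (T n)) \<longlonglongrightarrow> 0" using tendsto_real_sqrt by fastforce
  have d: "norm (h n - h m) \<le> (sqrt (T n) + sqrt (T m)) * C" for n m
  proof (rule norm_le_functional)
    fix k :: "'a \<Rightarrow>\<^sub>L real" assume k: "\<And>v. \<bar>blinfun_apply k v\<bar> \<le> norm v"
    have "sqrt (T j) * sd \<mu> k \<le> sqrt (T j) * C" for j
      using C(2)[OF k] by (intro mult_left_mono) (auto simp: T_def)
    then have "\<bar>Cov \<mu> l k - blinfun_apply k (h n)\<bar> \<le> sqrt (T n) * C" "\<bar>Cov \<mu> l k - blinfun_apply k (h m)\<bar> \<le> sqrt (T m) * C"
      using tail order_trans by blast+
    then show "blinfun_apply k (h n - h m) \<le> (sqrt (T n) + sqrt (T m)) * C"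
      by (simp add: blinfun.diff_right ring_distribs)
  qed
  have "Cauchy h"
  proof (rule metric_CauchyI)
    fix e :: real assume "e > 0"
    then have "eventually (\<lambda>n. sqrt (T n) < e / (2 * C)) sequentially"
      using order_tendstoD(2)[OF T0, of "e / (2*C)"] C by simp
    then obtain N where N: "\<And>n. n \<ge> N \<Longrightarrow> sqrt (T n) < e / (2 * C)" by (auto simp: eventually_sequentially)
    have "dist (h m) (h n) < e" if "m \<ge> N" "n \<ge> N" for m n
    proof -
      have "(sqrt (T m) + sqrt (T n)) * C < (e / (2*C) + e / (2*C)) * C"
        using N that C by (intro mult_strict_right_mono add_strict_mono) auto
      then show ?thesis using d[of m n] C by (simp add: dist_norm)
    qed
    then show "\<exists>M. \<forall>m\<ge>M. \<forall>n\<ge>M. dist (h m) (h n) < e" by blast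
  qed
  then obtain H where H: "h \<longlonglongrightarrow> H" by (auto simp: convergent_eq_Cauchy[symmetric])
  have "Cov \<mu> l k = blinfun_apply k H" for k
  proof (rule LIMSEQ_unique)
    show "(\<lambda>n. blinfun_apply k (h n)) \<longlonglongrightarrow> blinfun_apply k H"
      using H by (intro tendsto_intros)
    have "(\<lambda>n. blinfun_apply k (h n) - Cov \<mu> l k) \<longlonglongrightarrow> 0"
      by (rule Lim_null_comparison[where g="\<lambda>n. sqrt (T n) * sd \<mu> k"])
         (use tail T0 in \<open>auto simp: abs_minus_commute intro: tendsto_mult_left_zero\<close>)
    then show "(\<lambda>n. blinfun_apply k (h n)) \<longlonglongrightarrow> Cov \<mu> l k" by (simp add: LIM_zero_iff)
  qed
  then show ?thesis by (auto simp: represents_def)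
qed

text \<open>Continuity of the embedding into the Banach space; it turns \<open>sd\<close>-Cauchy
  sequences of functionals into convergent sequences of vectors.\<close>

lemma represents_norm_le: "\<exists>C>0. \<forall>l h. represents \<mu> l h \<longrightarrow> norm h \<le> C * sd \<mu> l"
proof -
  obtain C where C: "C > 0" "\<And>k. (\<And>v. \<bar>blinfun_apply k v\<bar> \<le> norm v) \<Longrightarrow> sd \<mu> k \<le> C"
    using sd_bounded by metis
  have "norm h \<le> C * sd \<mu> l" if h: "represents \<mu> l h" for l h
  proof (rule norm_le_functional)
    fix k :: "'a \<Rightarrow>\<^sub>L real" assume k: "\<And>v. \<bar>blinfun_apply k v\<bar> \<le> norm v"
    have "blinfun_apply k h \<le> sd \<mu> l * sd \<mu> k" using h abs_Cov_le[of l k] by (simp add: represents_def)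
    also have "\<dots> \<le> C * sd \<mu> l" using C(2)[OF k] sd_nonneg[of l] by (simp add: mult.commute mult_right_mono)
    finally show "blinfun_apply k h \<le> C * sd \<mu> l" .
  qed
  then show ?thesis using C by blast
qed

end

section \<open>The Cameron-Martin space\<close>

context nondegenerate_gaussian_measure
begin

lemma sd_zero[simp]: "sd \<mu> 0 = 0"
  by (simp add: sd_eq_0_iff)

lemma represents_unique:
  assumes "represents \<mu> k h" "represents \<mu> k' h"
  shows "k = k'"
proof -
  have "Cov \<mu> (k - k') (k - k') = 0" using assms by (simp add: Cov_diff_left represents_def)
  then show ?thesis using sd_eq_0_iff[of "k - k'"] by (simp add: sd_def)
qed

lemma cm_star_eq: "represents \<mu> k h \<Longrightarrow> cm_star \<mu> h = k"
  unfolding cm_star_def by (rule some_equality) (auto intro: represents_unique)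

lemma represents_cm_star: "h \<in> pre_cm_space \<mu> \<Longrightarrow> represents \<mu> (cm_star \<mu> h) h"
  using cm_star_eq by (auto simp: pre_cm_space_def)

lemma represents_diff: "represents \<mu> k h \<Longrightarrow> represents \<mu> k' h' \<Longrightarrow> represents \<mu> (k - k') (h - h')"
  by (simp add: represents_def Cov_diff_left blinfun.diff_right)

text \<open>From here on Cauchy sequences are handled through functionals: representation is linear
  and carries \<open>sd\<close> to the norm.\<close>

lemma pre_cm_norm_eq: "represents \<mu> k h \<Longrightarrow> pre_cm_norm \<mu> h = sd \<mu> k"
  by (simp add: pre_cm_norm_def pre_cm_inner_def cm_star_eq sd_def)

lemma pre_cm_norm_diff:
  assumes "h \<in> pre_cm_space \<mu>" "h' \<in> pre_cm_space \<mu>"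
  shows "pre_cm_norm \<mu> (h - h') = sd \<mu> (cm_star \<mu> h - cm_star \<mu> h')"
  by (intro pre_cm_norm_eq represents_diff represents_cm_star assms)

lemma cm_cauchy_to_iff:
  "cm_cauchy_to \<mu> u h \<longleftrightarrow> (\<forall>n. u n \<in> pre_cm_space \<mu>) \<and>
     (\<forall>e>0. \<exists>n0. \<forall>m\<ge>n0. \<forall>n\<ge>n0. sd \<mu> (cm_star \<mu> (u m) - cm_star \<mu> (u n)) < e) \<and> u \<longlonglongrightarrow> h"
  unfolding cm_cauchy_to_def using pre_cm_norm_diff by (intro conj_cong refl) simp

lemma cm_cauchy_to_diff:
  assumes u: "cm_cauchy_to \<mu> u h" and v: "cm_cauchy_to \<mu> v h'"
  shows "cm_cauchy_to \<mu> (\<lambda>n. u n - v n) (h - h')"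
  unfolding cm_cauchy_to_iff
proof (intro conjI allI impI)
  have up: "u n \<in> pre_cm_space \<mu>" and vp: "v n \<in> pre_cm_space \<mu>" for n using u v by (auto simp: cm_cauchy_to_iff)
  have r: "represents \<mu> (cm_star \<mu> (u n) - cm_star \<mu> (v n)) (u n - v n)" for n
    by (intro represents_diff represents_cm_star up vp)
  show "u n - v n \<in> pre_cm_space \<mu>" for n using r by (auto simp: pre_cm_space_def)
  show "(\<lambda>n. u n - v n) \<longlonglongrightarrow> h - h'" using u v by (intro tendsto_diff) (auto simp: cm_cauchy_to_iff)
  fix e :: real assume "e > 0"
  then obtain a b where a: "\<forall>m\<ge>a. \<forall>n\<ge>a. sd \<mu> (cm_star \<mu> (u m) - cm_star \<mu> (u n)) < e/2"
    and b: "\<forall>m\<ge>b. \<forall>n\<ge>b. sd \<mu> (cm_star \<mu> (v m) - cm_star \<mu> (v n)) < e/2"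
    using u v unfolding cm_cauchy_to_iff by (meson half_gt_zero)
  show "\<exists>n0. \<forall>m\<ge>n0. \<forall>n\<ge>n0. sd \<mu> (cm_star \<mu> (u m - v m) - cm_star \<mu> (u n - v n)) < e"
  proof (intro exI[of _ "max a b"] allI impI)
    fix m n assume mn: "m \<ge> max a b" "n \<ge> max a b"
    have "sd \<mu> (cm_star \<mu> (u m - v m) - cm_star \<mu> (u n - v n)) =
      sd \<mu> ((cm_star \<mu> (u m) - cm_star \<mu> (u n)) + (cm_star \<mu> (v n) - cm_star \<mu> (v m)))"
      by (simp add: cm_star_eq[OF r] algebra_simps)
    also have "\<dots> \<le> sd \<mu> (cm_star \<mu> (u m) - cm_star \<mu> (u n)) + sd \<mu> (cm_star \<mu> (v n) - cm_star \<mu> (v m))"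
      by (rule sd_triangle)
    also have "\<dots> < e/2 + e/2" using a b mn by (intro add_strict_mono) auto
    finally show "sd \<mu> (cm_star \<mu> (u m - v m) - cm_star \<mu> (u n - v n)) < e" by simp
  qed
qed

text \<open>This is the injectivity of the map from the completion into the Banach space.\<close>

lemma cm_cauchy_to_0:
  assumes u: "cm_cauchy_to \<mu> u 0"
  shows "(\<lambda>n. sd \<mu> (cm_star \<mu> (u n))) \<longlonglongrightarrow> 0"
proof (rule LIMSEQ_I)
  fix e :: real assume "e > 0"
  define k where "k n = cm_star \<mu> (u n)" for n
  have r: "represents \<mu> (k n) (u n)" for n using u represents_cm_star by (simp add: cm_cauchy_to_iff k_def)
  obtain n0 where n0: "\<And>m n. m \<ge> n0 \<Longrightarrow> n \<ge> n0 \<Longrightarrow> sd \<mu> (k m - k n) < e/2"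
    using u \<open>e > 0\<close> unfolding cm_cauchy_to_iff k_def by (meson half_gt_zero)
  have "norm (sd \<mu> (k n) - 0) < e" if n: "n \<ge> n0" for n
  proof -
    define b where "b = sd \<mu> (k n)"
    have "b \<ge> 0" by (simp add: b_def sd_nonneg)
    \<comment> \<open>One factor \<open>k n\<close> is exchanged for \<open>k m\<close>: the error
      is small by the Cauchy property, and the remaining covariance is \<open>k n (u m)\<close>,
      which vanishes as \<open>u m\<close> tends to 0 in the Banach space.\<close>
    have "b\<^sup>2 \<le> b * (e/2) + \<bar>blinfun_apply (k n) (u m)\<bar>" if "m \<ge> n0" for m
    proof -
      have "b\<^sup>2 = Cov \<mu> (k n) (k n - k m) + Cov \<mu> (k m) (k n)"
        by (simp add: b_def sd_power2 Cov_diff_right Cov_sym)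
      also have "Cov \<mu> (k m) (k n) = blinfun_apply (k n) (u m)" using r by (simp add: represents_def)
      finally have "b\<^sup>2 \<le> b * sd \<mu> (k n - k m) + \<bar>blinfun_apply (k n) (u m)\<bar>"
        using abs_Cov_le[of "k n" "k n - k m"] by (simp add: b_def)
      moreover have "b * sd \<mu> (k n - k m) \<le> b * (e/2)"
        using n0[OF n that] \<open>b \<ge> 0\<close> by (intro mult_left_mono) auto
      ultimately show ?thesis by linarith
    qed
    moreover have "(\<lambda>m. b * (e/2) + \<bar>blinfun_apply (k n) (u m)\<bar>) \<longlonglongrightarrow> b * (e/2) + \<bar>blinfun_apply (k n) 0\<bar>"
      using u by (intro tendsto_intros) (auto simp: cm_cauchy_to_iff)
    ultimately have "b\<^sup>2 \<le> b * (e/2)"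
      by (intro LIMSEQ_le_const[where X="\<lambda>m. b * (e/2) + \<bar>blinfun_apply (k n) (u m)\<bar>"]) auto
    then have "b \<le> e/2" using \<open>b \<ge> 0\<close> \<open>e > 0\<close> by (cases "b = 0") (auto simp: power2_eq_square)
    then show ?thesis using \<open>b \<ge> 0\<close> \<open>e > 0\<close> by (simp add: b_def)
  qed
  then show "\<exists>no. \<forall>n\<ge>no. norm (sd \<mu> (cm_star \<mu> (u n)) - 0) < e" by (auto simp: k_def)
qed


text \<open>The limit exists because \<open>sd\<close> satisfies the triangle inequality, and two
  sequences with the same limit in the Banach space differ by one that \<open>cm_cauchy_to_0\<close>
  controls. So the \<open>THE\<close> in \<open>cm_norm\<close> is well defined.\<close>

lemma cm_norm_tendsto:
  assumes u: "cm_cauchy_to \<mu> u h"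
  shows "(\<lambda>n. sd \<mu> (cm_star \<mu> (u n))) \<longlonglongrightarrow> cm_norm \<mu> h"
proof -
  have pn: "pre_cm_norm \<mu> (v n) = sd \<mu> (cm_star \<mu> (v n))" if "cm_cauchy_to \<mu> v h" for v n
    using that by (intro pre_cm_norm_eq represents_cm_star) (simp add: cm_cauchy_to_iff)
  have "Cauchy (\<lambda>n. sd \<mu> (cm_star \<mu> (u n)))"
  proof (rule metric_CauchyI)
    fix e :: real assume "e > 0"
    then obtain n0 where n0: "\<forall>m\<ge>n0. \<forall>n\<ge>n0. sd \<mu> (cm_star \<mu> (u m) - cm_star \<mu> (u n)) < e"
      using u unfolding cm_cauchy_to_iff by meson
    then show "\<exists>M. \<forall>m\<ge>M. \<forall>n\<ge>M. dist (sd \<mu> (cm_star \<mu> (u m))) (sd \<mu> (cm_star \<mu> (u n))) < e"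
      unfolding dist_real_def using sd_diff_le le_less_trans by blast
  qed
  then obtain r where r: "(\<lambda>n. sd \<mu> (cm_star \<mu> (u n))) \<longlonglongrightarrow> r"
    by (auto simp: Cauchy_convergent_iff convergent_def)
  have "cm_norm \<mu> h = r"
    unfolding cm_norm_def
  proof (rule the_equality)
    show "\<exists>u. cm_cauchy_to \<mu> u h \<and> (\<lambda>n. pre_cm_norm \<mu> (u n)) \<longlonglongrightarrow> r"
      using u r pn[OF u] by auto
    fix r' assume "\<exists>v. cm_cauchy_to \<mu> v h \<and> (\<lambda>n. pre_cm_norm \<mu> (v n)) \<longlonglongrightarrow> r'"
    then obtain v where v: "cm_cauchy_to \<mu> v h" and r': "(\<lambda>n. sd \<mu> (cm_star \<mu> (v n))) \<longlonglongrightarrow> r'"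
      using pn by auto
    have rep: "cm_star \<mu> (v n - u n) = cm_star \<mu> (v n) - cm_star \<mu> (u n)" for n
      using u v by (intro cm_star_eq represents_diff represents_cm_star) (auto simp: cm_cauchy_to_iff)
    have "(\<lambda>n. sd \<mu> (cm_star \<mu> (v n) - cm_star \<mu> (u n))) \<longlonglongrightarrow> 0"
      using cm_cauchy_to_0[of "\<lambda>n. v n - u n"] cm_cauchy_to_diff[OF v u] by (simp add: rep)
    then have "(\<lambda>n. sd \<mu> (cm_star \<mu> (v n)) - sd \<mu> (cm_star \<mu> (u n))) \<longlonglongrightarrow> 0"
      by (rule Lim_null_comparison[rotated]) (simp add: sd_diff_le)
    then show "r' = r" using tendsto_diff[OF r' r] LIMSEQ_unique by fastforce
  qed
  with r show ?thesis by simp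
qed

lemma cm_norm_diff_tendsto:
  assumes v: "cm_cauchy_to \<mu> v x" and w: "w \<in> pre_cm_space \<mu>"
  shows "(\<lambda>m. sd \<mu> (cm_star \<mu> w - cm_star \<mu> (v m))) \<longlonglongrightarrow> cm_norm \<mu> (w - x)"
proof -
  have rep: "cm_star \<mu> (w - v n) = cm_star \<mu> w - cm_star \<mu> (v n)" for n
    using w v by (intro cm_star_eq represents_diff represents_cm_star) (auto simp: cm_cauchy_to_iff)
  have "cm_cauchy_to \<mu> (\<lambda>_. w) w" using w by (auto simp: cm_cauchy_to_iff)
  from cm_norm_tendsto[OF cm_cauchy_to_diff[OF this v]] show ?thesis by (simp add: rep)
qed

lemma cm_space_approx:
  assumes "x \<in> cm_space \<mu>"
  shows "\<exists>u. (\<forall>n. u n \<in> pre_cm_space \<mu>) \<and> (\<lambda>n. cm_norm \<mu> (u n - x)) \<longlonglongrightarrow> 0"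
proof -
  obtain v where v: "cm_cauchy_to \<mu> v x" using assms by (auto simp: cm_space_def)
  have vp: "v n \<in> pre_cm_space \<mu>" for n using v by (simp add: cm_cauchy_to_iff)
  have "(\<lambda>n. cm_norm \<mu> (v n - x)) \<longlonglongrightarrow> 0"
  proof (rule LIMSEQ_I)
    fix e :: real assume "e > 0"
    then obtain n0 where n0: "\<And>m n. m \<ge> n0 \<Longrightarrow> n \<ge> n0 \<Longrightarrow> sd \<mu> (cm_star \<mu> (v m) - cm_star \<mu> (v n)) < e/2"
      using v unfolding cm_cauchy_to_iff by (meson half_gt_zero)
    have "norm (cm_norm \<mu> (v n - x) - 0) < e" if "n \<ge> n0" for n
    proof -
      have t: "(\<lambda>m. sd \<mu> (cm_star \<mu> (v n) - cm_star \<mu> (v m))) \<longlonglongrightarrow> cm_norm \<mu> (v n - x)"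
        by (rule cm_norm_diff_tendsto[OF v vp])
      have "cm_norm \<mu> (v n - x) \<le> e/2"
        by (rule LIMSEQ_le_const2[OF t]) (use n0[OF that] in \<open>auto intro: less_imp_le\<close>)
      moreover have "cm_norm \<mu> (v n - x) \<ge> 0"
        by (rule LIMSEQ_le_const[OF t]) (auto simp: sd_nonneg)
      ultimately show ?thesis using \<open>e > 0\<close> by simp
    qed
    then show "\<exists>no. \<forall>n\<ge>no. norm (cm_norm \<mu> (v n - x) - 0) < e" by blast
  qed
  then show ?thesis using vp by blast
qed

text \<open>Each bound is the limit of an inequality for functionals along a Cauchy sequence
  \<open>v\<close> that defines \<open>x\<close>. The sequence \<open>u\<close> is arbitrary, since
  a pairing may come with any approximating sequence.\<close>

lemma cm_approx_bounds:
  assumes x: "x \<in> cm_space \<mu>" and u: "\<And>n. u n \<in> pre_cm_space \<mu>"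
  defines "k \<equiv> \<lambda>n. cm_star \<mu> (u n)"
  shows "cm_norm \<mu> (u n - x) \<ge> 0"
    and "sd \<mu> (k n - k m) \<le> cm_norm \<mu> (u n - x) + cm_norm \<mu> (u m - x)"
    and "\<bar>Cov \<mu> (k n) l - blinfun_apply l x\<bar> \<le> cm_norm \<mu> (u n - x) * sd \<mu> l"
    and "\<bar>sd \<mu> (k n) - cm_norm \<mu> x\<bar> \<le> cm_norm \<mu> (u n - x)"
proof -
  obtain v where v: "cm_cauchy_to \<mu> v x" using x by (auto simp: cm_space_def)
  have t: "(\<lambda>m. sd \<mu> (k n - cm_star \<mu> (v m))) \<longlonglongrightarrow> cm_norm \<mu> (u n - x)" for n
    unfolding k_def by (rule cm_norm_diff_tendsto[OF v u])
  show "cm_norm \<mu> (u n - x) \<ge> 0"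
    by (rule LIMSEQ_le_const[OF t]) (auto simp: sd_nonneg)
  show "sd \<mu> (k n - k m) \<le> cm_norm \<mu> (u n - x) + cm_norm \<mu> (u m - x)"
    by (rule LIMSEQ_le_const[OF tendsto_add[OF t t]])
       (use sd_diff_triangle[of "k n" "k m"] sd_minus_commute[of "k m"] in auto)
  have "(\<lambda>m. blinfun_apply l (v m)) \<longlonglongrightarrow> blinfun_apply l x"
    using v by (intro tendsto_intros) (simp add: cm_cauchy_to_iff)
  moreover have "Cov \<mu> (cm_star \<mu> (v m)) l = blinfun_apply l (v m)" for m
    using represents_cm_star[of "v m"] v by (simp add: cm_cauchy_to_iff represents_def)
  ultimately have c: "(\<lambda>m. Cov \<mu> (cm_star \<mu> (v m)) l) \<longlonglongrightarrow> blinfun_apply l x" by simp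
  show "\<bar>Cov \<mu> (k n) l - blinfun_apply l x\<bar> \<le> cm_norm \<mu> (u n - x) * sd \<mu> l"
    by (rule LIMSEQ_le[OF tendsto_rabs[OF tendsto_diff[OF tendsto_const c]] tendsto_mult[OF t tendsto_const]])
       (use abs_Cov_le[of _ l] in \<open>auto simp: Cov_diff_left[symmetric]\<close>)
  show "\<bar>sd \<mu> (k n) - cm_norm \<mu> x\<bar> \<le> cm_norm \<mu> (u n - x)"
    by (rule LIMSEQ_le[OF tendsto_rabs[OF tendsto_diff[OF tendsto_const cm_norm_tendsto[OF v]]] t])
       (use sd_diff_le in auto)
qed

text \<open>Minimising \<open>l \<mapsto> Cov l l / 2 - l x\<close> replaces the Riesz representation theorem in the closure
  of the dual space in \<open>L\<^sup>2\<close>.\<close>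

theorem cm_spaceI:
  assumes bound: "\<And>l. blinfun_apply l x \<le> C * sd \<mu> l"
  shows "x \<in> cm_space \<mu>"
proof -
  define J where "J l = Cov \<mu> l l / 2 - blinfun_apply l x" for l
  have low: "- C\<^sup>2 / 2 \<le> J l" for l
  proof -
    have "0 \<le> (sd \<mu> l - C)\<^sup>2" by simp
    then have "C * sd \<mu> l \<le> Cov \<mu> l l / 2 + C\<^sup>2 / 2" by (simp add: power2_diff sd_power2 mult.commute)
    then show ?thesis using bound[of l] by (simp add: J_def)
  qed
  define I where "I = (INF l. J l)"
  have bdd: "bdd_below (range J)" by (rule bdd_belowI2[OF low])
  have I: "I \<le> J l" for l unfolding I_def by (rule cINF_lower[OF bdd]) simp
  have "\<exists>l. J l < I + 1 / real (Suc n)" for n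
    using cINF_less_iff[OF _ bdd, of "I + 1 / real (Suc n)"] by (simp add: I_def)
  then obtain k where k: "\<And>n. J (k n) < I + 1 / real (Suc n)" by metis
  have cau: "(sd \<mu> (k m - k n))\<^sup>2 \<le> 4 * (1 / real (Suc m) + 1 / real (Suc n))" for m n
  proof -
    \<comment> \<open>Parallelogram identity: the midpoint of two near-minimisers cannot lie below
      the infimum, so they are close to each other.\<close>
    have "(sd \<mu> (k m - k n))\<^sup>2 / 4 = J (k m) + J (k n) - 2 * J ((1/2) *\<^sub>R (k m + k n))"
      by (simp add: J_def sd_power2 Cov_bilinear Cov_sym[of "k n" "k m"] blinfun.bilinear_simps field_simps)
    then show ?thesis using I[of "(1/2) *\<^sub>R (k m + k n)"] k[of m] k[of n] by simp
  qed
  have sdC: "\<exists>n0. \<forall>m\<ge>n0. \<forall>n\<ge>n0. sd \<mu> (k m - k n) < e" if "e > 0" for e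
  proof -
    obtain n0 :: nat where n0: "8 / e\<^sup>2 < real n0" using reals_Archimedean2 by blast
    have "sd \<mu> (k m - k n) < e" if "m \<ge> n0" "n \<ge> n0" for m n
    proof (rule power2_less_imp_less)
      have "1 / real (Suc j) < e\<^sup>2 / 8" if "j \<ge> n0" for j
      proof -
        have "8 / e\<^sup>2 < real (Suc j)" using n0 that by simp
        then show ?thesis using \<open>e > 0\<close> by (simp add: field_simps)
      qed
      from this[OF that(1)] this[OF that(2)] cau[of m n] show "(sd \<mu> (k m - k n))\<^sup>2 < e\<^sup>2" by simp
    qed (use \<open>e > 0\<close> in simp)
    then show ?thesis by blast
  qed
  obtain h where h: "\<And>n. represents \<mu> (k n) (h n)"
    using choice[of "\<lambda>n h. represents \<mu> (k n) h"] ex_represents by blast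
  obtain D where D: "D > 0" "\<And>l h. represents \<mu> l h \<Longrightarrow> norm h \<le> D * sd \<mu> l"
    using represents_norm_le by metis
  have "Cauchy h"
  proof (rule metric_CauchyI)
    fix e :: real assume "e > 0"
    then obtain n0 where n0: "\<forall>m\<ge>n0. \<forall>n\<ge>n0. sd \<mu> (k m - k n) < e / D" using sdC[of "e / D"] D by auto
    have "dist (h m) (h n) < e" if "m \<ge> n0" "n \<ge> n0" for m n
    proof -
      have "norm (h m - h n) \<le> D * sd \<mu> (k m - k n)" by (intro D represents_diff h)
      also have "\<dots> < D * (e / D)" using n0 that D by (intro mult_strict_left_mono) auto
      finally show ?thesis using D by (simp add: dist_norm)
    qed
    then show "\<exists>M. \<forall>m\<ge>M. \<forall>n\<ge>M. dist (h m) (h n) < e" by blast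
  qed
  then obtain H where H: "h \<longlonglongrightarrow> H" by (auto simp: convergent_eq_Cauchy[symmetric])
  have "blinfun_apply l H = blinfun_apply l x" for l :: "'a \<Rightarrow>\<^sub>L real"
  proof -
    have c: "(\<lambda>n. Cov \<mu> (k n) l) \<longlonglongrightarrow> blinfun_apply l H"
      using h blinfun.tendsto[OF tendsto_const H, of l] by (simp add: represents_def)
    \<comment> \<open>First variation: \<open>k n\<close> is nearly minimal, so moving it by
      \<open>t *\<^sub>R l\<close> gains at most \<open>1 / (n + 1)\<close>. In the limit a
      quadratic in \<open>t\<close> without constant term is non-negative, and its linear
      coefficient vanishes.\<close>
    have "0 \<le> 0 + 2 * t * ((blinfun_apply l H - blinfun_apply l x) / 2) + t\<^sup>2 * (Cov \<mu> l l / 2)" for t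
    proof (rule LIMSEQ_le[where X="\<lambda>n. - (1 / real (Suc n))"])
      show "(\<lambda>n. - (1 / real (Suc n))) \<longlonglongrightarrow> 0" using tendsto_minus[OF LIMSEQ_Suc[OF lim_1_over_n]] by simp
      show "(\<lambda>n. t * (Cov \<mu> (k n) l - blinfun_apply l x) + t\<^sup>2 * (Cov \<mu> l l / 2)) \<longlonglongrightarrow>
          0 + 2 * t * ((blinfun_apply l H - blinfun_apply l x) / 2) + t\<^sup>2 * (Cov \<mu> l l / 2)"
        using c by (auto intro!: tendsto_eq_intros)
      have "- (1 / real (Suc n)) \<le> t * (Cov \<mu> (k n) l - blinfun_apply l x) + t\<^sup>2 * (Cov \<mu> l l / 2)" for n
      proof -
        have "J (k n + t *\<^sub>R l) = J (k n) + (t * (Cov \<mu> (k n) l - blinfun_apply l x) + t\<^sup>2 * (Cov \<mu> l l / 2))"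
          by (simp add: J_def Cov_bilinear Cov_sym[of l "k n"] blinfun.bilinear_simps field_simps power2_eq_square)
        then show ?thesis using I[of "k n + t *\<^sub>R l"] k[of n] by simp
      qed
      then show "\<exists>N. \<forall>n\<ge>N. - (1 / real (Suc n)) \<le> t * (Cov \<mu> (k n) l - blinfun_apply l x) + t\<^sup>2 * (Cov \<mu> l l / 2)" by blast
    qed
    then have "((blinfun_apply l H - blinfun_apply l x) / 2)\<^sup>2 \<le> 0 * (Cov \<mu> l l / 2)"
      by (rule quadratic_nonneg_discriminant)
    then show ?thesis by simp
  qed
  then have "H = x" by (rule functional_separates)
  have "h n \<in> pre_cm_space \<mu>" for n using h[of n] unfolding pre_cm_space_def by blast
  then have "cm_cauchy_to \<mu> h x"
    unfolding cm_cauchy_to_iff cm_star_eq[OF h] using H sdC \<open>H = x\<close> by simp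
  then show ?thesis by (auto simp: cm_space_def)
qed

end

section \<open>The measurable linear functional and the reflection attached to a Cameron-Martin vector\<close>

text \<open>The rate \<open>(1/4) ^ n\<close> serves twice: the increments of \<open>k n\<close> are
  summable almost everywhere, and Chebyshev's inequality at the level \<open>(1/2) ^ n\<close> still
  leaves the summable \<open>(1/4) ^ n\<close>. The datum is a sequence because \<open>x\<close> is
  only a limit of represented vectors.\<close>

locale cm_vector = nondegenerate_gaussian_measure \<mu>
  for \<mu> :: "'a::{banach,second_countable_topology} measure" +
  fixes x :: 'a and k :: "nat \<Rightarrow> 'a \<Rightarrow>\<^sub>L real"
  assumes nonzero: "x \<noteq> 0"
    and fast: "\<And>n. sd \<mu> (k (Suc n) - k n) \<le> (1/4) ^ n"
    and Cov_k_tendsto: "\<And>l. (\<lambda>n. Cov \<mu> (k n) l) \<longlonglongrightarrow> blinfun_apply l x"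
    and sd_k_tendsto: "(\<lambda>n. sd \<mu> (k n)) \<longlonglongrightarrow> cm_norm \<mu> x"
begin

abbreviation "c \<equiv> cm_norm \<mu> x"

text \<open>\<open>lim\<close> makes \<open>g\<close> a total Borel function; only its values where
  \<open>k n\<close> converges carry meaning.\<close>

definition g :: "'a \<Rightarrow> real" where "g w = lim (\<lambda>n. blinfun_apply (k n) w)"

text \<open>As \<open>g x = c\<^sup>2\<close>, this is the reflection in the hyperplane
  \<open>g = 0\<close>, which sends \<open>x\<close> to \<open>- x\<close>.\<close>

definition reflect :: "'a \<Rightarrow> 'a" where "reflect w = w - (2 * (g w / c\<^sup>2)) *\<^sub>R x"

lemma measurable_g[measurable]: "g \<in> borel_measurable borel"
  unfolding g_def by measurable

lemma measurable_reflect[measurable]: "reflect \<in> borel_measurable borel"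
  unfolding reflect_def by measurable

lemma c_pos: "c > 0"
proof (rule ccontr)
  assume "\<not> c > 0"
  moreover have "c \<ge> 0" by (rule LIMSEQ_le_const[OF sd_k_tendsto]) (auto simp: sd_nonneg)
  ultimately have s0: "(\<lambda>n. sd \<mu> (k n)) \<longlonglongrightarrow> 0" using sd_k_tendsto by simp
  have "blinfun_apply l x = blinfun_apply l 0" for l :: "'a \<Rightarrow>\<^sub>L real"
  proof -
    have "(\<lambda>n. Cov \<mu> (k n) l) \<longlonglongrightarrow> 0"
      by (rule Lim_null_comparison[OF _ tendsto_mult_left_zero[OF s0, of "sd \<mu> l"]]) (use abs_Cov_le in auto)
    then show ?thesis using Cov_k_tendsto[of l] LIMSEQ_unique by auto
  qed
  then have "x = 0" by (rule functional_separates)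
  then show False using nonzero by simp
qed

text \<open>The right-hand side is the sum of \<open>(1/4) ^ i\<close> over
  \<open>n \<le> i < n + j\<close>, in closed form for the induction.\<close>

lemma sd_k_diff: "sd \<mu> (k (n + j) - k n) \<le> 4/3 * (1/4) ^ n * (1 - (1/4) ^ j)"
proof (induction j)
  case 0 then show ?case by simp
next
  case (Suc j)
  have "sd \<mu> (k (n + Suc j) - k n) \<le> sd \<mu> (k (Suc (n + j)) - k (n + j)) + sd \<mu> (k (n + j) - k n)"
    using sd_diff_triangle by simp
  also have "\<dots> \<le> (1/4) ^ (n + j) + 4/3 * (1/4) ^ n * (1 - (1/4) ^ j)"
    using fast Suc by (intro add_mono)
  also have "\<dots> = 4/3 * (1/4) ^ n * (1 - (1/4) ^ Suc j)" by (simp add: power_add field_simps)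
  finally show ?case .
qed

lemma sd_k_diff_le: "m \<ge> n \<Longrightarrow> sd \<mu> (k m - k n) \<le> 2 * (1/4) ^ n"
proof -
  assume "m \<ge> n"
  then obtain j where "m = n + j" using le_Suc_ex by blast
  have "4/3 * (1/4) ^ n * (1 - (1/4) ^ j) \<le> 2 * (1/4::real) ^ n * 1"
    by (intro mult_mono) (auto simp: power_le_one)
  from order_trans[OF sd_k_diff[of n j] this] show ?thesis using \<open>m = n + j\<close> by simp
qed

text \<open>Formally \<open>g x\<close> is the squared norm of \<open>x\<close>. Indeed
  \<open>k n x\<close> is the limit of \<open>Cov (k m) (k n)\<close> in \<open>m\<close>, and for
  \<open>m \<ge> n\<close> this differs from the variance of \<open>k n\<close> by at most
  \<open>2 * (1/4) ^ n * sd (k n)\<close>.\<close>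

lemma k_x_tendsto: "(\<lambda>n. blinfun_apply (k n) x) \<longlonglongrightarrow> c\<^sup>2"
proof -
  have b: "\<bar>blinfun_apply (k n) x - (sd \<mu> (k n))\<^sup>2\<bar> \<le> 2 * (1/4) ^ n * sd \<mu> (k n)" for n
  proof (rule LIMSEQ_le_const2[OF tendsto_rabs[OF tendsto_diff[OF Cov_k_tendsto[of "k n"] tendsto_const]]])
    show "\<exists>N. \<forall>m\<ge>N. \<bar>Cov \<mu> (k m) (k n) - (sd \<mu> (k n))\<^sup>2\<bar> \<le> 2 * (1/4) ^ n * sd \<mu> (k n)"
    proof (intro exI[of _ n] allI impI)
      fix m assume "n \<le> m"
      have "\<bar>Cov \<mu> (k m) (k n) - (sd \<mu> (k n))\<^sup>2\<bar> = \<bar>Cov \<mu> (k m - k n) (k n)\<bar>"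
        by (simp add: sd_power2 Cov_diff_left)
      also have "\<dots> \<le> sd \<mu> (k m - k n) * sd \<mu> (k n)" by (rule abs_Cov_le)
      also have "\<dots> \<le> 2 * (1/4) ^ n * sd \<mu> (k n)"
        by (intro mult_right_mono sd_k_diff_le sd_nonneg \<open>n \<le> m\<close>)
      finally show "\<bar>Cov \<mu> (k m) (k n) - (sd \<mu> (k n))\<^sup>2\<bar> \<le> 2 * (1/4) ^ n * sd \<mu> (k n)" .
    qed
  qed
  have "(\<lambda>n. 2 * (1/4) ^ n * sd \<mu> (k n)) \<longlonglongrightarrow> 2 * 0 * c"
    by (intro tendsto_intros sd_k_tendsto LIMSEQ_power_zero) simp
  then have lim: "(\<lambda>n. 2 * (1/4) ^ n * sd \<mu> (k n)) \<longlonglongrightarrow> 0" by simp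
  have "(\<lambda>n. blinfun_apply (k n) x - (sd \<mu> (k n))\<^sup>2) \<longlonglongrightarrow> 0"
    by (rule Lim_null_comparison[OF _ lim]) (simp only: real_norm_def b eventually_True)
  from tendsto_add[OF this tendsto_power[OF sd_k_tendsto, of 2]] show ?thesis by simp
qed

text \<open>The increments of \<open>k n\<close> have summable \<open>L1\<close> norms, so their
  telescoping series converges absolutely almost everywhere.\<close>

lemma AE_g: "AE w in \<mu>. (\<lambda>n. blinfun_apply (k n) w) \<longlonglongrightarrow> g w"
proof -
  have le: "(\<integral>\<^sup>+w. ennreal \<bar>blinfun_apply (k (Suc n) - k n) w\<bar> \<partial>\<mu>) \<le> ennreal ((1/4) ^ n)" for n
  proof -
    let ?l = "k (Suc n) - k n"
    have i: "integrable \<mu> (\<lambda>w. \<bar>blinfun_apply ?l w\<bar> * 1)" and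
      "\<bar>LINT w|\<mu>. \<bar>blinfun_apply ?l w\<bar> * 1\<bar> \<le> sqrt (LINT w|\<mu>. \<bar>blinfun_apply ?l w\<bar>\<^sup>2) * sqrt (LINT w|\<mu>. 1\<^sup>2)"
      by (intro Cauchy_Schwarz_integral; simp add: functional_second_moment)+
    then have "(LINT w|\<mu>. \<bar>blinfun_apply ?l w\<bar>) \<le> sd \<mu> ?l"
      using prob_space by (simp add: sd_power2'[symmetric] sd_nonneg)
    then have "(LINT w|\<mu>. \<bar>blinfun_apply ?l w\<bar>) \<le> (1/4) ^ n" using fast[of n] by linarith
    then show ?thesis using i by (subst nn_integral_eq_integral) (auto intro!: ennreal_leI)
  qed
  have "(\<integral>\<^sup>+w. (\<Sum>n. ennreal \<bar>blinfun_apply (k (Suc n) - k n) w\<bar>) \<partial>\<mu>) =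
      (\<Sum>n. \<integral>\<^sup>+w. ennreal \<bar>blinfun_apply (k (Suc n) - k n) w\<bar> \<partial>\<mu>)"
    by (rule nn_integral_suminf) simp
  also have "\<dots> \<le> (\<Sum>n. ennreal ((1/4) ^ n))" by (intro suminf_le le) auto
  also have "\<dots> = ennreal (\<Sum>n. (1/4) ^ n)" by (rule suminf_ennreal2) auto
  also have "\<dots> < \<infinity>" by simp
  finally have "AE w in \<mu>. (\<Sum>n. ennreal \<bar>blinfun_apply (k (Suc n) - k n) w\<bar>) \<noteq> \<infinity>"
    by (intro nn_integral_PInf_AE) auto
  then show ?thesis
  proof eventually_elim
    case (elim w)
    then have "summable (\<lambda>n. \<bar>blinfun_apply (k (Suc n) - k n) w\<bar>)"
      by (intro summable_suminf_not_top) auto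
    then have "summable (\<lambda>n. blinfun_apply (k (Suc n)) w - blinfun_apply (k n) w)"
      by (auto simp: blinfun.diff_left dest: summable_rabs_cancel)
    then have "convergent (\<lambda>n. \<Sum>i<n. blinfun_apply (k (Suc i)) w - blinfun_apply (k i) w)"
      by (simp add: summable_iff_convergent)
    then have "convergent (\<lambda>n. (blinfun_apply (k n) w - blinfun_apply (k 0) w) + blinfun_apply (k 0) w)"
      unfolding sum_lessThan_telescope[of "\<lambda>i. blinfun_apply (k i) w"] by (intro convergent_add convergent_const)
    then show ?case by (simp add: g_def convergent_LIMSEQ_iff)
  qed
qed

lemma g_eqI: "(\<lambda>n. blinfun_apply (k n) w) \<longlonglongrightarrow> r \<Longrightarrow> g w = r"
  unfolding g_def by (rule limI)

text \<open>Composed with \<open>reflect\<close>, a functional \<open>l\<close> becomes the almost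
  everywhere limit of the functionals \<open>l - b *\<^sub>R k n\<close>. By the choice of
  \<open>b\<close> the extra terms \<open>- 2 * b * l x + b\<^sup>2 * c\<^sup>2\<close> of the
  limiting variance cancel, so the characteristic functional is unchanged.\<close>

lemma distr_reflect: "distr \<mu> borel reflect = \<mu>"
proof (rule measure_eqI_cf)
  interpret R: prob_space "distr \<mu> borel reflect" by (rule prob_space_distr) simp
  have "(LINT w|distr \<mu> borel reflect. cos (blinfun_apply l w + \<phi>)) = (LINT w|\<mu>. cos (blinfun_apply l w + \<phi>))"
    for l :: "'a \<Rightarrow>\<^sub>L real" and \<phi>
  proof -
    define b where "b = 2 * blinfun_apply l x / c\<^sup>2"
    have "(\<lambda>n. LINT w|\<mu>. cos (blinfun_apply (l - b *\<^sub>R k n) w + \<phi>)) \<longlonglongrightarrow>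
       (LINT w|\<mu>. cos (blinfun_apply l (reflect w) + \<phi>))"
    proof (rule integral_dominated_convergence[where w="\<lambda>_. 1"])
      show "AE w in \<mu>. (\<lambda>n. cos (blinfun_apply (l - b *\<^sub>R k n) w + \<phi>)) \<longlonglongrightarrow> cos (blinfun_apply l (reflect w) + \<phi>)"
        using AE_g
      proof eventually_elim
        case (elim w)
        then have "(\<lambda>n. cos ((blinfun_apply l w - b * blinfun_apply (k n) w) + \<phi>)) \<longlonglongrightarrow>
           cos ((blinfun_apply l w - b * g w) + \<phi>)" by (intro tendsto_intros)
        moreover have "blinfun_apply l (reflect w) = blinfun_apply l w - b * g w"
          by (simp add: reflect_def blinfun.bilinear_simps b_def mult_ac)
        ultimately show ?case by (simp add: blinfun.bilinear_simps)
      qed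
    qed auto
    moreover have "(\<lambda>n. LINT w|\<mu>. cos (blinfun_apply (l - b *\<^sub>R k n) w + \<phi>)) \<longlonglongrightarrow> exp (- Cov \<mu> l l / 2) * cos \<phi>"
    proof -
      have "Cov \<mu> (l - b *\<^sub>R k n) (l - b *\<^sub>R k n) = Cov \<mu> l l - 2 * b * Cov \<mu> (k n) l + b\<^sup>2 * (sd \<mu> (k n))\<^sup>2" for n
        unfolding sd_power2 by (simp add: Cov_bilinear Cov_sym[of l "k n"] power2_eq_square algebra_simps)
      moreover have "(\<lambda>n. Cov \<mu> l l - 2 * b * Cov \<mu> (k n) l + b\<^sup>2 * (sd \<mu> (k n))\<^sup>2) \<longlonglongrightarrow>
          Cov \<mu> l l - 2 * b * blinfun_apply l x + b\<^sup>2 * c\<^sup>2"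
        by (intro tendsto_intros Cov_k_tendsto sd_k_tendsto)
      moreover have "Cov \<mu> l l - 2 * b * blinfun_apply l x + b\<^sup>2 * c\<^sup>2 = Cov \<mu> l l"
        using c_pos by (simp add: b_def power2_eq_square)
      ultimately have "(\<lambda>n. Cov \<mu> (l - b *\<^sub>R k n) (l - b *\<^sub>R k n)) \<longlonglongrightarrow> Cov \<mu> l l" by simp
      then show ?thesis unfolding integral_cos_functional by (intro tendsto_intros) auto
    qed
    ultimately have "(LINT w|\<mu>. cos (blinfun_apply l (reflect w) + \<phi>)) = (LINT w|\<mu>. cos (blinfun_apply l w + \<phi>))"
      unfolding integral_cos_functional by (rule LIMSEQ_unique)
    then show ?thesis by (subst integral_distr) auto
  qed
  then show "same_cf (distr \<mu> borel reflect) \<mu>"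
    by (simp add: same_cf_def R.finite_measure_axioms finite_measure_axioms)
qed

lemma AE_g_scaleR: "AE w in \<mu>. (\<lambda>n. blinfun_apply (k n) (r *\<^sub>R w)) \<longlonglongrightarrow> g (r *\<^sub>R w) \<and> g (r *\<^sub>R w) = r * g w"
  using AE_g
proof eventually_elim
  case (elim w)
  then have "(\<lambda>n. blinfun_apply (k n) (r *\<^sub>R w)) \<longlonglongrightarrow> r * g w"
    by (simp add: blinfun.scaleR_right tendsto_mult_left)
  then show ?case using g_eqI by metis
qed

lemma distr_reflect_scaleR:
  "distr (distr \<mu> borel (\<lambda>z. r *\<^sub>R z)) borel reflect = distr \<mu> borel (\<lambda>z. r *\<^sub>R z)"
proof -
  have "distr (distr \<mu> borel (\<lambda>z. r *\<^sub>R z)) borel reflect = distr \<mu> borel (\<lambda>z. reflect (r *\<^sub>R z))"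
    by (subst distr_distr) (auto simp: comp_def)
  also have "\<dots> = distr \<mu> borel (\<lambda>z. r *\<^sub>R reflect z)"
  proof (rule distr_cong_AE)
    show "AE z in \<mu>. reflect (r *\<^sub>R z) = r *\<^sub>R reflect z"
      using AE_g_scaleR[of r]
      by eventually_elim (simp add: reflect_def algebra_simps)
  qed auto
  also have "\<dots> = distr (distr \<mu> borel reflect) borel (\<lambda>z. r *\<^sub>R z)"
    by (subst distr_distr) (auto simp: comp_def)
  finally show ?thesis by (simp add: distr_reflect)
qed

end

text \<open>Terms within \<open>(1/4) ^ n / 2\<close> of \<open>x\<close> have consecutive distances
  at most \<open>(1/4) ^ n\<close>. Limits survive the passage to a subsequence, so any sequence
  that defines a pairing may be used.\<close>

lemma (in nondegenerate_gaussian_measure) ex_cm_vector_subseq: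
  assumes x: "x \<in> cm_space \<mu>" "x \<noteq> 0"
    and u: "\<And>n. u n \<in> pre_cm_space \<mu>" and lim: "(\<lambda>n. cm_norm \<mu> (u n - x)) \<longlonglongrightarrow> 0"
  shows "\<exists>r. strict_mono r \<and> cm_vector \<mu> x (\<lambda>n. cm_star \<mu> (u (r n)))"
proof -
  note b = cm_approx_bounds[where u=u, OF x(1) u]
  have "\<exists>N. \<forall>n\<ge>N. cm_norm \<mu> (u n - x) < (1/4) ^ j / 2" for j
    using order_tendstoD(2)[OF lim, of "(1/4) ^ j / 2"] by (simp add: eventually_sequentially)
  then obtain N where N: "\<And>j n. n \<ge> N j \<Longrightarrow> cm_norm \<mu> (u n - x) < (1/4) ^ j / 2" by metis
  \<comment> \<open>The maximum makes \<open>r\<close> strictly increasing and keeps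
    \<open>r n\<close> beyond \<open>N n\<close>; then \<open>r (Suc n)\<close> is beyond
    \<open>N n\<close> as well.\<close>
  define r where "r = rec_nat (N 0) (\<lambda>n m. max (Suc m) (N (Suc n)))"
  have r: "r (Suc n) = max (Suc (r n)) (N (Suc n))" for n by (simp add: r_def)
  have rN: "r n \<ge> N n" for n by (cases n) (auto simp: r, simp add: r_def)
  have sm: "strict_mono r" by (rule strict_monoI_Suc) (simp add: r less_max_iff_disj)
  have lim': "(\<lambda>n. cm_norm \<mu> (u (r n) - x)) \<longlonglongrightarrow> 0"
    using LIMSEQ_subseq_LIMSEQ[OF lim sm] by (simp add: comp_def)
  have "cm_vector \<mu> x (\<lambda>n. cm_star \<mu> (u (r n)))"
  proof (intro cm_vector.intro cm_vector_axioms.intro nondegenerate_gaussian_measure_axioms)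
    show "x \<noteq> 0" by fact
    show "sd \<mu> (cm_star \<mu> (u (r (Suc n))) - cm_star \<mu> (u (r n))) \<le> (1/4) ^ n" for n
    proof -
      have "r (Suc n) \<ge> N n" using rN[of n] by (simp add: r)
      then show ?thesis using b(2)[of "r (Suc n)" "r n"] N[of n "r (Suc n)"] N[OF rN[of n]] by simp
    qed
    show "(\<lambda>n. Cov \<mu> (cm_star \<mu> (u (r n))) l) \<longlonglongrightarrow> blinfun_apply l x" for l
      by (rule LIM_zero_cancel, rule Lim_null_comparison[OF _ tendsto_mult_left_zero[OF lim', of "sd \<mu> l"]])
         (use b(3) in auto)
    show "(\<lambda>n. sd \<mu> (cm_star \<mu> (u (r n)))) \<longlonglongrightarrow> cm_norm \<mu> x"
      by (rule LIM_zero_cancel, rule Lim_null_comparison[OF _ lim']) (use b(4) in auto)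
  qed
  with sm show ?thesis by blast
qed

section \<open>Brownian motion\<close>

text \<open>The last grid point before \<open>s\<close> on the grid with \<open>n + 1\<close> cells;
  this carries estimates on grids over to continuous paths.\<close>

lemma grid_approximation:
  fixes T :: real
  assumes "T > 0" "s \<in> {0..T}"
  obtains p :: "nat \<Rightarrow> nat" where "\<And>n. p n \<le> Suc n" "(\<lambda>n. T / real (Suc n) * real (p n)) \<longlonglongrightarrow> s"
proof -
  define p where "p n = nat \<lfloor>s * real (Suc n) / T\<rfloor>" for n
  have fl: "real (p n) \<le> s * real (Suc n) / T" "s * real (Suc n) / T - 1 \<le> real (p n)" for n
    using assms by (auto simp: p_def of_nat_nat)
  have le: "T / real (Suc n) * real (p n) \<le> s" for n
  proof -
    have "T / real (Suc n) * real (p n) \<le> T / real (Suc n) * (s * real (Suc n) / T)"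
      using fl(1)[of n] assms by (intro mult_left_mono) auto
    then show ?thesis using assms by simp
  qed
  have ge: "s - T / real (Suc n) \<le> T / real (Suc n) * real (p n)" for n
  proof -
    have "T / real (Suc n) * (s * real (Suc n) / T - 1) \<le> T / real (Suc n) * real (p n)"
      using fl(2)[of n] assms by (intro mult_left_mono) auto
    moreover have "T / real (Suc n) * (s * real (Suc n) / T - 1) = s - T / real (Suc n)"
      using assms by (simp add: right_diff_distrib)
    ultimately show ?thesis by simp
  qed
  have "(\<lambda>n. T / real (Suc n) * real (p n)) \<longlonglongrightarrow> s"
  proof (rule tendsto_sandwich)
    have "(\<lambda>n. s - T / real (Suc n)) \<longlonglongrightarrow> s - 0"
      by (intro tendsto_intros LIMSEQ_Suc[OF lim_const_over_n])
    then show "(\<lambda>n. s - T / real (Suc n)) \<longlonglongrightarrow> s" by simp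
  qed (use le ge in auto)
  moreover have "p n \<le> Suc n" for n
  proof -
    have "s * real (Suc n) \<le> T * real (Suc n)" using assms by (intro mult_right_mono) auto
    then have "s * real (Suc n) / T \<le> real (Suc n)" using assms by (simp add: pos_divide_le_eq mult.commute)
    with fl(1)[of n] show ?thesis by linarith
  qed
  ultimately show thesis using that by blast
qed

locale brownian = nondegenerate_gaussian_measure \<mu>
  for \<mu> :: "'a::{banach,second_countable_topology} measure" +
  fixes M :: "'w measure" and x0 :: 'a and B :: "real \<Rightarrow> 'w \<Rightarrow> 'a"
  assumes bm: "brownian_motion M \<mu> x0 B"
begin

sublocale M: prob_space M
  using bm by (simp add: brownian_motion_def)

lemma measurable_B[measurable]: "t \<ge> 0 \<Longrightarrow> B t \<in> borel_measurable M"
  using bm by (simp add: brownian_motion_def)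

lemma continuous_B: "\<omega> \<in> space M \<Longrightarrow> continuous_on {0..} (\<lambda>t. B t \<omega>)"
  using bm by (simp add: brownian_motion_def)

lemma AE_B_0: "AE \<omega> in M. B 0 \<omega> = x0"
  using bm by (simp add: brownian_motion_def)

lemma distr_increment:
  "0 \<le> s \<Longrightarrow> s < t \<Longrightarrow> distr M borel (\<lambda>\<omega>. B t \<omega> - B s \<omega>) = distr \<mu> borel (\<lambda>z. sqrt (t - s) *\<^sub>R z)"
  using bm unfolding brownian_motion_def by blast

lemma indep_increment:
  assumes "0 \<le> s" "s < t" "A \<in> sets borel" "F \<in> past_sets M B s"
  shows "M.prob ({\<omega>\<in>space M. B t \<omega> - B s \<omega> \<in> A} \<inter> F) = M.prob {\<omega>\<in>space M. B t \<omega> - B s \<omega> \<in> A} * M.prob F"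
proof -
  have "M.indep_set {(\<lambda>\<omega>. B t \<omega> - B s \<omega>) -` A \<inter> space M | A. A \<in> sets borel} (past_sets M B s)"
    using bm assms(1,2) unfolding brownian_motion_def by blast
  moreover have "{\<omega>\<in>space M. B t \<omega> - B s \<omega> \<in> A} = (\<lambda>\<omega>. B t \<omega> - B s \<omega>) -` A \<inter> space M" by auto
  ultimately show ?thesis using assms(3,4) by (intro M.indep_setD) auto
qed

text \<open>A measure space with the events of \<open>past_sets\<close>, so that adaptedness becomes
  measurability.\<close>

definition past :: "real \<Rightarrow> 'w measure" where
  "past s = sigma (space M) {B u -` A \<inter> space M | u A. 0 \<le> u \<and> u \<le> s \<and> A \<in> sets borel}"

lemma space_past[simp]: "space (past s) = space M"
  unfolding past_def by (rule space_measure_of_conv)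

lemma sets_past: "sets (past s) = past_sets M B s"
  unfolding past_def past_sets_def by (rule sets_measure_of) auto

lemma past_measurable: "0 \<le> u \<Longrightarrow> u \<le> s \<Longrightarrow> B u \<in> borel_measurable (past s)"
  by (rule measurableI) (auto simp: sets_past past_sets_def intro!: sigma_sets.Basic)

lemma past_sets_mono: "s \<le> t \<Longrightarrow> sets (past s) \<subseteq> sets (past t)"
  unfolding sets_past past_sets_def by (intro sigma_sets_mono') force

lemma past_sets_events: "F \<in> sets (past s) \<Longrightarrow> F \<in> sets M"
proof -
  assume "F \<in> sets (past s)"
  moreover have "sigma_sets (space M) {B u -` A \<inter> space M | u A. 0 \<le> u \<and> u \<le> s \<and> A \<in> sets borel} \<subseteq> sets M"
    by (intro sets.sigma_sets_subset) (auto intro: measurable_sets[OF measurable_B])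
  ultimately show ?thesis by (auto simp: sets_past past_sets_def)
qed

lemma distr_functional_increment_tail:
  assumes st: "0 \<le> s" "s \<le> t" and a: "a > 0"
  shows "M.prob {\<omega>\<in>space M. a \<le> \<bar>blinfun_apply l (B t \<omega> - B s \<omega>)\<bar>} \<le> (t - s) * Cov \<mu> l l / a\<^sup>2"
proof (cases "s = t")
  case True
  then show ?thesis using a by (simp add: blinfun.zero_right)
next
  case False
  have [measurable]: "B t \<in> borel_measurable M" "B s \<in> borel_measurable M" using st by auto
  have "M.prob {\<omega>\<in>space M. a \<le> \<bar>blinfun_apply l (B t \<omega> - B s \<omega>)\<bar>} = measure (distr M borel (\<lambda>\<omega>. B t \<omega> - B s \<omega>)) {w. a \<le> \<bar>blinfun_apply l w\<bar>}"
    by (subst measure_distr) (auto intro!: arg_cong[where f=M.prob])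
  also have "distr M borel (\<lambda>\<omega>. B t \<omega> - B s \<omega>) = distr \<mu> borel (\<lambda>z. sqrt (t - s) *\<^sub>R z)"
    using st False by (intro distr_increment) auto
  also have "measure \<dots> {w. a \<le> \<bar>blinfun_apply l w\<bar>} = measure \<mu> {z\<in>space \<mu>. a\<^sup>2 \<le> (t - s) * (blinfun_apply l z)\<^sup>2}"
  proof -
    have "a \<le> \<bar>sqrt (t - s) * blinfun_apply l z\<bar> \<longleftrightarrow> a\<^sup>2 \<le> (t - s) * (blinfun_apply l z)\<^sup>2" for z
      using a st abs_le_square_iff[of a "sqrt (t - s) * blinfun_apply l z"] by (simp add: power_mult_distrib)
    then show ?thesis by (subst measure_distr) (auto simp: blinfun.scaleR_right intro!: arg_cong[where f="measure \<mu>"])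
  qed
  also have "\<dots> \<le> (LINT z|\<mu>. (t - s) * (blinfun_apply l z)\<^sup>2) / a\<^sup>2"
    using a st by (intro integral_Markov_inequality_measure[where A="{}"])
      (auto intro!: integrable_mult_right functional_second_moment)
  also have "\<dots> = (t - s) * Cov \<mu> l l / a\<^sup>2" by (simp add: Cov_def power2_eq_square)
  finally show ?thesis .
qed

text \<open>Ottaviani's inequality, with Chebyshev's inequality for the increments.\<close>

lemma max_functional_grid:
  assumes \<delta>: "\<delta> > 0" and e: "e > 0"
  shows "M.prob {\<omega>\<in>space M. \<exists>j\<le>m. 2 * e \<le> \<bar>blinfun_apply l (B (\<delta> * real j) \<omega> - B 0 \<omega>)\<bar>} \<le> 2 * (\<delta> * real m) * Cov \<mu> l l / e\<^sup>2"
proof -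
  define S where "S j \<omega> = blinfun_apply l (B (\<delta> * real j) \<omega> - B 0 \<omega>)" for j \<omega>
  have [measurable]: "B (\<delta> * real j) \<in> borel_measurable M" for j using \<delta> by simp
  have mS[measurable]: "S j \<in> borel_measurable M" for j unfolding S_def using \<delta> by measurable
  define v where "v = \<delta> * real m * Cov \<mu> l l / e\<^sup>2"
  have tail: "M.prob {\<omega>\<in>space M. e \<le> \<bar>S m \<omega> - S j \<omega>\<bar>} \<le> v" if "j \<le> m" for j
  proof -
    have "M.prob {\<omega>\<in>space M. e \<le> \<bar>blinfun_apply l (B (\<delta> * real m) \<omega> - B (\<delta> * real j) \<omega>)\<bar>} \<le> (\<delta> * real m - \<delta> * real j) * Cov \<mu> l l / e\<^sup>2"
      using \<delta> e that by (intro distr_functional_increment_tail) auto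
    also have "\<dots> \<le> v" unfolding v_def
      using \<delta> Cov_self_nonneg[of l] by (intro divide_right_mono mult_right_mono) auto
    finally show ?thesis by (simp add: S_def blinfun.diff_right)
  qed
  show ?thesis
  \<comment> \<open>For \<open>v > 1/2\<close> the bound \<open>2 * v\<close> exceeds 1. Otherwise
    the increment from any grid point to the last one stays below \<open>e\<close> with probability
    at least one half.\<close>
  proof (cases "v > 1/2")
    case True
    have "M.prob {\<omega>\<in>space M. \<exists>j\<le>m. 2 * e \<le> \<bar>S j \<omega>\<bar>} \<le> 1" by simp
    also have "1 \<le> 2 * v" using True by simp
    finally show ?thesis by (simp add: S_def v_def)
  next
    case False
    define E where "E j = {\<omega>\<in>space M. 2 * e \<le> \<bar>S j \<omega>\<bar> \<and> (\<forall>i<j. \<bar>S i \<omega>\<bar> < 2 * e)}" for j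
    have mE[measurable]: "E j \<in> sets M" for j unfolding E_def by measurable
    have Ep: "E j \<in> past_sets M B (\<delta> * real j)" for j
    proof -
      have "S i \<in> borel_measurable (past (\<delta> * real j))" if "i \<le> j" for i
      proof -
        have [measurable]: "B (\<delta> * real i) \<in> borel_measurable (past (\<delta> * real j))" "B 0 \<in> borel_measurable (past (\<delta> * real j))"
          using that \<delta> by (auto intro!: past_measurable)
        show ?thesis unfolding S_def by measurable
      qed
      \<comment> \<open>\<open>min i j\<close> makes the statement hold for every \<open>i\<close>,
        so that the bounded quantifier over \<open>i < j\<close> is measurable.\<close>
      then have [measurable]: "S (min i j) \<in> borel_measurable (past (\<delta> * real j))" "S j \<in> borel_measurable (past (\<delta> * real j))" for i by simp_all
      have "{\<omega>\<in>space (past (\<delta> * real j)). 2 * e \<le> \<bar>S j \<omega>\<bar> \<and> (\<forall>i<j. \<bar>S (min i j) \<omega>\<bar> < 2 * e)} \<in> sets (past (\<delta> * real j))"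
        by measurable
      moreover have "{\<omega>\<in>space (past (\<delta> * real j)). 2 * e \<le> \<bar>S j \<omega>\<bar> \<and> (\<forall>i<j. \<bar>S (min i j) \<omega>\<bar> < 2 * e)} = E j"
        unfolding E_def by (intro Collect_cong conj_cong) (simp_all add: min_def)
      ultimately show ?thesis by (simp add: sets_past)
    qed
    \<comment> \<open>At the first passage \<open>j\<close> the modulus is at least
      \<open>2 * e\<close>; the remaining increment is independent of that event and, with
      probability at least one half, too small to bring the modulus below \<open>e\<close>.\<close>
    have half: "M.prob (E j) / 2 \<le> M.prob (E j \<inter> {\<omega>\<in>space M. e \<le> \<bar>S m \<omega>\<bar>})" if "j \<le> m" for j
    proof (cases "j = m")
      case True
      have "E j \<inter> {\<omega>\<in>space M. e \<le> \<bar>S m \<omega>\<bar>} = E j" using e True by (auto simp: E_def)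
      then show ?thesis by simp
    next
      case False
      then have "j < m" using that by simp
      have "M.prob ({\<omega>\<in>space M. B (\<delta> * real m) \<omega> - B (\<delta> * real j) \<omega> \<in> {w. \<bar>blinfun_apply l w\<bar> < e}} \<inter> E j) =
         M.prob {\<omega>\<in>space M. B (\<delta> * real m) \<omega> - B (\<delta> * real j) \<omega> \<in> {w. \<bar>blinfun_apply l w\<bar> < e}} * M.prob (E j)"
        using \<delta> \<open>j < m\<close> by (intro indep_increment Ep) auto
      also have "{\<omega>\<in>space M. B (\<delta> * real m) \<omega> - B (\<delta> * real j) \<omega> \<in> {w. \<bar>blinfun_apply l w\<bar> < e}} = {\<omega>\<in>space M. \<not> e \<le> \<bar>S m \<omega> - S j \<omega>\<bar>}"
        by (auto simp: S_def blinfun.diff_right)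
      finally have ind: "M.prob ({\<omega>\<in>space M. \<not> e \<le> \<bar>S m \<omega> - S j \<omega>\<bar>} \<inter> E j) = M.prob {\<omega>\<in>space M. \<not> e \<le> \<bar>S m \<omega> - S j \<omega>\<bar>} * M.prob (E j)" .
      have "M.prob {\<omega>\<in>space M. \<not> e \<le> \<bar>S m \<omega> - S j \<omega>\<bar>} = 1 - M.prob {\<omega>\<in>space M. e \<le> \<bar>S m \<omega> - S j \<omega>\<bar>}"
        by (rule M.prob_neg) measurable
      then have "M.prob {\<omega>\<in>space M. \<not> e \<le> \<bar>S m \<omega> - S j \<omega>\<bar>} \<ge> 1/2" using tail[OF that] \<open>\<not> v > 1/2\<close> by simp
      then have "1/2 * M.prob (E j) \<le> M.prob ({\<omega>\<in>space M. \<not> e \<le> \<bar>S m \<omega> - S j \<omega>\<bar>} \<inter> E j)"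
        unfolding ind by (rule mult_right_mono) simp
      also have "\<dots> \<le> M.prob (E j \<inter> {\<omega>\<in>space M. e \<le> \<bar>S m \<omega>\<bar>})"
        by (rule M.finite_measure_mono) (auto simp: E_def)
      finally show ?thesis by simp
    qed
    have disj: "disjoint_family_on E {..m}"
    proof -
      have "E i \<inter> E j = {}" if "i < j" for i j using that by (force simp: E_def)
      then show ?thesis unfolding disjoint_family_on_def by (metis Int_commute linorder_neqE_nat)
    qed
    have "{\<omega>\<in>space M. \<exists>j\<le>m. 2 * e \<le> \<bar>S j \<omega>\<bar>} = (\<Union>j\<le>m. E j)"
    proof (intro set_eqI iffI)
      fix \<omega> assume "\<omega> \<in> {\<omega>\<in>space M. \<exists>j\<le>m. 2 * e \<le> \<bar>S j \<omega>\<bar>}"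
      then obtain j where j: "\<omega> \<in> space M" "j \<le> m" "2 * e \<le> \<bar>S j \<omega>\<bar>" by auto
      define i where "i = (LEAST i. 2 * e \<le> \<bar>S i \<omega>\<bar>)"
      have "2 * e \<le> \<bar>S i \<omega>\<bar>" unfolding i_def by (rule LeastI[of _ j]) (use j in simp)
      moreover have "i \<le> j" unfolding i_def by (rule Least_le) (use j in simp)
      moreover have "\<bar>S n \<omega>\<bar> < 2 * e" if "n < i" for n using not_less_Least[of n] that unfolding i_def by force
      ultimately show "\<omega> \<in> (\<Union>j\<le>m. E j)" using j by (auto simp: E_def intro!: bexI[of _ i])
    qed (auto simp: E_def)
    then have "M.prob {\<omega>\<in>space M. \<exists>j\<le>m. 2 * e \<le> \<bar>S j \<omega>\<bar>} = (\<Sum>j\<le>m. M.prob (E j))"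
      using disj mE M.finite_measure_finite_Union[of "{..m}" E] by (simp add: image_subset_iff)
    also have "\<dots> = 2 * (\<Sum>j\<le>m. M.prob (E j) / 2)" by (simp add: sum_divide_distrib[symmetric])
    also have "\<dots> \<le> 2 * (\<Sum>j\<le>m. M.prob (E j \<inter> {\<omega>\<in>space M. e \<le> \<bar>S m \<omega>\<bar>}))"
      by (intro mult_left_mono sum_mono half) auto
    also have "(\<Sum>j\<le>m. M.prob (E j \<inter> {\<omega>\<in>space M. e \<le> \<bar>S m \<omega>\<bar>})) = M.prob (\<Union>j\<le>m. E j \<inter> {\<omega>\<in>space M. e \<le> \<bar>S m \<omega>\<bar>})"
      using disj by (intro M.finite_measure_finite_Union[symmetric]) (auto simp: disjoint_family_on_def)
    also have "\<dots> \<le> M.prob {\<omega>\<in>space M. e \<le> \<bar>S m \<omega>\<bar>}" by (intro M.finite_measure_mono) auto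
    also have "\<dots> = M.prob {\<omega>\<in>space M. e \<le> \<bar>S m \<omega> - S 0 \<omega>\<bar>}" by (simp add: S_def blinfun.zero_right)
    also have "\<dots> \<le> v" by (rule tail) simp
    finally show ?thesis by (simp add: S_def v_def)
  qed
qed

lemma continuous_functional: "\<omega> \<in> space M \<Longrightarrow> continuous_on {0..} (\<lambda>t. blinfun_apply l (B t \<omega> - B 0 \<omega>))"
  by (intro continuous_intros continuous_B)

text \<open>The grid events \<open>A n\<close> need not be monotone, so the exceptional set is their
  limit inferior, the increasing union of \<open>D n\<close>, which inherits the bound. A path that
  exceeds the level strictly does so on all fine grids, by continuity.\<close>

lemma max_functional:
  assumes "T > 0" and e: "e > 0"
  shows "\<exists>D\<in>sets M. M.prob D \<le> 2 * T * Cov \<mu> l l / e\<^sup>2 \<and>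
     (\<forall>\<omega>\<in>space M - D. \<forall>s\<in>{0..T}. \<bar>blinfun_apply l (B s \<omega> - B 0 \<omega>)\<bar> \<le> 2 * e)"
proof -
  define A where "A n = {\<omega>\<in>space M. \<exists>j\<le>Suc n. 2 * e \<le> \<bar>blinfun_apply l (B (T / real (Suc n) * real j) \<omega> - B 0 \<omega>)\<bar>}" for n
  define D where "D n = (\<Inter>m\<in>{n..}. A m)" for n
  have A[measurable]: "A n \<in> sets M" for n
  proof -
    have [measurable]: "B (T / real (Suc n) * real j) \<in> borel_measurable M" "B 0 \<in> borel_measurable M" for j using \<open>T > 0\<close> by auto
    show ?thesis unfolding A_def by measurable
  qed
  have D[measurable]: "D n \<in> sets M" for n unfolding D_def by (intro sets.countable_INT') auto
  have pA: "M.prob (A n) \<le> 2 * T * Cov \<mu> l l / e\<^sup>2" for n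
  proof -
    have "T / real (Suc n) * real (Suc n) = T" by simp
    then show ?thesis
      using max_functional_grid[of "T / real (Suc n)" e "Suc n" l] assms unfolding A_def by simp
  qed
  have "(\<lambda>n. M.prob (D n)) \<longlonglongrightarrow> M.prob (\<Union>n. D n)"
    by (rule M.finite_Lim_measure_incseq) (auto simp: incseq_def D_def)
  moreover have "M.prob (D n) \<le> 2 * T * Cov \<mu> l l / e\<^sup>2" for n
    using M.finite_measure_mono[of "D n" "A n"] pA[of n] by (force simp: D_def)
  ultimately have le: "M.prob (\<Union>n. D n) \<le> 2 * T * Cov \<mu> l l / e\<^sup>2"
    by (intro LIMSEQ_le_const2[where X="\<lambda>n. M.prob (D n)"]) auto
  have "\<bar>blinfun_apply l (B s \<omega> - B 0 \<omega>)\<bar> \<le> 2 * e" if \<omega>: "\<omega> \<in> space M" "\<omega> \<notin> (\<Union>n. D n)" and s: "s \<in> {0..T}" for \<omega> s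
  proof (rule ccontr)
    assume "\<not> \<bar>blinfun_apply l (B s \<omega> - B 0 \<omega>)\<bar> \<le> 2 * e"
    then have gt: "\<bar>blinfun_apply l (B s \<omega> - B 0 \<omega>)\<bar> > 2 * e" by simp
    obtain p :: "nat \<Rightarrow> nat" where p: "\<And>n. p n \<le> Suc n" "(\<lambda>n. T / real (Suc n) * real (p n)) \<longlonglongrightarrow> s"
      using grid_approximation[OF \<open>T > 0\<close> s] by blast
    have p0: "T / real (Suc n) * real (p n) \<ge> 0" for n using \<open>T > 0\<close> by simp
    have "(\<lambda>n. blinfun_apply l (B (T / real (Suc n) * real (p n)) \<omega> - B 0 \<omega>)) \<longlonglongrightarrow> blinfun_apply l (B s \<omega> - B 0 \<omega>)"
      by (rule continuous_on_tendsto_compose[OF continuous_functional[OF \<omega>(1), of l] p(2)]) (use p0 s in auto)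
    from order_tendstoD(1)[OF tendsto_rabs[OF this] gt]
    obtain n0 where n0: "\<And>n. n \<ge> n0 \<Longrightarrow> 2 * e < \<bar>blinfun_apply l (B (T / real (Suc n) * real (p n)) \<omega> - B 0 \<omega>)\<bar>"
      by (auto simp: eventually_sequentially)
    have "\<omega> \<in> A n" if "n \<ge> n0" for n
      using n0[OF that] p(1)[of n] \<omega>(1) unfolding A_def by (auto intro: less_imp_le)
    then have "\<omega> \<in> D n0" by (auto simp: D_def)
    then show False using \<omega> by blast
  qed
  with le show ?thesis by (intro bexI[of _ "\<Union>n. D n"]) auto
qed

end

lemma brownian_iff: "brownian \<mu> M x0 B \<longleftrightarrow> nondegenerate_gaussian \<mu> \<and> brownian_motion M \<mu> x0 B"
  by (simp add: brownian_def brownian_axioms_def nondegenerate_gaussian_measure_def)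

section \<open>Meeting with positive probability forces a Cameron-Martin shift\<close>

theorem meeting_imp_cm_space:
  assumes nd: "nondegenerate_gaussian \<mu>" and cp: "coupling P \<mu> B1 0 B2 x"
    and pos: "measure P {\<omega>\<in>space P. meets_in_finite_time B1 B2 \<omega>} > 0"
  shows "x \<in> cm_space \<mu>"
proof -
  interpret B1: brownian \<mu> P 0 B1 using nd cp by (simp add: brownian_iff coupling_def)
  interpret B2: brownian \<mu> P x B2 using nd cp by (simp add: brownian_iff coupling_def)
  \<comment> \<open>Processes that have met agree at every later integer time, so countably many
    measurable events cover the meeting event.\<close>
  define E where "E n = {\<omega>\<in>space P. B1 (real (Suc n)) \<omega> - B2 (real (Suc n)) \<omega> = 0}" for n
  have E[measurable]: "E n \<in> sets P" for n
  proof -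
    have [measurable]: "B1 (real (Suc n)) \<in> borel_measurable P" "B2 (real (Suc n)) \<in> borel_measurable P"
      by (auto intro: B1.measurable_B B2.measurable_B)
    show ?thesis unfolding E_def by measurable
  qed
  have sub: "{\<omega>\<in>space P. meets_in_finite_time B1 B2 \<omega>} \<subseteq> (\<Union>n. E n)"
  proof
    fix \<omega> assume "\<omega> \<in> {\<omega>\<in>space P. meets_in_finite_time B1 B2 \<omega>}"
    then obtain \<tau> where t: "\<omega> \<in> space P" "\<tau> \<ge> 0" "\<And>s. s \<ge> 0 \<Longrightarrow> B1 (\<tau> + s) \<omega> = B2 (\<tau> + s) \<omega>"
      by (auto simp: meets_in_finite_time_def meets_by_def meet_times_def)
    obtain n where "\<tau> \<le> real n" using real_arch_simple by blast
    then show "\<omega> \<in> (\<Union>n. E n)" using t(1) t(3)[of "real (Suc n) - \<tau>"] by (auto simp: E_def intro!: exI[of _ n])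
  qed
  have "\<exists>n. measure P (E n) > 0"
  proof (rule ccontr)
    assume "\<not> (\<exists>n. measure P (E n) > 0)"
    then have "measure P (E n) = 0" for n using measure_nonneg[of P "E n"] by (metis order_le_less)
    then have "E n \<in> null_sets P" for n by (simp add: null_sets_def B1.M.emeasure_eq_measure)
    then have "(\<Union>n. E n) \<in> null_sets P" by blast
    then have "measure P (\<Union>n. E n) = 0" by (simp add: measure_eq_0_null_sets)
    moreover have "measure P {\<omega>\<in>space P. meets_in_finite_time B1 B2 \<omega>} \<le> measure P (\<Union>n. E n)"
      by (rule B1.M.finite_measure_mono[OF sub]) auto
    ultimately show False using pos by simp
  qed
  then obtain n where n: "measure P (E n) > 0" by blast
  define q t where "q = measure P (E n)" and "t = real (Suc n)"
  have "t > 0" "q > 0" using n by (auto simp: q_def t_def)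
  have [measurable]: "B1 t \<in> borel_measurable P" "B1 0 \<in> borel_measurable P" "B2 t \<in> borel_measurable P" "B2 0 \<in> borel_measurable P"
    using \<open>t > 0\<close> by (auto intro: B1.measurable_B B2.measurable_B)
  \<comment> \<open>The constant comes from \<open>q * a\<^sup>2 \<le> 2 * t * Cov \<mu> l l\<close>
    with \<open>a\<close> equal to half of \<open>l x\<close>.\<close>
  have "blinfun_apply l x \<le> sqrt (8 * t / q) * sd \<mu> l" for l :: "'a \<Rightarrow>\<^sub>L real"
  proof (cases "blinfun_apply l x > 0")
    case False
    then have "blinfun_apply l x \<le> 0" by simp
    also have "0 \<le> sqrt (8 * t / q) * sd \<mu> l"
      using \<open>t > 0\<close> \<open>q > 0\<close> B1.sd_nonneg[of l] by (intro mult_nonneg_nonneg) auto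
    finally show ?thesis .
  next
    case True
    \<comment> \<open>If both processes are at one point at time \<open>t\<close>, then, having
      started \<open>2 * a\<close> apart under \<open>l\<close>, at least one of them has moved by
      \<open>a\<close>.\<close>
    define a where "a = blinfun_apply l x / 2"
    have "a > 0" using True by (simp add: a_def)
    define E1 E2 where "E1 = {\<omega>\<in>space P. a \<le> \<bar>blinfun_apply l (B1 t \<omega> - B1 0 \<omega>)\<bar>}"
      and "E2 = {\<omega>\<in>space P. a \<le> \<bar>blinfun_apply l (B2 t \<omega> - B2 0 \<omega>)\<bar>}"
    have [measurable]: "E1 \<in> sets P" "E2 \<in> sets P" unfolding E1_def E2_def by measurable
    have "q \<le> measure P (E1 \<union> E2)"
      unfolding q_def
    proof (rule B1.M.finite_measure_mono_AE)
      show "AE \<omega> in P. \<omega> \<in> E n \<longrightarrow> \<omega> \<in> E1 \<union> E2"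
        using B1.AE_B_0 B2.AE_B_0
      proof eventually_elim
        case (elim \<omega>)
        show ?case
        proof
          assume w: "\<omega> \<in> E n"
          then have "B1 t \<omega> = B2 t \<omega>" by (simp add: E_def t_def)
          moreover have "a \<le> \<bar>v\<bar> \<or> a \<le> \<bar>v - 2 * a\<bar>" for v by linarith
          ultimately show "\<omega> \<in> E1 \<union> E2" using w elim
            by (auto simp: E_def E1_def E2_def a_def blinfun.diff_right blinfun.zero_right)
        qed
      qed
    qed measurable
    also have "\<dots> \<le> measure P E1 + measure P E2" by (rule measure_Un_le) auto
    also have "\<dots> \<le> (t - 0) * Cov \<mu> l l / a\<^sup>2 + (t - 0) * Cov \<mu> l l / a\<^sup>2"
      unfolding E1_def E2_def using \<open>a > 0\<close> \<open>t > 0\<close>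
      by (intro add_mono B1.distr_functional_increment_tail B2.distr_functional_increment_tail) auto
    finally have "q * a\<^sup>2 \<le> 2 * t * Cov \<mu> l l" using \<open>a > 0\<close> by (simp add: field_simps)
    then have "(blinfun_apply l x)\<^sup>2 \<le> 8 * t / q * (sd \<mu> l)\<^sup>2"
      using \<open>q > 0\<close> by (simp add: a_def B1.sd_power2 field_simps power_divide)
    then have "sqrt ((blinfun_apply l x)\<^sup>2) \<le> sqrt (8 * t / q * (sd \<mu> l)\<^sup>2)" by (rule real_sqrt_le_mono)
    then show ?thesis using True B1.sd_nonneg[of l] by (simp only: real_sqrt_mult real_sqrt_abs abs_of_nonneg abs_of_pos)
  qed
  then show ?thesis by (rule B1.cm_spaceI)
qed

section \<open>The Paley-Wiener pairing\<close>

locale cm_brownian = cm_vector \<mu> x k + brownian \<mu> M 0 B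
  for \<mu> :: "'a::{banach,second_countable_topology} measure" and x :: 'a and k
    and M :: "'w measure" and B :: "real \<Rightarrow> 'w \<Rightarrow> 'a"
begin

lemma measurable_Cauchy_k[measurable]: "Measurable.pred borel (\<lambda>w. Cauchy (\<lambda>n. blinfun_apply (k n) w))"
  unfolding pred_def by (rule sets_Collect_Cauchy) simp

text \<open>Because \<open>g\<close> is defined by \<open>lim\<close>, convergence to
  \<open>g w\<close> is the Cauchy property, a Borel condition on \<open>w\<close> that can be
  transferred from one random vector to another with the same law.\<close>

lemma Cauchy_k_iff: "Cauchy (\<lambda>n. blinfun_apply (k n) w) \<longleftrightarrow> (\<lambda>n. blinfun_apply (k n) w) \<longlonglongrightarrow> g w"
  by (simp add: Cauchy_convergent_iff convergent_LIMSEQ_iff g_def)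

lemma AE_g_increment:
  assumes "0 \<le> s" "s \<le> t"
  shows "AE \<omega> in M. (\<lambda>n. blinfun_apply (k n) (B t \<omega> - B s \<omega>)) \<longlonglongrightarrow> g (B t \<omega> - B s \<omega>)"
proof (cases "s = t")
  case True
  have "(\<lambda>n. blinfun_apply (k n) 0) \<longlonglongrightarrow> g 0" using g_eqI[of 0 0] by (simp add: blinfun.zero_right)
  then show ?thesis using True by simp
next
  case False
  have [measurable]: "B t \<in> borel_measurable M" "B s \<in> borel_measurable M" using assms by auto
  have "AE w in distr \<mu> borel (\<lambda>z. sqrt (t - s) *\<^sub>R z). Cauchy (\<lambda>n. blinfun_apply (k n) w)"
  proof (subst AE_distr_iff)
    show "AE z in \<mu>. Cauchy (\<lambda>n. blinfun_apply (k n) (sqrt (t - s) *\<^sub>R z))"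
      using AE_g_scaleR[of "sqrt (t - s)"] by eventually_elim (unfold Cauchy_k_iff, elim conjE)
  qed (use measurable_Cauchy_k in \<open>auto simp: pred_def\<close>)
  then have "AE w in distr M borel (\<lambda>\<omega>. B t \<omega> - B s \<omega>). Cauchy (\<lambda>n. blinfun_apply (k n) w)"
    by (subst distr_increment) (use assms False in auto)
  then have "AE \<omega> in M. Cauchy (\<lambda>n. blinfun_apply (k n) (B t \<omega> - B s \<omega>))"
    by (rule AE_distrD[rotated]) measurable
  then show ?thesis by (simp add: Cauchy_k_iff)
qed

lemma AE_g_B:
  assumes "0 \<le> t"
  shows "AE \<omega> in M. (\<lambda>n. blinfun_apply (k n) (B t \<omega>)) \<longlonglongrightarrow> g (B t \<omega>)"
  using AE_g_increment[of 0 t] AE_B_0 assms by (auto elim: eventually_elim2)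

lemma nn_integral_functional_increment:
  assumes "0 \<le> s" "s \<le> t"
  shows "(\<integral>\<^sup>+\<omega>. ennreal ((blinfun_apply l (B t \<omega> - B s \<omega>))\<^sup>2) \<partial>M) = ennreal ((t - s) * Cov \<mu> l l)"
proof (cases "s = t")
  case True then show ?thesis by (simp add: blinfun.zero_right)
next
  case False
  have [measurable]: "B t \<in> borel_measurable M" "B s \<in> borel_measurable M" using assms by auto
  have "(\<integral>\<^sup>+\<omega>. ennreal ((blinfun_apply l (B t \<omega> - B s \<omega>))\<^sup>2) \<partial>M) = (\<integral>\<^sup>+w. ennreal ((blinfun_apply l w)\<^sup>2) \<partial>distr M borel (\<lambda>\<omega>. B t \<omega> - B s \<omega>))"
    by (subst nn_integral_distr) auto
  also have "\<dots> = (\<integral>\<^sup>+w. ennreal ((blinfun_apply l w)\<^sup>2) \<partial>distr \<mu> borel (\<lambda>z. sqrt (t - s) *\<^sub>R z))"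
    using distr_increment[of s t] assms False by simp
  also have "\<dots> = (\<integral>\<^sup>+z. ennreal ((t - s) * (blinfun_apply l z)\<^sup>2) \<partial>\<mu>)"
    using assms by (subst nn_integral_distr) (auto simp: blinfun.scaleR_right power_mult_distrib)
  also have "\<dots> = ennreal (LINT z|\<mu>. (t - s) * (blinfun_apply l z)\<^sup>2)"
    using assms by (intro nn_integral_eq_integral) (auto intro!: integrable_mult_right functional_second_moment)
  also have "(LINT z|\<mu>. (t - s) * (blinfun_apply l z)\<^sup>2) = (t - s) * Cov \<mu> l l"
    by (simp add: Cov_def power2_eq_square)
  finally show ?thesis .
qed

lemma nn_integral_functional_B:
  assumes "0 \<le> t"
  shows "(\<integral>\<^sup>+\<omega>. ennreal ((blinfun_apply l (B t \<omega>))\<^sup>2) \<partial>M) = ennreal (t * Cov \<mu> l l)"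
proof -
  have "(\<integral>\<^sup>+\<omega>. ennreal ((blinfun_apply l (B t \<omega>))\<^sup>2) \<partial>M) = (\<integral>\<^sup>+\<omega>. ennreal ((blinfun_apply l (B t \<omega> - B 0 \<omega>))\<^sup>2) \<partial>M)"
    using AE_B_0 by (intro nn_integral_cong_AE) auto
  then show ?thesis using nn_integral_functional_increment[of 0 t l] assms by simp
qed

text \<open>The variance of the \<open>n\<close>-th difference is at most \<open>(1/16) ^ n\<close>,
  so at the level \<open>(1/2) ^ n\<close> the maximal inequality leaves
  \<open>2 * T * (1/4) ^ n\<close>, which is summable: the Borel-Cantelli lemma applies.\<close>

lemma AE_uniformly_Cauchy:
  assumes "T > 0"
  shows "AE \<omega> in M. \<exists>n0. \<forall>n\<ge>n0. \<forall>s\<in>{0..T}. \<bar>blinfun_apply (k (Suc n) - k n) (B s \<omega>)\<bar> \<le> 2 * (1/2) ^ n"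
proof -
  have "\<exists>D\<in>sets M. M.prob D \<le> 2 * T * Cov \<mu> (k (Suc n) - k n) (k (Suc n) - k n) / ((1/2) ^ n)\<^sup>2 \<and>
     (\<forall>\<omega>\<in>space M - D. \<forall>s\<in>{0..T}. \<bar>blinfun_apply (k (Suc n) - k n) (B s \<omega> - B 0 \<omega>)\<bar> \<le> 2 * (1/2) ^ n)" for n
    by (rule max_functional[OF assms]) simp
  then obtain D where D: "\<And>n. D n \<in> sets M"
     "\<And>n. M.prob (D n) \<le> 2 * T * Cov \<mu> (k (Suc n) - k n) (k (Suc n) - k n) / ((1/2) ^ n)\<^sup>2"
     "\<And>n \<omega> s. \<omega> \<in> space M - D n \<Longrightarrow> s \<in> {0..T} \<Longrightarrow> \<bar>blinfun_apply (k (Suc n) - k n) (B s \<omega> - B 0 \<omega>)\<bar> \<le> 2 * (1/2) ^ n"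
    by metis
  have pD: "M.prob (D n) \<le> 2 * T * (1/4) ^ n" for n
  proof -
    have "Cov \<mu> (k (Suc n) - k n) (k (Suc n) - k n) \<le> ((1/4) ^ n)\<^sup>2"
      unfolding sd_power2[symmetric] by (intro power_mono fast sd_nonneg)
    then have "2 * T * Cov \<mu> (k (Suc n) - k n) (k (Suc n) - k n) / ((1/2) ^ n)\<^sup>2 \<le> 2 * T * ((1/4) ^ n)\<^sup>2 / ((1/2) ^ n)\<^sup>2"
      using assms by (intro divide_right_mono mult_left_mono) auto
    also have "\<dots> = 2 * T * (1/4) ^ n"
      by (simp add: power2_eq_square power_mult_distrib[symmetric] power_divide[symmetric] divide_simps)
    finally show ?thesis using D(2)[of n] by linarith
  qed
  have "AE \<omega> in M. eventually (\<lambda>n. \<omega> \<in> space M - D n) sequentially"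
  proof (rule borel_cantelli_AE1)
    have s: "summable (\<lambda>n. 2 * T * (1/4::real) ^ n)" by (intro summable_mult summable_geometric) simp
    show "summable (\<lambda>n. M.prob (D n))"
      by (rule summable_comparison_test'[OF s]) (use pD in simp)
  qed (use D(1) in \<open>auto simp: M.emeasure_eq_measure\<close>)
  with AE_B_0 show ?thesis
  proof eventually_elim
    case (elim \<omega>)
    then obtain n0 where "\<And>n. n \<ge> n0 \<Longrightarrow> \<omega> \<in> space M - D n" by (auto simp: eventually_sequentially)
    note n0 = this
    show ?case
    proof (intro exI[of _ n0] allI impI ballI)
      fix n s assume "n0 \<le> n" "s \<in> {0..T}"
      from D(3)[OF n0[OF this(1)] this(2)] show "\<bar>blinfun_apply (k (Suc n) - k n) (B s \<omega>)\<bar> \<le> 2 * (1/2) ^ n"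
        using elim(1) by simp
    qed
  qed
qed

text \<open>Off a single null set the continuous functions \<open>k n (B t)\<close> converge
  uniformly on every bounded interval, so \<open>g (B t)\<close> itself has continuous paths
  there.\<close>

lemma ex_continuous_version:
  "\<exists>N. (\<forall>t\<ge>0. N t \<in> borel_measurable M) \<and> (\<forall>\<omega>\<in>space M. continuous_on {0..} (\<lambda>t. N t \<omega>)) \<and>
     (\<forall>t\<ge>0. AE \<omega> in M. (\<lambda>n. blinfun_apply (k n) (B t \<omega>)) \<longlonglongrightarrow> N t \<omega>)"
proof -
  have "AE \<omega> in M. \<forall>j::nat. \<exists>n0. \<forall>n\<ge>n0. \<forall>s\<in>{0..real (Suc j)}. \<bar>blinfun_apply (k (Suc n) - k n) (B s \<omega>)\<bar> \<le> 2 * (1/2) ^ n"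
    unfolding AE_all_countable by (intro allI AE_uniformly_Cauchy) simp
  then obtain Z where Z: "Z \<in> null_sets M" "{\<omega>\<in>space M. \<not> (\<forall>j::nat. \<exists>n0. \<forall>n\<ge>n0. \<forall>s\<in>{0..real (Suc j)}.
      \<bar>blinfun_apply (k (Suc n) - k n) (B s \<omega>)\<bar> \<le> 2 * (1/2) ^ n)} \<subseteq> Z"
    by (auto simp: eventually_ae_filter)
  \<comment> \<open>The value 0 on \<open>Z\<close> gives continuity to every path, as the pairing
    demands on all of \<open>space M\<close>.\<close>
  define N where "N t \<omega> = (if \<omega> \<in> Z then 0 else g (B t \<omega>))" for t \<omega>
  have [measurable]: "Z \<in> sets M" using Z(1) by auto
  have meas: "N t \<in> borel_measurable M" if "t \<ge> 0" for t
  proof -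
    have [measurable]: "B t \<in> borel_measurable M" using that by simp
    show ?thesis unfolding N_def by measurable
  qed
  have unif: "uniform_limit {0..real (Suc j)} (\<lambda>n t. blinfun_apply (k n) (B t \<omega>)) (\<lambda>t. g (B t \<omega>)) sequentially"
    if \<omega>: "\<omega> \<in> space M" "\<omega> \<notin> Z" for \<omega> j
  proof -
    obtain n0 where n0: "\<And>n s. n \<ge> n0 \<Longrightarrow> s \<in> {0..real (Suc j)} \<Longrightarrow> \<bar>blinfun_apply (k (Suc n) - k n) (B s \<omega>)\<bar> \<le> 2 * (1/2) ^ n"
      using Z(2) \<omega> by blast
    let ?A = "{0..real (Suc j)}"
    define f where "f i t = blinfun_apply (k (Suc i)) (B t \<omega>) - blinfun_apply (k i) (B t \<omega>)" for i t
    have "uniform_limit ?A (\<lambda>n t. \<Sum>i<n. f i t) (\<lambda>t. suminf (\<lambda>i. f i t)) sequentially"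
    proof (rule Weierstrass_m_test_ev)
      show "eventually (\<lambda>n. \<forall>t\<in>?A. norm (f n t) \<le> 2 * (1/2) ^ n) sequentially"
        using n0 unfolding eventually_sequentially f_def by (intro exI[of _ n0]) (simp add: blinfun.diff_left)
    qed (auto intro: summable_mult)
    moreover have "(\<Sum>i<n. f i t) = blinfun_apply (k n) (B t \<omega>) - blinfun_apply (k 0) (B t \<omega>)" for n t
      unfolding f_def by (rule sum_lessThan_telescope)
    ultimately have "uniform_limit ?A (\<lambda>n t. (blinfun_apply (k n) (B t \<omega>) - blinfun_apply (k 0) (B t \<omega>)) + blinfun_apply (k 0) (B t \<omega>))
       (\<lambda>t. suminf (\<lambda>i. f i t) + blinfun_apply (k 0) (B t \<omega>)) sequentially"
      by (intro uniform_limit_add uniform_limit_const) simp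
    then have u: "uniform_limit ?A (\<lambda>n t. blinfun_apply (k n) (B t \<omega>))
       (\<lambda>t. suminf (\<lambda>i. f i t) + blinfun_apply (k 0) (B t \<omega>)) sequentially" by simp
    have geq: "g (B t \<omega>) = suminf (\<lambda>i. f i t) + blinfun_apply (k 0) (B t \<omega>)" if "t \<in> ?A" for t
      by (rule g_eqI, rule tendsto_uniform_limitI[OF u that])
    show ?thesis
    proof (rule uniform_limitI)
      fix e :: real assume "e > 0"
      from uniform_limitD[OF u this]
      show "\<forall>\<^sub>F n in sequentially. \<forall>t\<in>?A. dist (blinfun_apply (k n) (B t \<omega>)) (g (B t \<omega>)) < e"
        by eventually_elim (use geq in auto)
    qed
  qed
  have cont: "continuous_on {0..} (\<lambda>t. N t \<omega>)" if \<omega>: "\<omega> \<in> space M" for \<omega>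
  proof (cases "\<omega> \<in> Z")
    case True then show ?thesis by (simp add: N_def)
  next
    case False
    have c: "continuous_on {0..real (Suc j)} (\<lambda>t. N t \<omega>)" for j
    proof -
      have "continuous_on {0..real (Suc j)} (\<lambda>t. g (B t \<omega>))"
      proof (rule uniform_limit_theorem[OF _ unif[OF \<omega> False]])
        show "eventually (\<lambda>n. continuous_on {0..real (Suc j)} (\<lambda>t. blinfun_apply (k n) (B t \<omega>))) sequentially"
          by (intro always_eventually allI continuous_intros continuous_on_subset[OF continuous_B[OF \<omega>]]) auto
      qed simp
      then show ?thesis using False by (simp add: N_def)
    qed
    show ?thesis unfolding continuous_on_eq_continuous_within
    proof
      fix t :: real assume t: "t \<in> {0..}"
      obtain j where j: "t \<le> real j" using real_arch_simple by blast
      have "at t within {0..} = at t within {0..real (Suc j)}"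
        by (rule at_within_nhd[of _ "{..<real (Suc j)}"]) (use j in auto)
      moreover have "continuous (at t within {0..real (Suc j)}) (\<lambda>t. N t \<omega>)"
        using c[of j] t j unfolding continuous_on_eq_continuous_within by auto
      ultimately show "continuous (at t within {0..}) (\<lambda>t. N t \<omega>)" by (simp add: continuous_within)
    qed
  qed
  have "AE \<omega> in M. (\<lambda>n. blinfun_apply (k n) (B t \<omega>)) \<longlonglongrightarrow> N t \<omega>" if "t \<ge> 0" for t
    using AE_g_B[OF that] AE_not_in[OF Z(1)] by eventually_elim (simp add: N_def)
  then show ?thesis using meas cont by (intro exI[of _ N]) auto
qed

text \<open>Fatou's lemma in \<open>m\<close>: as \<open>N\<close> is the limit of
  \<open>k m (B t)\<close>, its mean-square distance from \<open>k n (B t)\<close> is at most the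
  limit inferior of \<open>t\<close> times the variance of \<open>k m - k n\<close>.\<close>

lemma nn_integral_sq_tendsto:
  assumes t: "t \<ge> 0" and N: "N \<in> borel_measurable M" and lim: "AE \<omega> in M. (\<lambda>n. blinfun_apply (k n) (B t \<omega>)) \<longlonglongrightarrow> N \<omega>"
  shows "(\<lambda>n. \<integral>\<^sup>+\<omega>. ennreal ((blinfun_apply (k n) (B t \<omega>) - N \<omega>)\<^sup>2) \<partial>M) \<longlonglongrightarrow> 0"
proof -
  note [measurable] = N
  have [measurable]: "B t \<in> borel_measurable M" using t by simp
  have le: "(\<integral>\<^sup>+\<omega>. ennreal ((blinfun_apply (k n) (B t \<omega>) - N \<omega>)\<^sup>2) \<partial>M) \<le> ennreal (t * (2 * (1/4) ^ n)\<^sup>2)" for n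
  proof -
    have "(\<integral>\<^sup>+\<omega>. ennreal ((blinfun_apply (k n) (B t \<omega>) - N \<omega>)\<^sup>2) \<partial>M) =
       (\<integral>\<^sup>+\<omega>. liminf (\<lambda>m. ennreal ((blinfun_apply (k m - k n) (B t \<omega>))\<^sup>2)) \<partial>M)"
    proof (intro nn_integral_cong_AE)
      show "AE \<omega> in M. ennreal ((blinfun_apply (k n) (B t \<omega>) - N \<omega>)\<^sup>2) = liminf (\<lambda>m. ennreal ((blinfun_apply (k m - k n) (B t \<omega>))\<^sup>2))"
        using lim
      proof eventually_elim
        case (elim \<omega>)
        have "(\<lambda>m. ennreal ((blinfun_apply (k m - k n) (B t \<omega>))\<^sup>2)) \<longlonglongrightarrow> ennreal ((N \<omega> - blinfun_apply (k n) (B t \<omega>))\<^sup>2)"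
          unfolding blinfun.diff_left by (intro tendsto_ennrealI tendsto_intros elim)
        from lim_imp_Liminf[OF _ this] show ?case by (simp add: power2_commute[of "N \<omega>"])
      qed
    qed
    also have "\<dots> \<le> liminf (\<lambda>m. \<integral>\<^sup>+\<omega>. ennreal ((blinfun_apply (k m - k n) (B t \<omega>))\<^sup>2) \<partial>M)"
      by (rule nn_integral_liminf) measurable
    also have "\<dots> \<le> ennreal (t * (2 * (1/4) ^ n)\<^sup>2)"
    proof (rule Liminf_le[OF sequentially_bot], rule eventually_sequentiallyI[of n])
      fix m assume "n \<le> m"
      have "Cov \<mu> (k m - k n) (k m - k n) \<le> (2 * (1/4) ^ n)\<^sup>2"
        unfolding sd_power2[symmetric] using sd_k_diff_le[OF \<open>n \<le> m\<close>] by (intro power_mono sd_nonneg)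
      then show "(\<integral>\<^sup>+\<omega>. ennreal ((blinfun_apply (k m - k n) (B t \<omega>))\<^sup>2) \<partial>M) \<le> ennreal (t * (2 * (1/4) ^ n)\<^sup>2)"
        unfolding nn_integral_functional_B[OF t] using t by (intro ennreal_leI mult_left_mono)
    qed
    finally show ?thesis .
  qed
  have "(\<lambda>n. t * (2 * (1/4) ^ n)\<^sup>2) \<longlonglongrightarrow> t * (2 * 0)\<^sup>2"
    by (intro tendsto_intros LIMSEQ_power_zero) simp
  then have "(\<lambda>n. t * (2 * (1/4) ^ n)\<^sup>2) \<longlonglongrightarrow> 0" by simp
  from tendsto_ennrealI[OF this]
  have lim0: "(\<lambda>n. ennreal (t * (2 * (1/4) ^ n)\<^sup>2)) \<longlonglongrightarrow> 0" by (simp only: ennreal_0)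
  show ?thesis
    by (rule tendsto_sandwich[OF _ _ tendsto_const lim0]) (simp_all only: le zero_le eventually_True)
qed

end

lemma ex_paley_wiener:
  assumes nd: "nondegenerate_gaussian \<mu>" and bm: "brownian_motion M \<mu> 0 B" and x: "x \<in> cm_space \<mu>" "x \<noteq> 0"
  shows "\<exists>N. paley_wiener M \<mu> B x N"
proof -
  interpret brownian \<mu> M 0 B using nd bm by (simp add: brownian_iff)
  obtain u where u: "\<And>n. u n \<in> pre_cm_space \<mu>" "(\<lambda>n. cm_norm \<mu> (u n - x)) \<longlonglongrightarrow> 0"
    using cm_space_approx[OF x(1)] by blast
  obtain r where r: "strict_mono r" "cm_vector \<mu> x (\<lambda>n. cm_star \<mu> (u (r n)))"
    using ex_cm_vector_subseq[OF x u] by blast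
  interpret cm_brownian \<mu> x "\<lambda>n. cm_star \<mu> (u (r n))" M B
    using r(2) brownian_axioms by (simp add: cm_brownian_def)
  obtain N where "\<forall>t\<ge>0. N t \<in> borel_measurable M" "\<forall>\<omega>\<in>space M. continuous_on {0..} (\<lambda>t. N t \<omega>)"
     "\<forall>t\<ge>0. AE \<omega> in M. (\<lambda>n. blinfun_apply (cm_star \<mu> (u (r n))) (B t \<omega>)) \<longlonglongrightarrow> N t \<omega>"
    using ex_continuous_version by (elim exE conjE)
  note N = this(1,2)[rule_format] this(3)[THEN spec, THEN mp]
  have "paley_wiener M \<mu> B x N"
    unfolding paley_wiener_def
  proof (intro conjI allI impI ballI exI[of _ "\<lambda>n. u (r n)"])
    show "(\<lambda>n. cm_norm \<mu> (u (r n) - x)) \<longlonglongrightarrow> 0" using LIMSEQ_subseq_LIMSEQ[OF u(2) r(1)] by (simp add: comp_def)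
    show "(\<lambda>n. \<integral>\<^sup>+\<omega>. ennreal ((blinfun_apply (cm_star \<mu> (u (r n))) (B t \<omega>) - N t \<omega>)\<^sup>2) \<partial>M) \<longlonglongrightarrow> 0" if "t \<ge> 0" for t
      by (rule nn_integral_sq_tendsto[OF that N(1)[OF that] N(3)[OF that]])
  qed (use N u in auto)
  then show ?thesis by blast
qed

text \<open>Fatou's lemma along a sequence that also converges almost surely. Every version of the
  pairing is thus a fixed Borel function of \<open>B t\<close>, up to a null set that may depend on
  \<open>t\<close>.\<close>

lemma (in cm_brownian) AE_N_eq_g:
  assumes t: "t \<ge> 0" and N: "N \<in> borel_measurable M"
    and lim: "(\<lambda>n. \<integral>\<^sup>+\<omega>. ennreal ((blinfun_apply (k n) (B t \<omega>) - N \<omega>)\<^sup>2) \<partial>M) \<longlonglongrightarrow> 0"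
  shows "AE \<omega> in M. N \<omega> = g (B t \<omega>)"
proof -
  note [measurable] = N
  have [measurable]: "B t \<in> borel_measurable M" using t by simp
  have "(\<integral>\<^sup>+\<omega>. ennreal ((g (B t \<omega>) - N \<omega>)\<^sup>2) \<partial>M) =
       (\<integral>\<^sup>+\<omega>. liminf (\<lambda>n. ennreal ((blinfun_apply (k n) (B t \<omega>) - N \<omega>)\<^sup>2)) \<partial>M)"
  proof (intro nn_integral_cong_AE)
    show "AE \<omega> in M. ennreal ((g (B t \<omega>) - N \<omega>)\<^sup>2) = liminf (\<lambda>n. ennreal ((blinfun_apply (k n) (B t \<omega>) - N \<omega>)\<^sup>2))"
      using AE_g_B[OF t]
    proof eventually_elim
      case (elim \<omega>)
      have "(\<lambda>n. ennreal ((blinfun_apply (k n) (B t \<omega>) - N \<omega>)\<^sup>2)) \<longlonglongrightarrow> ennreal ((g (B t \<omega>) - N \<omega>)\<^sup>2)"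
        by (intro tendsto_ennrealI tendsto_intros elim)
      from lim_imp_Liminf[OF _ this] show ?case by simp
    qed
  qed
  also have "\<dots> \<le> liminf (\<lambda>n. \<integral>\<^sup>+\<omega>. ennreal ((blinfun_apply (k n) (B t \<omega>) - N \<omega>)\<^sup>2) \<partial>M)"
    by (rule nn_integral_liminf) measurable
  also have "\<dots> = 0" using lim by (simp add: lim_imp_Liminf)
  finally have "AE \<omega> in M. ennreal ((g (B t \<omega>) - N \<omega>)\<^sup>2) = 0"
    by (subst (asm) le_zero_eq, subst (asm) nn_integral_0_iff_AE) auto
  then show ?thesis by eventually_elim (auto simp: ennreal_eq_0_iff)
qed

section \<open>Reflecting independent increments\<close>

text \<open>The increments \<open>D n\<close> are i.i.d. with law \<open>\<nu>\<close>; whether the \<open>n\<close>-th one is reflected is decided by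
  the past \<open>F n\<close>, so the joint law does not change.\<close>

locale switched_increments = prob_space M for M :: "'w measure" +
  fixes F :: "nat \<Rightarrow> 'w measure" and D :: "nat \<Rightarrow> 'w \<Rightarrow> 'a::topological_space"
    and \<nu> :: "'a measure" and R :: "'a \<Rightarrow> 'a" and E :: "nat \<Rightarrow> 'w set"
  assumes space_F: "\<And>n. space (F n) = space M"
    and F_events: "\<And>n. sets (F n) \<subseteq> sets M"
    and F_mono: "\<And>n. sets (F n) \<subseteq> sets (F (Suc n))"
    and D_measurable: "\<And>n. D n \<in> borel_measurable (F (Suc n))"
    and E_F: "\<And>n. E n \<in> sets (F n)"
    and \<nu>: "prob_space \<nu>" "sets \<nu> = sets borel"
    and R: "R \<in> borel_measurable borel" "distr \<nu> borel R = \<nu>"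
    and indep_D: "\<And>n A G. A \<in> sets borel \<Longrightarrow> G \<in> sets (F n) \<Longrightarrow>
        prob ({\<omega>\<in>space M. D n \<omega> \<in> A} \<inter> G) = measure \<nu> A * prob G"
begin

definition D' :: "nat \<Rightarrow> 'w \<Rightarrow> 'a" where
  "D' n \<omega> = (if \<omega> \<in> E n then R (D n \<omega>) else D n \<omega>)"

lemma D'_measurable_F: "D' n \<in> borel_measurable (F (Suc n))"
proof -
  have "E n \<in> sets (F (Suc n))" using E_F F_mono by blast
  moreover note [measurable] = D_measurable R(1)
  ultimately show ?thesis unfolding D'_def by measurable
qed

lemma D'_measurable[measurable]: "D' n \<in> borel_measurable M"
  using D'_measurable_F[of n] F_events[of "Suc n"] space_F[of "Suc n"] by (auto simp: measurable_def)

lemma D'_cylinder_F: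
  assumes "\<And>n. A n \<in> sets borel"
  shows "{\<omega>\<in>space M. \<forall>n<m. D' n \<omega> \<in> A n} \<in> sets (F m)"
proof (induction m)
  case 0 then show ?case using sets.top[of "F 0"] by (simp add: space_F)
next
  case (Suc m)
  have "{\<omega>\<in>space M. \<forall>n<Suc m. D' n \<omega> \<in> A n} = {\<omega>\<in>space M. \<forall>n<m. D' n \<omega> \<in> A n} \<inter> (D' m -` A m \<inter> space (F (Suc m)))"
    by (auto simp: space_F less_Suc_eq)
  also have "\<dots> \<in> sets (F (Suc m))"
    using Suc F_mono measurable_sets[OF D'_measurable_F assms] by blast
  finally show ?case .
qed

text \<open>The earlier switched increments and the decision \<open>E m\<close> belong to the past,
  so the \<open>m\<close>-th increment is independent of them; reflected or not, it hits
  \<open>A m\<close> with the same probability because \<open>R\<close> preserves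
  \<open>\<nu>\<close>.\<close>

lemma prob_D'_cylinder:
  assumes A: "\<And>n. A n \<in> sets borel"
  shows "prob {\<omega>\<in>space M. \<forall>n<m. D' n \<omega> \<in> A n} = (\<Prod>n<m. measure \<nu> (A n))"
proof (induction m)
  case 0 then show ?case by (simp add: prob_space)
next
  case (Suc m)
  define G where "G = {\<omega>\<in>space M. \<forall>n<m. D' n \<omega> \<in> A n}"
  have G: "G \<in> sets (F m)" unfolding G_def by (rule D'_cylinder_F[OF A])
  have GE: "G \<inter> E m \<in> sets (F m)" "G - E m \<in> sets (F m)" using G E_F[of m] by auto
  have RA: "R -` A m \<in> sets borel" using measurable_sets[OF R(1) A, of m] by simp
  have sp: "space \<nu> = UNIV" using sets_eq_imp_space_eq[OF \<nu>(2)] by simp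
  have RAm: "measure \<nu> (R -` A m) = measure \<nu> (A m)"
  proof -
    have "measure (distr \<nu> borel R) (A m) = measure \<nu> (R -` A m)"
      using R(1) A \<nu>(2) by (subst measure_distr) (auto simp: sp measurable_cong_sets[OF \<nu>(2) refl])
    then show ?thesis using R(2) by simp
  qed
  have DM: "D m \<in> borel_measurable M"
    using D_measurable[of m] F_events[of "Suc m"] space_F[of "Suc m"] by (auto simp: measurable_def)
  note [measurable] = DM
  have ev: "{\<omega>\<in>space M. D m \<omega> \<in> X} \<in> sets M" if "X \<in> sets borel" for X
    using measurable_sets[OF DM that] by (simp add: vimage_def Int_def conj_commute)
  have "{\<omega>\<in>space M. \<forall>n<Suc m. D' n \<omega> \<in> A n} =
     ({\<omega>\<in>space M. D m \<omega> \<in> R -` A m} \<inter> (G \<inter> E m)) \<union> ({\<omega>\<in>space M. D m \<omega> \<in> A m} \<inter> (G - E m))"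
  proof -
    have "{\<omega>\<in>space M. \<forall>n<Suc m. D' n \<omega> \<in> A n} = G \<inter> {\<omega>\<in>space M. D' m \<omega> \<in> A m}"
      unfolding G_def less_Suc_eq by blast
    also have "{\<omega>\<in>space M. D' m \<omega> \<in> A m} =
       ({\<omega>\<in>space M. D m \<omega> \<in> R -` A m} \<inter> E m) \<union> ({\<omega>\<in>space M. D m \<omega> \<in> A m} - E m)"
      by (simp add: set_eq_iff D'_def)
    finally show ?thesis by blast
  qed
  then have "prob {\<omega>\<in>space M. \<forall>n<Suc m. D' n \<omega> \<in> A n} =
     prob ({\<omega>\<in>space M. D m \<omega> \<in> R -` A m} \<inter> (G \<inter> E m)) + prob ({\<omega>\<in>space M. D m \<omega> \<in> A m} \<inter> (G - E m))"
  proof -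
    have "{\<omega>\<in>space M. D m \<omega> \<in> R -` A m} \<inter> (G \<inter> E m) \<in> sets M" "{\<omega>\<in>space M. D m \<omega> \<in> A m} \<inter> (G - E m) \<in> sets M"
      using ev[OF RA] ev[OF A] GE F_events[of m] by blast+
    moreover have "({\<omega>\<in>space M. D m \<omega> \<in> R -` A m} \<inter> (G \<inter> E m)) \<inter> ({\<omega>\<in>space M. D m \<omega> \<in> A m} \<inter> (G - E m)) = {}" by blast
    ultimately have "prob (({\<omega>\<in>space M. D m \<omega> \<in> R -` A m} \<inter> (G \<inter> E m)) \<union> ({\<omega>\<in>space M. D m \<omega> \<in> A m} \<inter> (G - E m))) =
       prob ({\<omega>\<in>space M. D m \<omega> \<in> R -` A m} \<inter> (G \<inter> E m)) + prob ({\<omega>\<in>space M. D m \<omega> \<in> A m} \<inter> (G - E m))"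
      by (rule finite_measure_Union)
    then show ?thesis using \<open>{\<omega>\<in>space M. \<forall>n<Suc m. D' n \<omega> \<in> A n} = _\<close> by (simp only:)
  qed
  also have "\<dots> = measure \<nu> (A m) * (prob (G \<inter> E m) + prob (G - E m))"
    unfolding indep_D[OF RA GE(1)] indep_D[OF A GE(2)] RAm by (simp only: distrib_left)
  also have "prob (G \<inter> E m) + prob (G - E m) = prob G"
  proof -
    have "G \<inter> E m \<in> sets M" "G - E m \<in> sets M" using GE F_events[of m] by blast+
    from finite_measure_Union[OF this Int_Diff_disjoint] show ?thesis by (simp only: Int_Diff_Un)
  qed
  finally show ?case using Suc by (simp add: G_def)
qed

lemma distr_D':
  "distr M (PiM {..<m} (\<lambda>_. borel)) (\<lambda>\<omega>. \<lambda>n\<in>{..<m}. D' n \<omega>) = PiM {..<m} (\<lambda>_. \<nu>)"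
proof -
  interpret \<nu>: prob_space \<nu> by (rule \<nu>)
  interpret P: product_sigma_finite "\<lambda>_::nat. \<nu>" ..
  have s: "sets (PiM {..<m} (\<lambda>_::nat. borel)) = sets (PiM {..<m} (\<lambda>_. \<nu>))"
    by (rule sets_PiM_cong) (auto simp: \<nu>)
  have m: "(\<lambda>\<omega>. \<lambda>n\<in>{..<m}. D' n \<omega>) \<in> measurable M (PiM {..<m} (\<lambda>_. borel))"
    by (intro measurable_restrict D'_measurable)
  show ?thesis
  proof (rule P.PiM_eqI)
    fix A :: "nat \<Rightarrow> 'a set" assume A: "\<And>i. i \<in> {..<m} \<Longrightarrow> A i \<in> sets \<nu>"
    \<comment> \<open>Indices from \<open>m\<close> on get the full space, as the cylinder lemma
      quantifies over all of them.\<close>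
    define A' where "A' n = (if n < m then A n else UNIV)" for n
    have A': "A' n \<in> sets borel" for n using A by (auto simp: A'_def \<nu>)
    have "emeasure (distr M (PiM {..<m} (\<lambda>_. borel)) (\<lambda>\<omega>. \<lambda>n\<in>{..<m}. D' n \<omega>)) (Pi\<^sub>E {..<m} A) =
       emeasure M ((\<lambda>\<omega>. \<lambda>n\<in>{..<m}. D' n \<omega>) -` Pi\<^sub>E {..<m} A \<inter> space M)"
      using A by (intro emeasure_distr m sets_PiM_I_finite) (auto simp: \<nu>)
    also have "(\<lambda>\<omega>. \<lambda>n\<in>{..<m}. D' n \<omega>) -` Pi\<^sub>E {..<m} A \<inter> space M = {\<omega>\<in>space M. \<forall>n<m. D' n \<omega> \<in> A' n}"
      unfolding set_eq_iff by (simp add: A'_def PiE_iff Ball_def conj_commute)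
    also have "emeasure M \<dots> = ennreal (\<Prod>n<m. measure \<nu> (A' n))"
      by (simp add: emeasure_eq_measure prob_D'_cylinder[OF A'])
    also have "\<dots> = (\<Prod>n<m. emeasure \<nu> (A n))"
    proof -
      have "ennreal (\<Prod>n<m. measure \<nu> (A' n)) = (\<Prod>n<m. ennreal (measure \<nu> (A' n)))"
        by (rule prod_ennreal[symmetric]) simp
      also have "\<dots> = (\<Prod>n<m. emeasure \<nu> (A n))"
        by (rule prod.cong) (simp_all add: \<nu>.emeasure_eq_measure A'_def)
      finally show ?thesis .
    qed
    finally show "emeasure (distr M (PiM {..<m} (\<lambda>_. borel)) (\<lambda>\<omega>. \<lambda>n\<in>{..<m}. D' n \<omega>)) (Pi\<^sub>E {..<m} A) = (\<Prod>n\<in>{..<m}. emeasure \<nu> (A n))" .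
  qed (use s in auto)
qed

end

section \<open>Hitting times of continuous paths\<close>

lemma hitting_time_cases:
  fixes N :: "real \<Rightarrow> 'w \<Rightarrow> real"
  assumes cont: "continuous_on {0..} (\<lambda>t. N t \<omega>)"
  obtains "hitting_time N a \<omega> = \<infinity>" "\<And>t. t \<ge> 0 \<Longrightarrow> N t \<omega> \<noteq> a"
  | h where "hitting_time N a \<omega> = ereal h" "h \<ge> 0" "N h \<omega> = a" "\<And>t. 0 \<le> t \<Longrightarrow> t < h \<Longrightarrow> N t \<omega> \<noteq> a"
proof -
  define H where "H = {t. 0 \<le> t \<and> N t \<omega> = a}"
  have T: "hitting_time N a \<omega> = Inf (ereal ` H)" by (simp add: hitting_time_def H_def)
  show thesis
  proof (cases "H = {}")
    case True
    then have "hitting_time N a \<omega> = \<infinity>" using T by (simp add: top_ereal_def)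
    moreover have "N t \<omega> \<noteq> a" if "t \<ge> 0" for t using True that by (auto simp: H_def)
    ultimately show ?thesis using that(1) by blast
  next
    case False
    have "closed ({0..} \<inter> (\<lambda>t. N t \<omega>) -` {a})"
      by (rule continuous_closed_preimage[OF cont]) auto
    moreover have "{0..} \<inter> (\<lambda>t. N t \<omega>) -` {a} = H" by (auto simp: H_def)
    ultimately have "closed H" by simp
    moreover have bdd: "bdd_below H" by (auto simp: H_def intro: bdd_belowI[of _ 0])
    ultimately have "Inf H \<in> H" using False by (intro closed_contains_Inf)
    moreover have "Inf (ereal ` H) = ereal (Inf H)"
      using \<open>Inf H \<in> H\<close> by (intro antisym Inf_lower INF_greatest) (auto intro: cInf_lower[OF _ bdd])
    moreover have "N t \<omega> \<noteq> a" if "0 \<le> t" "t < Inf H" for t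
      using cInf_lower[OF _ bdd, of t] that by (force simp: H_def)
    ultimately show ?thesis using that(2)[of "Inf H"] T by (auto simp: H_def)
  qed
qed

text \<open>On a compact interval a continuous path that avoids the level keeps some distance
  \<open>1 / (m + 1)\<close> from it, and this can be tested on grids. The condition is countable
  and looks at no time beyond \<open>t\<close>.\<close>

lemma avoids_level_iff:
  fixes f :: "real \<Rightarrow> real"
  assumes cont: "continuous_on {0..t} f" and t: "t \<ge> 0"
  shows "(\<forall>s\<in>{0..t}. f s \<noteq> a) \<longleftrightarrow>
    (\<exists>m::nat. \<forall>n j. j \<le> Suc n \<longrightarrow> 1 / real (Suc m) \<le> \<bar>f (t / real (Suc n) * real j) - a\<bar>)"
proof
  assume avoid: "\<forall>s\<in>{0..t}. f s \<noteq> a"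
  have "continuous_on {0..t} (\<lambda>s. \<bar>f s - a\<bar>)" by (intro continuous_intros cont)
  then obtain s where s: "s \<in> {0..t}" "\<And>u. u \<in> {0..t} \<Longrightarrow> \<bar>f s - a\<bar> \<le> \<bar>f u - a\<bar>"
    using continuous_attains_inf[of "{0..t}" "\<lambda>s. \<bar>f s - a\<bar>"] t by auto
  have "\<bar>f s - a\<bar> > 0" using avoid s(1) by auto
  then obtain m :: nat where m: "1 / real (Suc m) < \<bar>f s - a\<bar>" using nat_approx_posE by blast
  have "1 / real (Suc m) \<le> \<bar>f (t / real (Suc n) * real j) - a\<bar>" if "j \<le> Suc n" for n j
  proof -
    have "t * real j \<le> t * real (Suc n)" using that t by (intro mult_left_mono) auto
    then have "t / real (Suc n) * real j \<in> {0..t}" using t by (simp add: pos_divide_le_eq)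
    from s(2)[OF this] m show ?thesis by linarith
  qed
  then show "\<exists>m::nat. \<forall>n j. j \<le> Suc n \<longrightarrow> 1 / real (Suc m) \<le> \<bar>f (t / real (Suc n) * real j) - a\<bar>" by blast
next
  assume "\<exists>m::nat. \<forall>n j. j \<le> Suc n \<longrightarrow> 1 / real (Suc m) \<le> \<bar>f (t / real (Suc n) * real j) - a\<bar>"
  then obtain m :: nat where m: "\<And>n j. j \<le> Suc n \<Longrightarrow> 1 / real (Suc m) \<le> \<bar>f (t / real (Suc n) * real j) - a\<bar>" by blast
  show "\<forall>s\<in>{0..t}. f s \<noteq> a"
  proof
    fix s assume s: "s \<in> {0..t}"
    have "1 / real (Suc m) \<le> \<bar>f s - a\<bar>"
    proof (cases "t = 0")
      case True then show ?thesis using m[of 0 0] s by simp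
    next
      case False
      then have "t > 0" using t by simp
      obtain p where p: "\<And>n. p n \<le> Suc n" "(\<lambda>n. t / real (Suc n) * real (p n)) \<longlonglongrightarrow> s"
        using grid_approximation[OF \<open>t > 0\<close> s] by blast
      have in0: "t / real (Suc n) * real (p n) \<in> {0..t}" for n
      proof -
        have "t * real (p n) \<le> t * real (Suc n)" using p(1)[of n] t by (intro mult_left_mono) auto
        then show ?thesis using t by (simp add: pos_divide_le_eq)
      qed
      have "(\<lambda>n. f (t / real (Suc n) * real (p n))) \<longlonglongrightarrow> f s"
        by (rule continuous_on_tendsto_compose[OF cont p(2) s]) (use in0 in auto)
      then have "(\<lambda>n. \<bar>f (t / real (Suc n) * real (p n)) - a\<bar>) \<longlonglongrightarrow> \<bar>f s - a\<bar>" by (intro tendsto_intros)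
      then show ?thesis by (rule LIMSEQ_le_const) (use m p(1) in blast)
    qed
    then show "f s \<noteq> a" by auto
  qed
qed

text \<open>The number \<open>m K\<close> of grid points before both \<open>\<delta> K\<close> and \<open>T\<close>; the grid time \<open>\<delta> m K\<close> is the
  minimum of \<open>\<delta> K\<close> and \<open>T\<close> rounded up to the grid.\<close>

lemma grid_stopping:
  fixes \<delta> :: real and T :: ereal and K :: nat
  assumes \<delta>: "\<delta> > 0" and T: "T \<ge> 0"
  defines "m \<equiv> \<lambda>K. card {k. k < K \<and> ereal (\<delta> * real k) < T}"
  shows "(\<Sum>k<K. if ereal (\<delta> * real k) < T then f (Suc k) - f k else 0) = f (m K) - (f 0 :: real)"
    and "\<bar>\<delta> * real (m K) - real_of_ereal (min (ereal (\<delta> * real K)) T)\<bar> \<le> \<delta>"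
proof -
  have mS: "m (Suc K) = (if ereal (\<delta> * real K) < T then Suc (m K) else m K)" for K
  proof -
    have "{k. k < Suc K \<and> ereal (\<delta> * real k) < T} =
       (if ereal (\<delta> * real K) < T then insert K {k. k < K \<and> ereal (\<delta> * real k) < T} else {k. k < K \<and> ereal (\<delta> * real k) < T})"
      by (auto simp: less_Suc_eq)
    then show ?thesis by (simp add: m_def)
  qed
  have m0: "m 0 = 0" by (simp add: m_def)
  have mK: "m K \<le> K" for K by (induction K) (auto simp: m0 mS)
  \<comment> \<open>Either no step has been switched off and the last one began before
    \<open>T\<close>, or the grid time of \<open>m K\<close> has reached \<open>T\<close> and is at
    most one mesh late. For \<open>K = 0\<close> there is no last step.\<close>
  have inv: "(m K = K \<and> (K = 0 \<or> ereal (\<delta> * (real K - 1)) < T)) \<or> (T \<le> ereal (\<delta> * real (m K)) \<and> ereal (\<delta> * real (m K)) \<le> T + ereal \<delta>)" for K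
  proof (induction K)
    case 0 then show ?case by (simp add: m0)
  next
    case (Suc K)
    show ?case
    proof (cases "ereal (\<delta> * real K) < T")
      case True
      have "\<not> T \<le> ereal (\<delta> * real (m K))"
      proof
        assume "T \<le> ereal (\<delta> * real (m K))"
        also have "\<dots> \<le> ereal (\<delta> * real K)" using mK[of K] \<delta> by simp
        finally show False using True by simp
      qed
      then show ?thesis using Suc True by (simp add: mS)
    next
      case False
      then have "T \<le> ereal (\<delta> * real K)" by simp
      show ?thesis
      proof (cases "m K = K \<and> (K = 0 \<or> ereal (\<delta> * (real K - 1)) < T)")
        case True
        have "ereal (\<delta> * real K) \<le> T + ereal \<delta>"
          using True T \<delta> \<open>T \<le> ereal (\<delta> * real K)\<close> by (cases T) (auto simp: algebra_simps)
        then show ?thesis using \<open>T \<le> ereal (\<delta> * real K)\<close> True False by (simp add: mS)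
      next
        case nc: False
        then show ?thesis using Suc False by (auto simp: mS)
      qed
    qed
  qed
  show "(\<Sum>k<K. if ereal (\<delta> * real k) < T then f (Suc k) - f k else 0) = f (m K) - f 0"
  proof (induction K)
    case 0 then show ?case by (simp add: m0)
  next
    case (Suc K)
    \<comment> \<open>A step before \<open>T\<close> is preceded only by steps before
      \<open>T\<close>, so the sum telescopes without gaps.\<close>
    have "m K = K" if "ereal (\<delta> * real K) < T"
    proof -
      have "\<not> T \<le> ereal (\<delta> * real (m K))"
      proof
        assume "T \<le> ereal (\<delta> * real (m K))"
        also have "\<dots> \<le> ereal (\<delta> * real K)" using mK[of K] \<delta> by simp
        finally show False using that by simp
      qed
      then show ?thesis using inv[of K] by blast
    qed
    then show ?case using Suc by (simp add: mS)
  qed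
  show "\<bar>\<delta> * real (m K) - real_of_ereal (min (ereal (\<delta> * real K)) T)\<bar> \<le> \<delta>"
  proof -
    have "\<delta> * real (m K) \<le> \<delta> * real K" using mK[of K] \<delta> by simp
    then show ?thesis
      using inv[of K] \<delta> T by (cases T) (auto simp: min_def algebra_simps)
  qed
qed

section \<open>The reflected process\<close>

lemma less_hitting_time_iff:
  assumes "continuous_on {0..} (\<lambda>t. N t \<omega>)" "t \<ge> 0"
  shows "ereal t < hitting_time N a \<omega> \<longleftrightarrow> (\<forall>s\<in>{0..t}. N s \<omega> \<noteq> a)"
  by (rule hitting_time_cases[where N=N and \<omega>=\<omega> and a=a, OF assms(1)]) (use assms(2) in \<open>auto simp: not_less[symmetric]\<close>)

lemma hitting_time_nonneg: "hitting_time N a \<omega> \<ge> 0"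
  unfolding hitting_time_def by (rule Inf_greatest) auto

locale cm_reflection_process = cm_brownian \<mu> x k M B
  for \<mu> :: "'a::{banach,second_countable_topology} measure" and x :: 'a and k
    and M :: "'w measure" and B :: "real \<Rightarrow> 'w \<Rightarrow> 'a" +
  fixes N :: "real \<Rightarrow> 'w \<Rightarrow> real"
  assumes measurable_N: "\<And>t. t \<ge> 0 \<Longrightarrow> N t \<in> borel_measurable M"
    and continuous_N: "\<And>\<omega>. \<omega> \<in> space M \<Longrightarrow> continuous_on {0..} (\<lambda>t. N t \<omega>)"
    and N_eq_g: "\<And>t. t \<ge> 0 \<Longrightarrow> AE \<omega> in M. N t \<omega> = g (B t \<omega>)"
begin

abbreviation "a \<equiv> c\<^sup>2 / 2"

definition T :: "'w \<Rightarrow> ereal" where "T = hitting_time N a"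

definition S :: "real \<Rightarrow> 'w \<Rightarrow> real" where "S t \<omega> = real_of_ereal (min (ereal t) (T \<omega>))"

abbreviation "Rfl \<equiv> cm_reflection \<mu> x N B"

lemma T_nonneg: "T \<omega> \<ge> 0"
  by (simp add: T_def hitting_time_nonneg)

lemma ereal_S: "ereal (S t \<omega>) = min (ereal t) (T \<omega>)"
  using T_nonneg[of \<omega>] by (cases "T \<omega>") (auto simp: S_def min_def)

lemma S_nonneg: "t \<ge> 0 \<Longrightarrow> S t \<omega> \<ge> 0"
  using T_nonneg[of \<omega>] by (metis ereal_S ereal_less_eq(5) min.boundedI)

lemma S_lipschitz: "\<bar>S s \<omega> - S t \<omega>\<bar> \<le> \<bar>s - t\<bar>"
  using T_nonneg[of \<omega>] by (cases "T \<omega>") (auto simp: S_def min_def)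

lemma continuous_S: "continuous_on A (\<lambda>t. S t \<omega>)"
  unfolding continuous_on_iff dist_real_def by (meson S_lipschitz le_less_trans)

text \<open>At \<open>T\<close> the pairing equals \<open>c\<^sup>2 / 2\<close> and the coefficient
  of \<open>x\<close> becomes 1, so the formula for early times, with the pairing frozen at
  \<open>T\<close>, gives \<open>B t\<close> afterwards. The two branches join continuously.\<close>

lemma reflection_eq:
  assumes "\<omega> \<in> space M" "t \<ge> 0"
  shows "Rfl t \<omega> = x + B t \<omega> - (2 * (N (S t \<omega>) \<omega> / c\<^sup>2)) *\<^sub>R x"
proof (cases "ereal t < T \<omega>")
  case True
  then have "S t \<omega> = t" by (simp add: S_def)
  then show ?thesis using True by (simp add: cm_reflection_def cm_reflection_time_def T_def)
next
  case False
  from continuous_N[OF assms(1)] have "N (S t \<omega>) \<omega> = a"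
  proof (rule hitting_time_cases[of N \<omega> a])
    assume "hitting_time N a \<omega> = \<infinity>"
    then show ?thesis using False by (simp add: T_def)
  next
    fix h assume "hitting_time N a \<omega> = ereal h" "N h \<omega> = a"
    then show ?thesis using False by (simp add: S_def T_def min_def)
  qed
  then have one: "2 * (N (S t \<omega>) \<omega> / c\<^sup>2) = 1" using c_pos by simp
  have "Rfl t \<omega> = B t \<omega>" using False by (simp add: cm_reflection_def cm_reflection_time_def T_def)
  then show ?thesis unfolding one by simp
qed

lemma continuous_N_S: "\<omega> \<in> space M \<Longrightarrow> continuous_on {0..} (\<lambda>t. N (S t \<omega>) \<omega>)"
  by (rule continuous_on_compose2[OF continuous_N continuous_S]) (auto simp: S_nonneg)

lemma continuous_reflection:
  assumes "\<omega> \<in> space M"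
  shows "continuous_on {0..} (\<lambda>t. Rfl t \<omega>)"
proof -
  have "continuous_on {0..} (\<lambda>t. x + B t \<omega> - (2 * (N (S t \<omega>) \<omega> / c\<^sup>2)) *\<^sub>R x)"
    using c_pos by (intro continuous_intros continuous_B continuous_N_S assms) auto
  then show ?thesis
    by (rule continuous_on_eq) (use reflection_eq[OF assms] in auto)
qed

text \<open>The event that \<open>Y\<close> keeps away from the level up to time \<open>t\<close>,
  as a countable condition. With \<open>N\<close> for \<open>Y\<close> it is \<open>t < T\<close>;
  with \<open>g (B u)\<close> it agrees with this almost surely and belongs to the uncompleted past
  of \<open>B\<close>.\<close>

definition before :: "real \<Rightarrow> (real \<Rightarrow> 'w \<Rightarrow> real) \<Rightarrow> 'w set" where
  "before t Y = {\<omega>\<in>space M. \<exists>m::nat. \<forall>n j. j \<le> Suc n \<longrightarrow> 1 / real (Suc m) \<le> \<bar>Y (t / real (Suc n) * real j) \<omega> - a\<bar>}"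

lemma before_measurable:
  assumes t: "t \<ge> 0" and sp: "space K = space M" and Y: "\<And>u. 0 \<le> u \<Longrightarrow> u \<le> t \<Longrightarrow> Y u \<in> borel_measurable K"
  shows "before t Y \<in> sets K"
proof -
  \<comment> \<open>\<open>min\<close> keeps all times inside \<open>{0..t}\<close>, so that every
    \<open>Z n j\<close> is measurable with respect to \<open>K\<close>.\<close>
  define Z where "Z n j = Y (t / real (Suc n) * real (min j (Suc n)))" for n j
  have [measurable]: "Z n j \<in> borel_measurable K" for n j
    unfolding Z_def
  proof (rule Y)
    have "t * real (min j (Suc n)) \<le> t * real (Suc n)" using t by (intro mult_left_mono) auto
    then show "t / real (Suc n) * real (min j (Suc n)) \<le> t" by (simp add: pos_divide_le_eq)
  qed (use t in auto)
  have "{\<omega>\<in>space K. \<exists>m::nat. \<forall>n j. j \<le> Suc n \<longrightarrow> 1 / real (Suc m) \<le> \<bar>Z n j \<omega> - a\<bar>} \<in> sets K"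
    by measurable
  moreover have "(\<forall>n j. j \<le> Suc n \<longrightarrow> 1 / real (Suc m) \<le> \<bar>Z n j \<omega> - a\<bar>) \<longleftrightarrow>
     (\<forall>n j. j \<le> Suc n \<longrightarrow> 1 / real (Suc m) \<le> \<bar>Y (t / real (Suc n) * real j) \<omega> - a\<bar>)" for m \<omega>
  proof -
    have Z: "Z n j = Y (t / real (Suc n) * real j)" if "j \<le> Suc n" for n j
      using that by (simp only: Z_def min_absorb1)
    show ?thesis by (intro iff_allI imp_cong refl) (simp only: Z)
  qed
  ultimately show ?thesis by (simp only: before_def sp)
qed

lemma before_N: "t \<ge> 0 \<Longrightarrow> before t N = {\<omega>\<in>space M. ereal t < T \<omega>}"
  unfolding before_def T_def
proof (rule Collect_cong, rule conj_cong[OF refl])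
  fix \<omega> assume t: "t \<ge> 0" and \<omega>: "\<omega> \<in> space M"
  have "continuous_on {0..t} (\<lambda>s. N s \<omega>)" by (rule continuous_on_subset[OF continuous_N[OF \<omega>]]) auto
  from avoids_level_iff[OF this t, of a]
  show "(\<exists>m::nat. \<forall>n j. j \<le> Suc n \<longrightarrow> 1 / real (Suc m) \<le> \<bar>N (t / real (Suc n) * real j) \<omega> - a\<bar>) \<longleftrightarrow>
     ereal t < hitting_time N a \<omega>"
    unfolding less_hitting_time_iff[where N=N, OF continuous_N[OF \<omega>] t] by (rule sym)
qed

lemma AE_before_g: "t \<ge> 0 \<Longrightarrow> AE \<omega> in M. \<omega> \<in> before t (\<lambda>u \<omega>. g (B u \<omega>)) \<longleftrightarrow> ereal t < T \<omega>"
proof -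
  assume t: "t \<ge> 0"
  have "AE \<omega> in M. \<forall>n::nat. \<forall>j::nat. N (t / real (Suc n) * real j) \<omega> = g (B (t / real (Suc n) * real j) \<omega>)"
    unfolding AE_all_countable using t by (intro allI N_eq_g) auto
  then have "AE \<omega> in M. \<omega> \<in> before t (\<lambda>u \<omega>. g (B u \<omega>)) \<longleftrightarrow> \<omega> \<in> before t N"
    by eventually_elim (simp add: before_def)
  with AE_space show ?thesis
    by eventually_elim (simp add: before_N[OF t])
qed

lemma before_g_past: "t \<ge> 0 \<Longrightarrow> before t (\<lambda>u \<omega>. g (B u \<omega>)) \<in> sets (past t)"
proof (rule before_measurable)
  fix u assume "0 \<le> u" "u \<le> t"
  then have [measurable]: "B u \<in> borel_measurable (past t)" by (rule past_measurable)
  show "(\<lambda>\<omega>. g (B u \<omega>)) \<in> borel_measurable (past t)" by measurable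
qed auto

lemma less_T_measurable: "t \<ge> 0 \<Longrightarrow> {\<omega>\<in>space M. ereal t < T \<omega>} \<in> sets M"
  using before_measurable[of t M N] measurable_N before_N[of t] by simp

lemma measurable_T: "T \<in> borel_measurable M"
proof (rule borel_measurableI_greater)
  fix y :: ereal
  show "{\<omega>\<in>space M. y < T \<omega>} \<in> sets M"
  proof (cases "y < 0")
    case True
    then have "{\<omega>\<in>space M. y < T \<omega>} = space M" using T_nonneg less_le_trans by blast
    then show ?thesis by simp
  next
    case False
    then show ?thesis using less_T_measurable by (cases y) auto
  qed
qed

lemma measurable_reflection:
  assumes t: "t \<ge> 0"
  shows "Rfl t \<in> borel_measurable M"
proof -
  have [measurable]: "{\<omega>\<in>space M. ereal t < T \<omega>} \<in> sets M" "B t \<in> borel_measurable M" "N t \<in> borel_measurable M"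
    using t by (auto intro: less_T_measurable measurable_N)
  have "(\<lambda>\<omega>. if \<omega> \<in> {\<omega>\<in>space M. ereal t < T \<omega>} then x + B t \<omega> - (2 * (N t \<omega> / c\<^sup>2)) *\<^sub>R x else B t \<omega>) \<in> borel_measurable M"
    by measurable
  then show ?thesis
    by (rule measurable_cong[THEN iffD1, rotated]) (simp add: cm_reflection_def cm_reflection_time_def T_def)
qed

lemma AE_N_0: "AE \<omega> in M. N 0 \<omega> = 0"
proof -
  have "g 0 = 0" by (rule g_eqI) (simp add: blinfun.zero_right)
  with N_eq_g[of 0] AE_B_0 show ?thesis by (auto elim: eventually_elim2)
qed

text \<open>\<open>g\<close> is additive on its set of convergence, which contains
  \<open>B s\<close> and \<open>B t\<close> almost surely.\<close>

lemma AE_N_increment: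
  assumes "0 \<le> s" "s \<le> t"
  shows "AE \<omega> in M. N t \<omega> - N s \<omega> = g (B t \<omega> - B s \<omega>)"
proof -
  have "0 \<le> t" using assms by simp
  from AE_g_B[OF assms(1)] AE_g_B[OF this] N_eq_g[OF assms(1)] N_eq_g[OF this] show ?thesis
  proof eventually_elim
    case (elim \<omega>)
    have "(\<lambda>n. blinfun_apply (k n) (B t \<omega> - B s \<omega>)) \<longlonglongrightarrow> g (B t \<omega>) - g (B s \<omega>)"
      unfolding blinfun.diff_right by (intro tendsto_diff elim)
    from g_eqI[OF this] show ?case using elim by simp
  qed
qed

lemma AE_T_pos: "AE \<omega> in M. ereal 0 < T \<omega>"
  using AE_N_0 AE_space
proof eventually_elim
  case (elim \<omega>)
  then show ?case
    unfolding T_def using less_hitting_time_iff[where N=N, OF continuous_N[of \<omega>], of 0 a] c_pos by auto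
qed

lemma AE_reflection_0: "AE \<omega> in M. Rfl 0 \<omega> = x"
  using AE_T_pos AE_N_0 AE_B_0
  by eventually_elim (simp add: cm_reflection_def cm_reflection_time_def T_def)

end

lemma closed_bump:
  fixes C :: "'a::metric_space set"
  assumes "closed C"
  obtains f :: "nat \<Rightarrow> 'a \<Rightarrow> real" where "\<And>n. continuous_on UNIV (f n)" "\<And>n w. 0 \<le> f n w" "\<And>n w. f n w \<le> 1"
    "\<And>w. (\<lambda>n. f n w) \<longlonglongrightarrow> indicator C w"
proof (cases "C = {}")
  case True
  \<comment> \<open>Here \<open>infdist\<close> is 0 everywhere and the formula below would give the
    constant 1.\<close>
  then show thesis by (intro that[of "\<lambda>_ _. 0"]) auto
next
  case False
  define f where "f n w = max 0 (1 - real n * infdist w C)" for n w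
  show thesis
  proof (rule that)
    show "continuous_on UNIV (f n)" for n unfolding f_def by (intro continuous_intros)
    show "0 \<le> f n w" "f n w \<le> 1" for n w by (auto simp: f_def infdist_nonneg)
    show "(\<lambda>n. f n w) \<longlonglongrightarrow> indicator C w" for w
    proof (cases "w \<in> C")
      case True then show ?thesis by (simp add: f_def)
    next
      case w: False
      have "infdist w C \<noteq> 0" using in_closed_iff_infdist_zero[OF assms False] w by blast
      then have pos: "infdist w C > 0" using infdist_nonneg[of w C] by linarith
      obtain n0 :: nat where n0: "1 / infdist w C \<le> real n0" using real_arch_simple by blast
      have "f n w = indicator C w" if "n \<ge> n0" for n
      proof -
        have "1 / infdist w C \<le> real n" using n0 that by linarith
        then have "1 \<le> real n * infdist w C" using pos by (simp add: pos_divide_le_eq)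
        then show ?thesis using w by (simp add: f_def)
      qed
      then show ?thesis by (intro tendsto_eventually eventually_sequentiallyI)
    qed
  qed
qed

section \<open>Finite-dimensional distributions of the reflected process\<close>

context cm_reflection_process
begin

lemma switched_grid:
  assumes \<delta>: "\<delta> > 0" and E: "\<And>j. E j \<in> sets (past (\<delta> * real j))"
  shows "switched_increments M (\<lambda>j. past (\<delta> * real j)) (\<lambda>j \<omega>. B (\<delta> * real (Suc j)) \<omega> - B (\<delta> * real j) \<omega>)
    (distr \<mu> borel (\<lambda>z. sqrt \<delta> *\<^sub>R z)) reflect E"
proof (intro switched_increments.intro switched_increments_axioms.intro M.prob_space_axioms)
  show "sets (past (\<delta> * real j)) \<subseteq> sets M" for j using past_sets_events by blast
  show "sets (past (\<delta> * real j)) \<subseteq> sets (past (\<delta> * real (Suc j)))" for j using \<delta> by (intro past_sets_mono) simp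
  show "(\<lambda>\<omega>. B (\<delta> * real (Suc j)) \<omega> - B (\<delta> * real j) \<omega>) \<in> borel_measurable (past (\<delta> * real (Suc j)))" for j
    using \<delta> by (intro borel_measurable_diff past_measurable) auto
  show "E j \<in> sets (past (\<delta> * real j))" for j by (rule E)
  show "prob_space (distr \<mu> borel (\<lambda>z. sqrt \<delta> *\<^sub>R z))" by (rule prob_space_distr) simp
  show "distr (distr \<mu> borel (\<lambda>z. sqrt \<delta> *\<^sub>R z)) borel reflect = distr \<mu> borel (\<lambda>z. sqrt \<delta> *\<^sub>R z)"
    by (rule distr_reflect_scaleR)
  fix j and A :: "'a set" and G assume A: "A \<in> sets borel" and G: "G \<in> sets (past (\<delta> * real j))"
  let ?X = "\<lambda>\<omega>. B (\<delta> * real (Suc j)) \<omega> - B (\<delta> * real j) \<omega>"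
  have X: "?X \<in> borel_measurable M" using \<delta> by (intro borel_measurable_diff measurable_B) auto
  have st: "0 \<le> \<delta> * real j" "\<delta> * real j < \<delta> * real (Suc j)" using \<delta> by auto
  have d: "distr M borel ?X = distr \<mu> borel (\<lambda>z. sqrt \<delta> *\<^sub>R z)"
    using distr_increment[OF st] by (simp add: algebra_simps)
  have p: "M.prob {\<omega>\<in>space M. ?X \<omega> \<in> A} = measure (distr M borel ?X) A"
    using measure_distr[OF X A] by (simp add: vimage_def Int_def conj_commute)
  show "M.prob ({\<omega>\<in>space M. ?X \<omega> \<in> A} \<inter> G) = measure (distr \<mu> borel (\<lambda>z. sqrt \<delta> *\<^sub>R z)) A * M.prob G"
    unfolding d[symmetric] p[symmetric] by (rule indep_increment[OF st A G[unfolded sets_past]])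
qed auto

lemma integral_switched_grid:
  assumes \<delta>: "\<delta> > 0" and E: "\<And>j. E j \<in> sets (past (\<delta> * real j))"
    and \<Phi>: "\<Phi> \<in> borel_measurable (PiM {..<m} (\<lambda>_. borel))"
    and dep: "\<And>d d'. (\<And>j. j < m \<Longrightarrow> d j = d' j) \<Longrightarrow> \<Phi> d = \<Phi> d'"
  defines "D \<equiv> \<lambda>j \<omega>. B (\<delta> * real (Suc j)) \<omega> - B (\<delta> * real j) \<omega>"
  shows "(LINT \<omega>|M. \<Phi> (\<lambda>j. if \<omega> \<in> E j then reflect (D j \<omega>) else D j \<omega>)) = (LINT \<omega>|M. (\<Phi> (\<lambda>j. D j \<omega>) :: real))"
proof -
  have one: "(LINT \<omega>|M. \<Phi> (\<lambda>j. if \<omega> \<in> E' j then reflect (D j \<omega>) else D j \<omega>)) = (LINT d|PiM {..<m} (\<lambda>_. distr \<mu> borel (\<lambda>z. sqrt \<delta> *\<^sub>R z)). \<Phi> d)"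
    if E': "\<And>j. E' j \<in> sets (past (\<delta> * real j))" for E'
  proof -
    interpret sw: switched_increments M "\<lambda>j. past (\<delta> * real j)" D "distr \<mu> borel (\<lambda>z. sqrt \<delta> *\<^sub>R z)" reflect E'
      unfolding D_def by (rule switched_grid[OF \<delta> E'])
    have "(LINT d|PiM {..<m} (\<lambda>_. distr \<mu> borel (\<lambda>z. sqrt \<delta> *\<^sub>R z)). \<Phi> d) = (LINT \<omega>|M. \<Phi> (\<lambda>n\<in>{..<m}. sw.D' n \<omega>))"
      unfolding sw.distr_D'[symmetric] by (rule integral_distr[OF _ \<Phi>]) (intro measurable_restrict sw.D'_measurable)
    also have "\<dots> = (LINT \<omega>|M. \<Phi> (\<lambda>j. if \<omega> \<in> E' j then reflect (D j \<omega>) else D j \<omega>))"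
      by (intro Bochner_Integration.integral_cong refl dep) (simp add: sw.D'_def)
    finally show ?thesis by (rule sym)
  qed
  \<comment> \<open>Switching nowhere gives the original increments, with the same product
    law.\<close>
  from one[OF E] one[of "\<lambda>_. {}"] show ?thesis by simp
qed

text \<open>On a grid both integrals are those of one function of the increments, switched or not,
  and hence equal; continuity of the paths and boundedness of the test functions let the mesh tend
  to 0. Sums of increments start at 0, hence the subtraction of \<open>x\<close>.\<close>

lemma integral_reflection_fdd:
  assumes st: "0 \<le> s" "s < t" and J: "finite J" "J \<subseteq> {0..}"
    and f0: "continuous_on UNIV f0" "\<And>w. 0 \<le> f0 w" "\<And>w. f0 w \<le> 1"
    and f: "\<And>u. continuous_on UNIV (f u)" "\<And>u w. 0 \<le> f u w" "\<And>u w. f u w \<le> 1"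
  shows "(LINT \<omega>|M. f0 (Rfl t \<omega> - Rfl s \<omega>) * (\<Prod>u\<in>J. f u (Rfl u \<omega> - x))) =
         (LINT \<omega>|M. f0 (B t \<omega> - B s \<omega>) * (\<Prod>u\<in>J. f u (B u \<omega>)) :: real)"
proof -
  define \<delta> where "\<delta> n = 1 / real (Suc n)" for n
  have \<delta>: "\<delta> n > 0" for n by (simp add: \<delta>_def)
  have \<delta>0: "\<delta> \<longlonglongrightarrow> 0" unfolding \<delta>_def by (rule LIMSEQ_Suc[OF lim_1_over_n])
  define \<kappa> where "\<kappa> n u = nat \<lfloor>u * real (Suc n)\<rfloor>" for n u
  have \<kappa>: "\<bar>\<delta> n * real (\<kappa> n u) - u\<bar> \<le> \<delta> n" if "u \<ge> 0" for n u
  proof -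
    have "\<bar>real (\<kappa> n u) - u * real (Suc n)\<bar> \<le> 1" using that by (simp add: \<kappa>_def of_nat_nat) linarith
    then have "\<delta> n * \<bar>real (\<kappa> n u) - u * real (Suc n)\<bar> \<le> \<delta> n * 1" using \<delta>[of n] by (intro mult_left_mono) auto
    also have "\<delta> n * \<bar>real (\<kappa> n u) - u * real (Suc n)\<bar> = \<bar>\<delta> n * (real (\<kappa> n u) - u * real (Suc n))\<bar>"
      using \<delta>[of n] by (simp add: abs_mult)
    also have "\<delta> n * (real (\<kappa> n u) - u * real (Suc n)) = \<delta> n * real (\<kappa> n u) - u"
      by (simp add: \<delta>_def diff_divide_distrib)
    finally show ?thesis by simp
  qed
  have \<kappa>lim: "(\<lambda>n. \<delta> n * real (\<kappa> n u)) \<longlonglongrightarrow> u" if "u \<ge> 0" for u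
    by (rule LIM_zero_cancel, rule Lim_null_comparison[OF _ \<delta>0]) (use \<kappa>[OF that] in auto)
  have \<kappa>nn: "\<delta> n * real (\<kappa> n u) \<ge> 0" for n u using \<delta>[of n] by simp
  define D where "D n j \<omega> = B (\<delta> n * real (Suc j)) \<omega> - B (\<delta> n * real j) \<omega>" for n j \<omega>
  define E where "E n j = before (\<delta> n * real j) (\<lambda>u \<omega>. g (B u \<omega>))" for n j
  define D' where "D' n j \<omega> = (if \<omega> \<in> E n j then reflect (D n j \<omega>) else D n j \<omega>)" for n j \<omega>
  define \<Phi> where "\<Phi> n d = f0 ((\<Sum>j<\<kappa> n t. d j) - (\<Sum>j<\<kappa> n s. d j)) * (\<Prod>u\<in>J. f u (\<Sum>j<\<kappa> n u. d j))"
    for n and d :: "nat \<Rightarrow> 'a"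
  \<comment> \<open>The sum is a crude common bound for all grid indices that occur.\<close>
  define m where "m n = (\<Sum>u\<in>insert s (insert t J). \<kappa> n u)" for n
  have \<kappa>m: "\<kappa> n u \<le> m n" if "u \<in> insert s (insert t J)" for n u
    unfolding m_def by (rule member_le_sum) (use that J in auto)
  have f0m[measurable]: "f0 \<in> borel_measurable borel" and fm[measurable]: "f u \<in> borel_measurable borel" for u
    using f0(1) f(1) by (auto intro: borel_measurable_continuous_onI)
  have \<Phi>01: "0 \<le> \<Phi> n d" "\<Phi> n d \<le> 1" for n d
    unfolding \<Phi>_def using f0 f by (auto intro!: mult_nonneg_nonneg prod_nonneg mult_le_one prod_le_1)
  have summ: "(\<lambda>d. \<Sum>j<\<kappa> n u. d j) \<in> borel_measurable (PiM {..<m n} (\<lambda>_. borel :: 'a measure))" if "u \<in> insert s (insert t J)" for n u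
    using \<kappa>m[OF that, of n] by (intro borel_measurable_sum measurable_component_singleton) auto
  have \<Phi>m: "\<Phi> n \<in> borel_measurable (PiM {..<m n} (\<lambda>_. borel))" for n
  proof -
    have "(\<lambda>d. f0 ((\<Sum>j<\<kappa> n t. d j) - (\<Sum>j<\<kappa> n s. d j))) \<in> borel_measurable (PiM {..<m n} (\<lambda>_. borel))"
      by (intro measurable_compose[OF _ f0m] borel_measurable_diff summ) auto
    moreover have "(\<lambda>d. f u (\<Sum>j<\<kappa> n u. d j)) \<in> borel_measurable (PiM {..<m n} (\<lambda>_. borel))" if "u \<in> J" for u
      using summ[of u n] that by (intro measurable_compose[OF _ fm]) auto
    ultimately show ?thesis unfolding \<Phi>_def by (intro borel_measurable_times borel_measurable_prod) auto
  qed
  have eq: "(LINT \<omega>|M. \<Phi> n (\<lambda>j. D' n j \<omega>)) = (LINT \<omega>|M. \<Phi> n (\<lambda>j. D n j \<omega>))" for n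
    unfolding D'_def D_def
  proof (rule integral_switched_grid[OF \<delta> _ \<Phi>m])
    show "E n j \<in> sets (past (\<delta> n * real j))" for j unfolding E_def using \<delta>[of n] by (intro before_g_past) simp
    fix d d' :: "nat \<Rightarrow> 'a" assume dd: "\<And>j. j < m n \<Longrightarrow> d j = d' j"
    have "(\<Sum>j<\<kappa> n u. d j) = (\<Sum>j<\<kappa> n u. d' j)" if "u \<in> insert s (insert t J)" for u
      using \<kappa>m[OF that, of n] dd by (intro sum.cong) auto
    then show "\<Phi> n d = \<Phi> n d'" unfolding \<Phi>_def by simp
  qed
  have Dm[measurable]: "D n j \<in> borel_measurable M" for n j
    unfolding D_def using \<delta>[of n] by (intro borel_measurable_diff measurable_B) auto
  have Em[measurable]: "E n j \<in> sets M" for n j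
    unfolding E_def using \<delta>[of n] by (intro past_sets_events[OF before_g_past]) simp
  have D'm[measurable]: "D' n j \<in> borel_measurable M" for n j unfolding D'_def by measurable
  have \<Phi>Mm: "(\<lambda>\<omega>. \<Phi> n (\<lambda>j. X j \<omega>)) \<in> borel_measurable M" if "\<And>j. X j \<in> borel_measurable M" for n X
  proof -
    note [measurable] = that
    show ?thesis unfolding \<Phi>_def by measurable
  qed
  have \<Phi>lim: "(\<lambda>n. \<Phi> n (d n)) \<longlonglongrightarrow> f0 (L t - L s) * (\<Prod>u\<in>J. f u (L u))"
    if L: "\<And>u. u \<ge> 0 \<Longrightarrow> (\<lambda>n. \<Sum>j<\<kappa> n u. d n j) \<longlonglongrightarrow> L u" for d L
    unfolding \<Phi>_def
  proof (intro tendsto_mult tendsto_prod)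
    show "(\<lambda>n. f0 ((\<Sum>j<\<kappa> n t. d n j) - (\<Sum>j<\<kappa> n s. d n j))) \<longlonglongrightarrow> f0 (L t - L s)"
      using st by (intro continuous_on_tendsto_compose[OF f0(1)] tendsto_diff L) auto
    show "(\<lambda>n. f u (\<Sum>j<\<kappa> n u. d n j)) \<longlonglongrightarrow> f u (L u)" if "u \<in> J" for u
      using that J by (intro continuous_on_tendsto_compose[OF f(1)] L) auto
  qed
  have sumD: "(\<Sum>j<K. D n j \<omega>) = B (\<delta> n * real K) \<omega> - B 0 \<omega>" for n K \<omega>
    unfolding D_def using sum_lessThan_telescope[of "\<lambda>j. B (\<delta> n * real j) \<omega>" K] by simp
  have Blim: "(\<lambda>n. B (\<delta> n * real (\<kappa> n u)) \<omega>) \<longlonglongrightarrow> B u \<omega>" if "u \<ge> 0" "\<omega> \<in> space M" for u \<omega>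
    by (rule continuous_on_tendsto_compose[OF continuous_B[OF that(2)] \<kappa>lim[OF that(1)]]) (use that \<kappa>nn in auto)
  have limD: "(\<lambda>n. LINT \<omega>|M. \<Phi> n (\<lambda>j. D n j \<omega>)) \<longlonglongrightarrow> (LINT \<omega>|M. f0 (B t \<omega> - B s \<omega>) * (\<Prod>u\<in>J. f u (B u \<omega>)))"
  proof (rule integral_dominated_convergence[where w="\<lambda>_. 1"])
    show "AE \<omega> in M. (\<lambda>n. \<Phi> n (\<lambda>j. D n j \<omega>)) \<longlonglongrightarrow> f0 (B t \<omega> - B s \<omega>) * (\<Prod>u\<in>J. f u (B u \<omega>))"
      using AE_B_0 AE_space
    proof eventually_elim
      case (elim \<omega>)
      show ?case by (rule \<Phi>lim) (use Blim[OF _ elim(2)] elim(1) in \<open>simp add: sumD\<close>)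
    qed
    have "(\<lambda>\<omega>. f0 (B t \<omega> - B s \<omega>)) \<in> borel_measurable M"
      using st by (intro measurable_compose[OF _ f0m] borel_measurable_diff measurable_B) auto
    moreover have "(\<lambda>\<omega>. f u (B u \<omega>)) \<in> borel_measurable M" if "u \<in> J" for u
      using that J by (intro measurable_compose[OF _ fm]) auto
    ultimately show "(\<lambda>\<omega>. f0 (B t \<omega> - B s \<omega>) * (\<Prod>u\<in>J. f u (B u \<omega>))) \<in> borel_measurable M"
      by (intro borel_measurable_times borel_measurable_prod) auto
  qed (use \<Phi>01 \<Phi>Mm[OF Dm] in auto)
  have limD': "(\<lambda>n. LINT \<omega>|M. \<Phi> n (\<lambda>j. D' n j \<omega>)) \<longlonglongrightarrow> (LINT \<omega>|M. f0 (Rfl t \<omega> - Rfl s \<omega>) * (\<Prod>u\<in>J. f u (Rfl u \<omega> - x)))"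
  proof (rule integral_dominated_convergence[where w="\<lambda>_. 1"])
    have "AE \<omega> in M. \<forall>n j. \<omega> \<in> E n j \<longleftrightarrow> ereal (\<delta> n * real j) < T \<omega>"
      unfolding AE_all_countable E_def using \<delta> by (intro allI AE_before_g) (simp add: less_imp_le)
    moreover have "AE \<omega> in M. \<forall>n j. N (\<delta> n * real (Suc j)) \<omega> - N (\<delta> n * real j) \<omega> = g (D n j \<omega>)"
      unfolding AE_all_countable D_def using \<delta> by (intro allI AE_N_increment) (auto simp: less_imp_le)
    ultimately show "AE \<omega> in M. (\<lambda>n. \<Phi> n (\<lambda>j. D' n j \<omega>)) \<longlonglongrightarrow> f0 (Rfl t \<omega> - Rfl s \<omega>) * (\<Prod>u\<in>J. f u (Rfl u \<omega> - x))"
      using AE_B_0 AE_N_0 AE_space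
    proof eventually_elim
      case (elim \<omega>)
      define q where "q n K = card {j. j < K \<and> ereal (\<delta> n * real j) < T \<omega>}" for n K
      \<comment> \<open>Where the switch is on, the increment is lowered by
        \<open>2 / c\<^sup>2\<close> times the increment of \<open>N\<close> along \<open>x\<close>;
        these steps form an initial segment, so their sum is \<open>N\<close> at the stopped grid
        time.\<close>
      have sumD': "(\<Sum>j<K. D' n j \<omega>) = B (\<delta> n * real K) \<omega> - (2 / c\<^sup>2 * N (\<delta> n * real (q n K)) \<omega>) *\<^sub>R x" for n K
      proof -
        have "D' n j \<omega> = D n j \<omega> - (2 / c\<^sup>2 * (if ereal (\<delta> n * real j) < T \<omega> then N (\<delta> n * real (Suc j)) \<omega> - N (\<delta> n * real j) \<omega> else 0)) *\<^sub>R x" for j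
          using elim(1)[rule_format, of n j] elim(2)[rule_format, of n j] unfolding D'_def reflect_def by simp
        then have "(\<Sum>j<K. D' n j \<omega>) = (\<Sum>j<K. D n j \<omega>) -
          (2 / c\<^sup>2 * (\<Sum>j<K. if ereal (\<delta> n * real j) < T \<omega> then N (\<delta> n * real (Suc j)) \<omega> - N (\<delta> n * real j) \<omega> else 0)) *\<^sub>R x"
          by (simp add: sum_subtractf scaleR_sum_left[symmetric] sum_distrib_left)
        also have "(\<Sum>j<K. if ereal (\<delta> n * real j) < T \<omega> then N (\<delta> n * real (Suc j)) \<omega> - N (\<delta> n * real j) \<omega> else 0) =
            N (\<delta> n * real (q n K)) \<omega> - N (\<delta> n * real 0) \<omega>"
          unfolding q_def by (rule grid_stopping(1)[OF \<delta> T_nonneg, of n \<omega> "\<lambda>j. N (\<delta> n * real j) \<omega>"])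
        finally show ?thesis using elim by (simp add: sumD)
      qed
      have qlim: "(\<lambda>n. \<delta> n * real (q n (\<kappa> n u))) \<longlonglongrightarrow> S u \<omega>" if "u \<ge> 0" for u
      proof -
        \<comment> \<open>One mesh from rounding the stopped time to the grid, one from rounding
          \<open>u\<close>.\<close>
        have b: "\<bar>\<delta> n * real (q n (\<kappa> n u)) - S u \<omega>\<bar> \<le> 2 * \<delta> n" for n
        proof -
          have "\<bar>\<delta> n * real (q n (\<kappa> n u)) - S (\<delta> n * real (\<kappa> n u)) \<omega>\<bar> \<le> \<delta> n"
            unfolding q_def S_def by (rule grid_stopping(2)[OF \<delta> T_nonneg])
          then show ?thesis using S_lipschitz[of "\<delta> n * real (\<kappa> n u)" \<omega> u] \<kappa>[OF that, of n] by linarith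
        qed
        show ?thesis
          by (rule LIM_zero_cancel, rule Lim_null_comparison[OF _ tendsto_mult_right_zero[OF \<delta>0, of 2]])
             (simp only: real_norm_def b eventually_True)
      qed
      have "(\<lambda>n. \<Phi> n (\<lambda>j. D' n j \<omega>)) \<longlonglongrightarrow> f0 ((Rfl t \<omega> - x) - (Rfl s \<omega> - x)) * (\<Prod>u\<in>J. f u (Rfl u \<omega> - x))"
      proof (rule \<Phi>lim)
        fix u :: real assume u: "u \<ge> 0"
        have "(\<lambda>n. N (\<delta> n * real (q n (\<kappa> n u))) \<omega>) \<longlonglongrightarrow> N (S u \<omega>) \<omega>"
          by (rule continuous_on_tendsto_compose[OF continuous_N[OF elim(5)] qlim[OF u]])
             (use S_nonneg[OF u] \<delta> in \<open>auto simp: less_imp_le\<close>)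
        then have "(\<lambda>n. B (\<delta> n * real (\<kappa> n u)) \<omega> - (2 / c\<^sup>2 * N (\<delta> n * real (q n (\<kappa> n u))) \<omega>) *\<^sub>R x) \<longlonglongrightarrow>
            B u \<omega> - (2 / c\<^sup>2 * N (S u \<omega>) \<omega>) *\<^sub>R x"
          by (intro tendsto_intros Blim[OF u elim(5)])
        then show "(\<lambda>n. \<Sum>j<\<kappa> n u. D' n j \<omega>) \<longlonglongrightarrow> Rfl u \<omega> - x"
          unfolding sumD' reflection_eq[OF elim(5) u] by simp
      qed
      then show ?case by simp
    qed
    have "(\<lambda>\<omega>. f0 (Rfl t \<omega> - Rfl s \<omega>)) \<in> borel_measurable M"
      using st by (intro measurable_compose[OF _ f0m] borel_measurable_diff measurable_reflection) auto
    moreover have "(\<lambda>\<omega>. f u (Rfl u \<omega> - x)) \<in> borel_measurable M" if "u \<in> J" for u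
      using that J by (intro measurable_compose[OF _ fm] borel_measurable_diff measurable_reflection) auto
    ultimately show "(\<lambda>\<omega>. f0 (Rfl t \<omega> - Rfl s \<omega>) * (\<Prod>u\<in>J. f u (Rfl u \<omega> - x))) \<in> borel_measurable M"
      by (intro borel_measurable_times borel_measurable_prod) auto
  qed (use \<Phi>01 \<Phi>Mm[OF D'm] in auto)
  show ?thesis using LIMSEQ_unique[OF limD' limD[folded eq]] .
qed

end

section \<open>The reflected process is a Brownian motion\<close>

context cm_reflection_process
begin

lemma prob_reflection_fdd:
  assumes st: "0 \<le> s" "s < t" and J: "finite J" "J \<subseteq> {0..}"
    and C: "closed C0" "\<And>u. closed (C u)"
  shows "M.prob {\<omega>\<in>space M. Rfl t \<omega> - Rfl s \<omega> \<in> C0 \<and> (\<forall>u\<in>J. Rfl u \<omega> - x \<in> C u)} =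
         M.prob {\<omega>\<in>space M. B t \<omega> - B s \<omega> \<in> C0 \<and> (\<forall>u\<in>J. B u \<omega> \<in> C u)}"
proof -
  obtain f0 :: "nat \<Rightarrow> 'a \<Rightarrow> real" where f0: "\<And>n. continuous_on UNIV (f0 n)" "\<And>n w. 0 \<le> f0 n w" "\<And>n w. f0 n w \<le> 1"
    "\<And>w. (\<lambda>n. f0 n w) \<longlonglongrightarrow> indicator C0 w"
    using closed_bump[OF C(1)] by blast
  have "\<exists>h :: nat \<Rightarrow> 'a \<Rightarrow> real. (\<forall>n. continuous_on UNIV (h n)) \<and> (\<forall>n w. 0 \<le> h n w) \<and> (\<forall>n w. h n w \<le> 1) \<and>
      (\<forall>w. (\<lambda>n. h n w) \<longlonglongrightarrow> indicator (C u) w)" for u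
    by (rule closed_bump[OF C(2)[of u]]) blast
  then have "\<exists>f :: real \<Rightarrow> nat \<Rightarrow> 'a \<Rightarrow> real. \<forall>u. (\<forall>n. continuous_on UNIV (f u n)) \<and> (\<forall>n w. 0 \<le> f u n w) \<and> (\<forall>n w. f u n w \<le> 1) \<and>
      (\<forall>w. (\<lambda>n. f u n w) \<longlonglongrightarrow> indicator (C u) w)"
    by (intro choice allI)
  then obtain f :: "real \<Rightarrow> nat \<Rightarrow> 'a \<Rightarrow> real" where f: "\<And>u n. continuous_on UNIV (f u n)" "\<And>u n w. 0 \<le> f u n w" "\<And>u n w. f u n w \<le> 1"
    "\<And>u w. (\<lambda>n. f u n w) \<longlonglongrightarrow> indicator (C u) w"
    by blast
  have lim: "(\<lambda>n. LINT \<omega>|M. f0 n (V \<omega>) * (\<Prod>u\<in>J. f u n (W u \<omega>))) \<longlonglongrightarrow>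
      M.prob {\<omega>\<in>space M. V \<omega> \<in> C0 \<and> (\<forall>u\<in>J. W u \<omega> \<in> C u)}"
    if V: "V \<in> borel_measurable M" and W: "\<And>u. u \<in> J \<Longrightarrow> W u \<in> borel_measurable M" for V :: "'w \<Rightarrow> 'a" and W
  proof -
    let ?A = "{\<omega>\<in>space M. V \<omega> \<in> C0 \<and> (\<forall>u\<in>J. W u \<omega> \<in> C u)}"
    have A: "?A \<in> sets M"
    proof -
      have "?A = (V -` C0 \<inter> space M) \<inter> {\<omega>\<in>space M. \<forall>u\<in>J. W u \<omega> \<in> C u}" by auto
      moreover have "{\<omega>\<in>space M. \<forall>u\<in>J. W u \<omega> \<in> C u} \<in> sets M"
      proof (rule sets.sets_Collect_finite_All[OF _ J(1)])
        fix u assume "u \<in> J"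
        from measurable_sets[OF W[OF this] borel_closed[OF C(2)[of u]]]
        show "{\<omega>\<in>space M. W u \<omega> \<in> C u} \<in> sets M" by (simp add: vimage_def Int_def conj_commute)
      qed
      ultimately show ?thesis using measurable_sets[OF V borel_closed[OF C(1)]] by auto
    qed
    have p: "(\<Prod>u\<in>J. indicator (C u) (W u \<omega>) :: real) = (if \<forall>u\<in>J. W u \<omega> \<in> C u then 1 else 0)" for \<omega>
      using J(1) by (induction J) (auto simp: indicator_def)
    have "(\<lambda>n. LINT \<omega>|M. f0 n (V \<omega>) * (\<Prod>u\<in>J. f u n (W u \<omega>))) \<longlonglongrightarrow> (LINT \<omega>|M. indicator C0 (V \<omega>) * (\<Prod>u\<in>J. indicator (C u) (W u \<omega>)))"
    proof (rule integral_dominated_convergence[where w="\<lambda>_. 1"])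
      have m: "(\<lambda>\<omega>. h (W u \<omega>)) \<in> borel_measurable M" if "h \<in> borel_measurable borel" "u \<in> J" for h :: "'a \<Rightarrow> real" and u
        using measurable_compose[OF W that(1)] that(2) by blast
      have fm: "f0 n \<in> borel_measurable borel" "f u n \<in> borel_measurable borel" for u n
        by (rule borel_measurable_continuous_onI, rule f0 f)+
      have im: "indicator C0 \<in> borel_measurable borel" "indicator (C u) \<in> borel_measurable borel" for u
        using C by (auto intro!: borel_measurable_indicator borel_closed)
      show "(\<lambda>\<omega>. indicator C0 (V \<omega>) * (\<Prod>u\<in>J. indicator (C u) (W u \<omega>)) :: real) \<in> borel_measurable M"
        by (intro borel_measurable_times borel_measurable_prod m im measurable_compose[OF V])
      show "(\<lambda>\<omega>. f0 n (V \<omega>) * (\<Prod>u\<in>J. f u n (W u \<omega>))) \<in> borel_measurable M" for n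
        by (intro borel_measurable_times borel_measurable_prod m fm measurable_compose[OF V])
      show "AE \<omega> in M. (\<lambda>n. f0 n (V \<omega>) * (\<Prod>u\<in>J. f u n (W u \<omega>))) \<longlonglongrightarrow> indicator C0 (V \<omega>) * (\<Prod>u\<in>J. indicator (C u) (W u \<omega>))"
        by (intro AE_I2 tendsto_mult tendsto_prod f0 f)
      show "AE \<omega> in M. norm (f0 n (V \<omega>) * (\<Prod>u\<in>J. f u n (W u \<omega>))) \<le> 1" for n
      proof (rule AE_I2)
        fix \<omega>
        have "0 \<le> (\<Prod>u\<in>J. f u n (W u \<omega>))" "(\<Prod>u\<in>J. f u n (W u \<omega>)) \<le> 1" using f by (auto intro!: prod_nonneg prod_le_1)
        then show "norm (f0 n (V \<omega>) * (\<Prod>u\<in>J. f u n (W u \<omega>))) \<le> 1"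
          using f0(2,3)[of n "V \<omega>"] by (simp add: abs_mult mult_le_one)
      qed
    qed simp
    also have "(LINT \<omega>|M. indicator C0 (V \<omega>) * (\<Prod>u\<in>J. indicator (C u) (W u \<omega>))) = (LINT \<omega>|M. indicator ?A \<omega> :: real)"
      unfolding p by (intro Bochner_Integration.integral_cong refl) (simp add: indicator_def)
    also have "\<dots> = M.prob ?A" using A by simp
    finally show ?thesis .
  qed
  have "(\<lambda>n. LINT \<omega>|M. f0 n (Rfl t \<omega> - Rfl s \<omega>) * (\<Prod>u\<in>J. f u n (Rfl u \<omega> - x))) \<longlonglongrightarrow>
      M.prob {\<omega>\<in>space M. Rfl t \<omega> - Rfl s \<omega> \<in> C0 \<and> (\<forall>u\<in>J. Rfl u \<omega> - x \<in> C u)}"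
    using st J by (intro lim borel_measurable_diff measurable_reflection borel_measurable_const) auto
  moreover have "(\<lambda>n. LINT \<omega>|M. f0 n (B t \<omega> - B s \<omega>) * (\<Prod>u\<in>J. f u n (B u \<omega>))) \<longlonglongrightarrow>
      M.prob {\<omega>\<in>space M. B t \<omega> - B s \<omega> \<in> C0 \<and> (\<forall>u\<in>J. B u \<omega> \<in> C u)}"
    using st J by (intro lim borel_measurable_diff measurable_B) auto
  moreover have "(LINT \<omega>|M. f0 n (Rfl t \<omega> - Rfl s \<omega>) * (\<Prod>u\<in>J. f u n (Rfl u \<omega> - x))) =
      (LINT \<omega>|M. f0 n (B t \<omega> - B s \<omega>) * (\<Prod>u\<in>J. f u n (B u \<omega>)))" for n
    by (rule integral_reflection_fdd[OF st J f0(1,2,3) f(1,2,3)])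
  ultimately show ?thesis using LIMSEQ_unique by simp
qed

lemma distr_reflection_increment:
  assumes st: "0 \<le> s" "s < t"
  shows "distr M borel (\<lambda>\<omega>. Rfl t \<omega> - Rfl s \<omega>) = distr M borel (\<lambda>\<omega>. B t \<omega> - B s \<omega>)"
proof (rule measure_eqI_generator_eq[where E="Collect closed" and \<Omega>=UNIV and A="\<lambda>_. UNIV"])
  have R: "(\<lambda>\<omega>. Rfl t \<omega> - Rfl s \<omega>) \<in> borel_measurable M" and Bm: "(\<lambda>\<omega>. B t \<omega> - B s \<omega>) \<in> borel_measurable M"
    using st by (auto intro!: borel_measurable_diff measurable_reflection measurable_B)
  interpret R: prob_space "distr M borel (\<lambda>\<omega>. Rfl t \<omega> - Rfl s \<omega>)" by (rule M.prob_space_distr[OF R])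
  show "Int_stable (Collect closed)" by (auto simp: Int_stable_def)
  show "emeasure (distr M borel (\<lambda>\<omega>. Rfl t \<omega> - Rfl s \<omega>)) X = emeasure (distr M borel (\<lambda>\<omega>. B t \<omega> - B s \<omega>)) X" if "X \<in> Collect closed" for X
  proof -
    have X: "closed X" "X \<in> sets borel" using that borel_closed by auto
    have "(\<lambda>\<omega>. Rfl t \<omega> - Rfl s \<omega>) -` X \<inter> space M = {\<omega>\<in>space M. Rfl t \<omega> - Rfl s \<omega> \<in> X \<and> (\<forall>u\<in>{}. Rfl u \<omega> - x \<in> UNIV)}"
      and "(\<lambda>\<omega>. B t \<omega> - B s \<omega>) -` X \<inter> space M = {\<omega>\<in>space M. B t \<omega> - B s \<omega> \<in> X \<and> (\<forall>u\<in>{}. B u \<omega> \<in> UNIV)}" by auto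
    then show ?thesis
      using prob_reflection_fdd[OF st finite.emptyI empty_subsetI X(1), of "\<lambda>_. UNIV"] X(2)
      by (simp only: emeasure_distr[OF R] emeasure_distr[OF Bm] M.emeasure_eq_measure closed_UNIV)
  qed
  show "emeasure (distr M borel (\<lambda>\<omega>. Rfl t \<omega> - Rfl s \<omega>)) ((\<lambda>_. UNIV) i) \<noteq> \<infinity>" for i :: nat
    by (simp add: R.emeasure_eq_measure)
qed (auto simp: borel_eq_closed)

text \<open>Independence depends only on the joint laws of the increment with finitely many earlier
  values, which are those of \<open>B\<close> up to the shift by \<open>x\<close>. Cylinders over
  closed sets are an intersection-stable generator of the past.\<close>

lemma indep_reflection_increment:
  assumes st: "0 \<le> s" "s < t"
  shows "M.indep_set {(\<lambda>\<omega>. Rfl t \<omega> - Rfl s \<omega>) -` A \<inter> space M | A. A \<in> sets borel} (past_sets M Rfl s)"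
proof -
  define V where "V \<omega> = Rfl t \<omega> - Rfl s \<omega>" for \<omega>
  define \<A> where "\<A> = {V -` C \<inter> space M | C. closed C}"
  define cyl where "cyl J C = {\<omega>\<in>space M. \<forall>u\<in>J. Rfl u \<omega> \<in> C u}" for J :: "real set" and C :: "real \<Rightarrow> 'a set"
  define \<G> where "\<G> = {cyl J C | J C. finite J \<and> J \<subseteq> {0..s} \<and> (\<forall>u. closed (C u))}"
  have V: "V \<in> borel_measurable M"
    unfolding V_def using st by (intro borel_measurable_diff measurable_reflection) auto
  have cylM: "cyl J C \<in> sets M" if "finite J" "J \<subseteq> {0..s}" "\<And>u. closed (C u)" for J C
    unfolding cyl_def
  proof (rule sets.sets_Collect_finite_All[OF _ that(1)])
    fix u assume "u \<in> J"
    then have "Rfl u \<in> borel_measurable M" using that by (intro measurable_reflection) auto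
    from measurable_sets[OF this borel_closed[OF that(3)[of u]]]
    show "{\<omega>\<in>space M. Rfl u \<omega> \<in> C u} \<in> sets M" by (simp add: vimage_def Int_def conj_commute)
  qed
  have "M.indep_set \<A> \<G>"
  proof (rule M.indep_setI)
    show "\<A> \<subseteq> M.events" unfolding \<A>_def using measurable_sets[OF V borel_closed] by blast
    show "\<G> \<subseteq> M.events" unfolding \<G>_def using cylM by blast
    fix X Y assume "X \<in> \<A>" "Y \<in> \<G>"
    then obtain C0 J C where X: "X = V -` C0 \<inter> space M" "closed C0"
      and Y: "Y = cyl J C" "finite J" "J \<subseteq> {0..s}" "\<And>u. closed (C u)"
      unfolding \<A>_def \<G>_def by blast
    \<comment> \<open>\<open>prob_reflection_fdd\<close> concerns \<open>Rfl u - x\<close>, so the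
      sets are moved by \<open>- x\<close>.\<close>
    define C' where "C' u = (\<lambda>w. w + x) -` C u" for u
    have C': "closed (C' u)" for u
      unfolding C'_def by (intro closed_vimage Y(4) continuous_intros)
    have J0: "J \<subseteq> {0..}" using Y(3) by auto
    have cC: "Rfl u \<omega> \<in> C u \<longleftrightarrow> Rfl u \<omega> - x \<in> C' u" for u \<omega> by (simp add: C'_def)
    note fdd = prob_reflection_fdd[OF st Y(2) J0 _ C']
    let ?F = "{\<omega>\<in>space M. \<forall>u\<in>J. B u \<omega> \<in> C' u}"
    have F: "?F \<in> past_sets M B s"
    proof -
      have "{\<omega>\<in>space (past s). \<forall>u\<in>J. B u \<omega> \<in> C' u} \<in> sets (past s)"
      proof (rule sets.sets_Collect_finite_All[OF _ Y(2)])
        fix u assume "u \<in> J"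
        then have "B u \<in> borel_measurable (past s)" using Y(3) by (intro past_measurable) auto
        from measurable_sets[OF this borel_closed[OF C'[of u]]]
        show "{\<omega>\<in>space (past s). B u \<omega> \<in> C' u} \<in> sets (past s)" by (simp add: vimage_def Int_def conj_commute)
      qed
      then show ?thesis by (simp add: sets_past)
    qed
    have "M.prob (X \<inter> Y) = M.prob {\<omega>\<in>space M. Rfl t \<omega> - Rfl s \<omega> \<in> C0 \<and> (\<forall>u\<in>J. Rfl u \<omega> - x \<in> C' u)}"
      unfolding X Y cyl_def V_def cC by (rule arg_cong[where f=M.prob]) auto
    also have "\<dots> = M.prob {\<omega>\<in>space M. B t \<omega> - B s \<omega> \<in> C0 \<and> (\<forall>u\<in>J. B u \<omega> \<in> C' u)}"
      by (rule fdd[OF X(2)])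
    also have "\<dots> = M.prob ({\<omega>\<in>space M. B t \<omega> - B s \<omega> \<in> C0} \<inter> ?F)"
      by (rule arg_cong[where f=M.prob]) auto
    also have "\<dots> = M.prob {\<omega>\<in>space M. B t \<omega> - B s \<omega> \<in> C0} * M.prob ?F"
      by (rule indep_increment[OF st borel_closed[OF X(2)] F])
    \<comment> \<open>The marginals are special cases of the same identity: no earlier times here,
      the whole space for the increment below.\<close>
    also have "M.prob {\<omega>\<in>space M. B t \<omega> - B s \<omega> \<in> C0} = M.prob X"
      using prob_reflection_fdd[OF st finite.emptyI empty_subsetI X(2), of "\<lambda>_. UNIV"]
      by (simp add: X V_def vimage_def Int_def conj_commute)
    also have "M.prob ?F = M.prob Y"
      using fdd[OF closed_UNIV] by (simp add: Y cyl_def cC)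
    finally show "M.prob (X \<inter> Y) = M.prob X * M.prob Y" .
  qed
  moreover have "Int_stable \<A>"
  proof (rule Int_stableI)
    fix X Y assume "X \<in> \<A>" "Y \<in> \<A>"
    then obtain C D where "X = V -` C \<inter> space M" "closed C" "Y = V -` D \<inter> space M" "closed D" unfolding \<A>_def by blast
    then have "X \<inter> Y = V -` (C \<inter> D) \<inter> space M" "closed (C \<inter> D)" by auto
    then show "X \<inter> Y \<in> \<A>" unfolding \<A>_def by blast
  qed
  moreover have "Int_stable \<G>"
  proof (rule Int_stableI)
    fix X Y assume "X \<in> \<G>" "Y \<in> \<G>"
    then obtain J C J' C' where X: "X = cyl J C" "finite J" "J \<subseteq> {0..s}" "\<forall>u. closed (C u)"
      and Y: "Y = cyl J' C'" "finite J'" "J' \<subseteq> {0..s}" "\<forall>u. closed (C' u)" unfolding \<G>_def by blast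
    define C'' where "C'' u = (if u \<in> J then C u else UNIV) \<inter> (if u \<in> J' then C' u else UNIV)" for u
    have "X \<inter> Y = cyl (J \<union> J') C''"
      unfolding X Y cyl_def C''_def by (auto split: if_splits)
    moreover have "\<forall>u. closed (C'' u)" using X Y by (auto simp: C''_def)
    moreover have "finite (J \<union> J')" "J \<union> J' \<subseteq> {0..s}" using X Y by auto
    ultimately show "X \<inter> Y \<in> \<G>" unfolding \<G>_def by blast
  qed
  ultimately have ind: "M.indep_set (sigma_sets (space M) \<A>) (sigma_sets (space M) \<G>)"
    by (rule M.indep_set_sigma_sets)
  have closed_gen: "f -` A \<inter> space M \<in> sigma_sets (space M) \<H>"
    if "\<And>C. closed C \<Longrightarrow> f -` C \<inter> space M \<in> \<H>" "\<H> \<subseteq> Pow (space M)" "A \<in> sets borel" for f :: "'w \<Rightarrow> 'a" and \<H> A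
  proof -
    have "f \<in> measurable (sigma (space M) \<H>) (sigma UNIV (Collect closed))"
      using that(1,2) by (intro measurable_measure_of) (auto simp: space_measure_of sets_measure_of intro: sigma_sets.Basic)
    then have "f \<in> borel_measurable (sigma (space M) \<H>)" by (simp add: borel_eq_closed[symmetric])
    from measurable_sets[OF this that(3)] show ?thesis using that(2) by (simp add: space_measure_of sets_measure_of)
  qed
  have "{(\<lambda>\<omega>. Rfl t \<omega> - Rfl s \<omega>) -` A \<inter> space M | A. A \<in> sets borel} \<subseteq> sigma_sets (space M) \<A>"
  proof
    fix X assume "X \<in> {(\<lambda>\<omega>. Rfl t \<omega> - Rfl s \<omega>) -` A \<inter> space M | A. A \<in> sets borel}"
    then obtain A where A: "X = V -` A \<inter> space M" "A \<in> sets borel" unfolding V_def by blast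
    show "X \<in> sigma_sets (space M) \<A>" unfolding A(1) by (rule closed_gen[OF _ _ A(2)]) (auto simp: \<A>_def)
  qed
  moreover have "past_sets M Rfl s \<subseteq> sigma_sets (space M) \<G>"
    unfolding past_sets_def
  proof (rule sigma_sets_mono, rule subsetI)
    fix X assume "X \<in> {Rfl u -` A \<inter> space M | u A. 0 \<le> u \<and> u \<le> s \<and> A \<in> sets borel}"
    then obtain u A where A: "X = Rfl u -` A \<inter> space M" "0 \<le> u" "u \<le> s" "A \<in> sets borel" by blast
    show "X \<in> sigma_sets (space M) \<G>" unfolding A(1)
    proof (rule closed_gen[OF _ _ A(4)])
      fix C :: "'a set" assume "closed C"
      moreover have "Rfl u -` C \<inter> space M = cyl {u} (\<lambda>_. C)" by (auto simp: cyl_def)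
      ultimately show "Rfl u -` C \<inter> space M \<in> \<G>" unfolding \<G>_def using A by force
    qed (auto simp: \<G>_def cyl_def)
  qed
  ultimately show ?thesis using ind unfolding M.indep_sets2_eq by blast
qed

theorem brownian_motion_reflection: "brownian_motion M \<mu> x Rfl"
  unfolding brownian_motion_def
  using M.prob_space_axioms measurable_reflection continuous_reflection AE_reflection_0
    distr_reflection_increment distr_increment indep_reflection_increment by simp

section \<open>Maximality and the coupling time\<close>

lemma N_at_T:
  assumes "\<omega> \<in> space M" "T \<omega> = ereal h"
  shows "h \<ge> 0" "N h \<omega> = a" "\<And>t. 0 \<le> t \<Longrightarrow> t < h \<Longrightarrow> N t \<omega> \<noteq> a"
proof -
  have "h \<ge> 0 \<and> N h \<omega> = a \<and> (\<forall>t. 0 \<le> t \<longrightarrow> t < h \<longrightarrow> N t \<omega> \<noteq> a)"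
    by (rule hitting_time_cases[where N=N and \<omega>=\<omega> and a=a, OF continuous_N[OF assms(1)]])
       (use assms(2) in \<open>auto simp: T_def\<close>)
  then show "h \<ge> 0" "N h \<omega> = a" "\<And>t. 0 \<le> t \<Longrightarrow> t < h \<Longrightarrow> N t \<omega> \<noteq> a" by auto
qed

text \<open>Before \<open>T\<close> the two processes differ by
  \<open>(1 - 2 * (N t / c\<^sup>2)) *\<^sub>R x\<close>, which vanishes only at the level itself;
  so they cannot even touch earlier.\<close>

lemma meets_at_iff:
  assumes \<omega>: "\<omega> \<in> space M" and t: "t \<ge> 0"
  shows "t \<in> meet_times B Rfl \<omega> \<longleftrightarrow> T \<omega> \<le> ereal t"
proof
  assume "T \<omega> \<le> ereal t"
  then have "Rfl (t + s) \<omega> = B (t + s) \<omega>" if "s \<ge> 0" for s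
  proof -
    have "ereal t \<le> ereal (t + s)" using that by simp
    with \<open>T \<omega> \<le> ereal t\<close> have "\<not> ereal (t + s) < T \<omega>" by (meson leD order_trans)
    then show ?thesis by (simp add: cm_reflection_def cm_reflection_time_def T_def)
  qed
  then show "t \<in> meet_times B Rfl \<omega>" using t by (simp add: meet_times_def)
next
  assume m: "t \<in> meet_times B Rfl \<omega>"
  show "T \<omega> \<le> ereal t"
  proof (rule ccontr)
    assume "\<not> T \<omega> \<le> ereal t"
    then have lt: "ereal t < T \<omega>" by simp
    have "B (t + 0) \<omega> = Rfl (t + 0) \<omega>" using m unfolding meet_times_def by blast
    then have "x = (2 * (N t \<omega> / c\<^sup>2)) *\<^sub>R x"
      using lt by (simp add: cm_reflection_def cm_reflection_time_def T_def algebra_simps)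
    then have "(1 - 2 * (N t \<omega> / c\<^sup>2)) *\<^sub>R x = 0" by (simp add: scaleR_left_diff_distrib)
    then have "N t \<omega> = a" using nonzero c_pos by (simp add: field_simps)
    moreover have "N t \<omega> \<noteq> a"
      using lt less_hitting_time_iff[where N=N, OF continuous_N[OF \<omega>] t, of a] t by (auto simp: T_def)
    ultimately show False by simp
  qed
qed

lemma meets_by_iff:
  assumes \<omega>: "\<omega> \<in> space M" and t: "t \<ge> 0"
  shows "meets_by B Rfl t \<omega> \<longleftrightarrow> T \<omega> \<le> ereal t"
proof
  assume "meets_by B Rfl t \<omega>"
  then obtain \<tau> where \<tau>: "\<tau> \<in> meet_times B Rfl \<omega>" "\<tau> \<le> t" by (auto simp: meets_by_def)
  then have "0 \<le> \<tau>" by (simp add: meet_times_def)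
  with \<tau> meets_at_iff[OF \<omega>] have "T \<omega> \<le> ereal \<tau>" by blast
  with \<tau>(2) show "T \<omega> \<le> ereal t" by (meson ereal_less_eq(3) order_trans)
next
  assume "T \<omega> \<le> ereal t"
  then show "meets_by B Rfl t \<omega>" using meets_at_iff[OF \<omega> t] by (auto simp: meets_by_def)
qed

lemma coupling_time_eq:
  assumes \<omega>: "\<omega> \<in> space M"
  shows "coupling_time B Rfl \<omega> = T \<omega>"
  unfolding coupling_time_def
proof (rule antisym)
  show "T \<omega> \<le> Inf (ereal ` meet_times B Rfl \<omega>)"
  proof (rule Inf_greatest)
    fix y assume "y \<in> ereal ` meet_times B Rfl \<omega>"
    then obtain t where "y = ereal t" "t \<in> meet_times B Rfl \<omega>" by blast
    moreover from this have "t \<ge> 0" by (simp add: meet_times_def)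
    ultimately show "T \<omega> \<le> y" using meets_at_iff[OF \<omega>] by blast
  qed
  show "Inf (ereal ` meet_times B Rfl \<omega>) \<le> T \<omega>"
  proof (cases "T \<omega>")
    case (real h)
    then have "h \<in> meet_times B Rfl \<omega>" using meets_at_iff[OF \<omega>, of h] N_at_T(1)[OF \<omega> real] by simp
    then show ?thesis unfolding real by (intro Inf_lower) simp
  next
    case PInf then show ?thesis by simp
  next
    case MInf then show ?thesis using T_nonneg[of \<omega>] by simp
  qed
qed

text \<open>This set attains the total variation distance of the two laws at every time.\<close>

definition half_space :: "'a set" where
  "half_space = {w. Cauchy (\<lambda>n. blinfun_apply (k n) w) \<and> a \<le> g w}"

lemma half_space_borel[measurable]: "half_space \<in> sets borel"
proof -
  have "Measurable.pred borel (\<lambda>w. Cauchy (\<lambda>n. blinfun_apply (k n) w) \<and> a \<le> g w)" by measurable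
  then show ?thesis by (simp add: half_space_def pred_def)
qed

lemma AE_B_half_space:
  assumes "t \<ge> 0"
  shows "AE \<omega> in M. B t \<omega> \<in> half_space \<longleftrightarrow> a \<le> N t \<omega>"
  using AE_g_B[OF assms] N_eq_g[OF assms]
  by eventually_elim (simp add: half_space_def Cauchy_k_iff)

text \<open>In the limit along \<open>k n\<close> the reflected value becomes
  \<open>c\<^sup>2 - N t\<close>, because \<open>k n x\<close> tends to \<open>c\<^sup>2\<close>:
  the two sides of the level \<open>c\<^sup>2 / 2\<close> are exchanged. From \<open>T\<close> on
  nothing is reflected.\<close>

lemma AE_reflection_half_space:
  assumes "t \<ge> 0"
  shows "AE \<omega> in M. Rfl t \<omega> \<in> half_space \<longleftrightarrow> (if ereal t < T \<omega> then N t \<omega> \<le> a else a \<le> N t \<omega>)"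
  using AE_g_B[OF assms] N_eq_g[OF assms] AE_B_half_space[OF assms]
proof eventually_elim
  case (elim \<omega>)
  show ?case
  proof (cases "ereal t < T \<omega>")
    case True
    let ?w = "x + B t \<omega> - (2 * (N t \<omega> / c\<^sup>2)) *\<^sub>R x"
    have "(\<lambda>n. blinfun_apply (k n) ?w) \<longlonglongrightarrow> c\<^sup>2 + g (B t \<omega>) - (2 * (N t \<omega> / c\<^sup>2)) * c\<^sup>2"
      unfolding blinfun.bilinear_simps scaleR_conv_of_real of_real_eq_id id_apply
      by (intro tendsto_intros k_x_tendsto elim)
    then have lim: "(\<lambda>n. blinfun_apply (k n) ?w) \<longlonglongrightarrow> c\<^sup>2 - N t \<omega>" using elim(2) c_pos by simp
    then have "?w \<in> half_space \<longleftrightarrow> a \<le> c\<^sup>2 - N t \<omega>"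
      using g_eqI[OF lim] by (simp add: half_space_def LIMSEQ_imp_Cauchy)
    moreover have "Rfl t \<omega> = ?w" using True by (simp add: cm_reflection_def cm_reflection_time_def T_def)
    moreover have "a \<le> c\<^sup>2 - N t \<omega> \<longleftrightarrow> N t \<omega> \<le> a" by auto
    ultimately show ?thesis using True by simp
  next
    case False
    then show ?thesis using elim(3) by (simp add: cm_reflection_def cm_reflection_time_def T_def)
  qed
qed

text \<open>\<open>N\<close> starts at 0, below the level, and a continuous path cannot cross the
  level without attaining it.\<close>

lemma AE_less_T:
  assumes "t \<ge> 0"
  shows "AE \<omega> in M. ereal t < T \<omega> \<longrightarrow> N t \<omega> < a"
  using AE_N_0 AE_space
proof eventually_elim
  case (elim \<omega>)
  show ?case
  proof (rule impI, rule ccontr)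
    assume lt: "ereal t < T \<omega>" and "\<not> N t \<omega> < a"
    then have "a \<le> N t \<omega>" by simp
    moreover have "N 0 \<omega> \<le> a" using elim(1) by simp
    moreover have "continuous_on {0..t} (\<lambda>s. N s \<omega>)" by (rule continuous_on_subset[OF continuous_N[OF elim(2)]]) auto
    ultimately obtain s where "0 \<le> s" "s \<le> t" "N s \<omega> = a" using IVT'[of "\<lambda>s. N s \<omega>" 0 a t] assms by blast
    moreover have "\<forall>s\<in>{0..t}. N s \<omega> \<noteq> a"
      using lt less_hitting_time_iff[where N=N, OF continuous_N[OF elim(2)] assms, of a] by (simp add: T_def)
    ultimately show False by auto
  qed
qed

text \<open>While \<open>t < T\<close>, the reflected value lies in the half space and
  \<open>B t\<close> does not; from \<open>T\<close> on the two values coincide. Up to null sets the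
  events therefore differ by exactly \<open>t < T\<close>.\<close>

lemma prob_half_space_diff:
  assumes t: "t \<ge> 0"
  shows "measure (distr M borel (Rfl t)) half_space - measure (distr M borel (B t)) half_space = M.prob {\<omega>\<in>space M. ereal t < T \<omega>}"
proof -
  have m: "Rfl t \<in> borel_measurable M" "B t \<in> borel_measurable M" "N t \<in> borel_measurable M"
    using t by (auto intro: measurable_reflection measurable_N)
  have lT: "{\<omega>\<in>space M. ereal t < T \<omega>} \<in> sets M" by (rule less_T_measurable[OF t])
  have R: "{\<omega>\<in>space M. Rfl t \<omega> \<in> half_space} \<in> sets M" "{\<omega>\<in>space M. B t \<omega> \<in> half_space} \<in> sets M"
    using measurable_sets[OF m(1) half_space_borel] measurable_sets[OF m(2) half_space_borel] by (simp_all add: vimage_def Int_def conj_commute)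
  have "measure (distr M borel (Rfl t)) half_space = M.prob {\<omega>\<in>space M. Rfl t \<omega> \<in> half_space}"
    "measure (distr M borel (B t)) half_space = M.prob {\<omega>\<in>space M. B t \<omega> \<in> half_space}"
    using m by (simp_all add: measure_distr vimage_def Int_def conj_commute)
  moreover have "M.prob {\<omega>\<in>space M. Rfl t \<omega> \<in> half_space} = M.prob ({\<omega>\<in>space M. B t \<omega> \<in> half_space} - {\<omega>\<in>space M. ereal t < T \<omega>} \<union> {\<omega>\<in>space M. ereal t < T \<omega>})"
  proof (rule M.finite_measure_eq_AE)
    show "AE \<omega> in M. (\<omega> \<in> {\<omega>\<in>space M. Rfl t \<omega> \<in> half_space}) = (\<omega> \<in> {\<omega>\<in>space M. B t \<omega> \<in> half_space} - {\<omega>\<in>space M. ereal t < T \<omega>} \<union> {\<omega>\<in>space M. ereal t < T \<omega>})"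
      using AE_reflection_half_space[OF t] AE_B_half_space[OF t] AE_less_T[OF t]
      by eventually_elim auto
  qed (use R lT in auto)
  moreover have "\<dots> = M.prob ({\<omega>\<in>space M. B t \<omega> \<in> half_space} - {\<omega>\<in>space M. ereal t < T \<omega>}) + M.prob {\<omega>\<in>space M. ereal t < T \<omega>}"
    using R lT by (intro M.finite_measure_Union) auto
  moreover have "M.prob ({\<omega>\<in>space M. B t \<omega> \<in> half_space} - {\<omega>\<in>space M. ereal t < T \<omega>}) = M.prob {\<omega>\<in>space M. B t \<omega> \<in> half_space}"
  proof (rule M.finite_measure_eq_AE)
    show "AE \<omega> in M. (\<omega> \<in> {\<omega>\<in>space M. B t \<omega> \<in> half_space} - {\<omega>\<in>space M. ereal t < T \<omega>}) = (\<omega> \<in> {\<omega>\<in>space M. B t \<omega> \<in> half_space})"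
      using AE_B_half_space[OF t] AE_less_T[OF t] by eventually_elim auto
  qed (use R lT in auto)
  ultimately show ?thesis by simp
qed

lemma tv_dist_reflection:
  assumes t: "t \<ge> 0"
  shows "tv_dist (distr M borel (Rfl t)) (distr M borel (B t)) = M.prob {\<omega>\<in>space M. ereal t < T \<omega>}"
  unfolding tv_dist_def
proof (rule antisym)
  have m: "Rfl t \<in> borel_measurable M" "B t \<in> borel_measurable M" using t by (auto intro: measurable_reflection)
  have lT: "{\<omega>\<in>space M. ereal t < T \<omega>} \<in> sets M" by (rule less_T_measurable[OF t])
  have le: "\<bar>measure (distr M borel (Rfl t)) A - measure (distr M borel (B t)) A\<bar> \<le> M.prob {\<omega>\<in>space M. ereal t < T \<omega>}"
    if A: "A \<in> sets borel" for A
  proof -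
    define U V L where "U = {\<omega>\<in>space M. Rfl t \<omega> \<in> A}" and "V = {\<omega>\<in>space M. B t \<omega> \<in> A}" and "L = {\<omega>\<in>space M. ereal t < T \<omega>}"
    have ev: "U \<in> sets M" "V \<in> sets M" "L \<in> sets M" unfolding U_def V_def L_def
      using measurable_sets[OF m(1) A] measurable_sets[OF m(2) A] lT by (simp_all add: vimage_def Int_def conj_commute)
    \<comment> \<open>Coupling inequality: away from \<open>L\<close> the two values agree.\<close>
    have "U \<subseteq> V \<union> L" "V \<subseteq> U \<union> L"
      by (auto simp: U_def V_def L_def cm_reflection_def cm_reflection_time_def T_def)
    then have "M.prob U \<le> M.prob (V \<union> L)" "M.prob V \<le> M.prob (U \<union> L)"
      using ev by (auto intro!: M.finite_measure_mono)
    moreover have "M.prob (V \<union> L) \<le> M.prob V + M.prob L" "M.prob (U \<union> L) \<le> M.prob U + M.prob L"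
      using ev by (auto intro!: measure_Un_le)
    moreover have "measure (distr M borel (Rfl t)) A = M.prob U" "measure (distr M borel (B t)) A = M.prob V"
      unfolding U_def V_def using m A by (simp_all add: measure_distr vimage_def Int_def conj_commute)
    ultimately show ?thesis by (auto simp: L_def abs_le_iff)
  qed
  show "(SUP A\<in>sets borel. \<bar>measure (distr M borel (Rfl t)) A - measure (distr M borel (B t)) A\<bar>) \<le> M.prob {\<omega>\<in>space M. ereal t < T \<omega>}"
    by (rule cSUP_least) (use le in auto)
  have "\<bar>measure (distr M borel (Rfl t)) half_space - measure (distr M borel (B t)) half_space\<bar>
     \<le> (SUP A\<in>sets borel. \<bar>measure (distr M borel (Rfl t)) A - measure (distr M borel (B t)) A\<bar>)"
    by (rule cSUP_upper[OF half_space_borel]) (use le in \<open>auto intro!: bdd_aboveI2\<close>)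
  then show "M.prob {\<omega>\<in>space M. ereal t < T \<omega>} \<le> (SUP A\<in>sets borel. \<bar>measure (distr M borel (Rfl t)) A - measure (distr M borel (B t)) A\<bar>)"
    unfolding prob_half_space_diff[OF t] by simp
qed

theorem maximal_coupling_reflection: "maximal_coupling M \<mu> B 0 Rfl x"
  unfolding maximal_coupling_def coupling_def
proof (intro conjI bm brownian_motion_reflection allI impI)
  fix t :: real assume t: "t \<ge> 0"
  have "{\<omega>\<in>space M. meets_by B Rfl t \<omega>} = space M - {\<omega>\<in>space M. ereal t < T \<omega>}"
    using meets_by_iff[OF _ t] by auto
  then show "M.prob {\<omega>\<in>space M. meets_by B Rfl t \<omega>} = 1 - tv_dist (distr M borel (Rfl t)) (distr M borel (B t))"
    by (simp add: M.prob_compl[OF less_T_measurable[OF t]] tv_dist_reflection[OF t])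
qed

section \<open>Almost sure finiteness of the hitting time\<close>

definition half_space' :: "'a set" where
  "half_space' = {w. Cauchy (\<lambda>n. blinfun_apply (k n) w) \<and> - a \<le> g w}"

lemma half_space'_borel: "half_space' \<in> sets borel"
proof -
  have "Measurable.pred borel (\<lambda>w. Cauchy (\<lambda>n. blinfun_apply (k n) w) \<and> - a \<le> g w)" by measurable
  then show ?thesis by (simp add: half_space'_def pred_def)
qed

text \<open>Since \<open>k n x\<close> tends to \<open>c\<^sup>2\<close>, which is twice the level,
  translation by \<open>- x\<close> preserves convergence and turns the threshold \<open>a\<close>
  into \<open>- a\<close>. The clause on Cauchy sequences makes this hold for every
  \<open>w\<close>, not just almost everywhere.\<close>

lemma half_space_shift: "w \<in> half_space \<longleftrightarrow> w - x \<in> half_space'"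
proof -
  have shift: "(\<lambda>n. blinfun_apply (k n) (w - x)) \<longlonglongrightarrow> r - c\<^sup>2" if "(\<lambda>n. blinfun_apply (k n) w) \<longlonglongrightarrow> r" for w r
    unfolding blinfun.diff_right by (intro tendsto_diff that k_x_tendsto)
  have unshift: "(\<lambda>n. blinfun_apply (k n) w) \<longlonglongrightarrow> r + c\<^sup>2" if "(\<lambda>n. blinfun_apply (k n) (w - x)) \<longlonglongrightarrow> r" for w r
    using tendsto_add[OF that k_x_tendsto] by (simp add: blinfun.diff_right)
  have a2: "- a \<le> r - c\<^sup>2 \<longleftrightarrow> a \<le> r" for r by auto
  show ?thesis
  proof
    assume "w \<in> half_space"
    then have w: "(\<lambda>n. blinfun_apply (k n) w) \<longlonglongrightarrow> g w" "a \<le> g w" by (auto simp: half_space_def Cauchy_k_iff)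
    from shift[OF w(1)] g_eqI[OF shift[OF w(1)]] w(2) show "w - x \<in> half_space'"
      unfolding half_space'_def Cauchy_k_iff by simp
  next
    assume "w - x \<in> half_space'"
    then have w: "(\<lambda>n. blinfun_apply (k n) (w - x)) \<longlonglongrightarrow> g (w - x)" "- a \<le> g (w - x)" by (auto simp: half_space'_def Cauchy_k_iff)
    from unshift[OF w(1)] g_eqI[OF unshift[OF w(1)]] w(2) show "w \<in> half_space"
      unfolding half_space_def Cauchy_k_iff by simp
  qed
qed

text \<open>On this event \<open>g (B t)\<close> is bounded by the level in modulus. As
  \<open>g\<close> is only a limit of functionals, the small ball bound is applied to each
  \<open>k n\<close> and carried over by the limit inferior of the events \<open>A n\<close>;
  Brownian scaling gives the radius \<open>c\<^sup>2 / sqrt t\<close>.\<close>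

lemma prob_small_pairing:
  assumes t: "t > 0"
  shows "c * M.prob {\<omega>\<in>space M. B t \<omega> \<in> half_space' \<and> B t \<omega> \<notin> half_space} \<le> c\<^sup>2 / sqrt t"
proof -
  define r where "r = c\<^sup>2 / sqrt t"
  have r: "r \<ge> 0" using t by (simp add: r_def)
  define A where "A n = {\<omega>\<in>space M. \<bar>blinfun_apply (k n) (B t \<omega> - B 0 \<omega>)\<bar> \<le> c\<^sup>2}" for n
  have [measurable]: "B t \<in> borel_measurable M" "B 0 \<in> borel_measurable M" using t by auto
  have A[measurable]: "A n \<in> sets M" for n unfolding A_def by measurable
  have pA: "sd \<mu> (k n) * M.prob (A n) \<le> r" for n
  proof -
    have "M.prob (A n) = measure (distr M borel (\<lambda>\<omega>. B t \<omega> - B 0 \<omega>)) {w. \<bar>blinfun_apply (k n) w\<bar> \<le> c\<^sup>2}"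
      unfolding A_def by (subst measure_distr) (auto intro!: arg_cong[where f=M.prob])
    also have "\<dots> = measure (distr \<mu> borel (\<lambda>z. sqrt t *\<^sub>R z)) {w. \<bar>blinfun_apply (k n) w\<bar> \<le> c\<^sup>2}"
      using distr_increment[of 0 t] t by simp
    also have "\<dots> = measure \<mu> {z. \<bar>blinfun_apply (k n) z\<bar> \<le> r}"
      using t by (subst measure_distr)
        (auto intro!: arg_cong[where f="measure \<mu>"] simp: blinfun.scaleR_right abs_mult r_def pos_le_divide_eq mult.commute)
    finally show ?thesis using small_ball_functional[OF r, of "k n"] by simp
  qed
  define C where "C n = (\<Inter>m\<in>{n..}. A m)" for n
  have C[measurable]: "C n \<in> sets M" for n unfolding C_def by (intro sets.countable_INT') auto
  have pC: "c * M.prob (C n) \<le> r" for n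
  proof (rule LIMSEQ_le_const2[OF tendsto_mult[OF sd_k_tendsto tendsto_const]])
    have "sd \<mu> (k m) * M.prob (C n) \<le> r" if "m \<ge> n" for m
    proof -
      have "M.prob (C n) \<le> M.prob (A m)" using that by (intro M.finite_measure_mono) (auto simp: C_def)
      then have "sd \<mu> (k m) * M.prob (C n) \<le> sd \<mu> (k m) * M.prob (A m)" by (intro mult_left_mono sd_nonneg)
      then show ?thesis using pA[of m] by linarith
    qed
    then show "\<exists>N. \<forall>m\<ge>N. sd \<mu> (k m) * M.prob (C n) \<le> r" by blast
  qed
  have "(\<lambda>n. M.prob (C n)) \<longlonglongrightarrow> M.prob (\<Union>n. C n)"
    by (rule M.finite_Lim_measure_incseq) (auto simp: incseq_def C_def)
  from tendsto_mult_left[OF this, of c] have "c * M.prob (\<Union>n. C n) \<le> r"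
    by (rule LIMSEQ_le_const2) (use pC in blast)
  moreover have "M.prob {\<omega>\<in>space M. B t \<omega> \<in> half_space' \<and> B t \<omega> \<notin> half_space} \<le> M.prob (\<Union>n. C n)"
  proof (rule M.finite_measure_mono_AE)
    show "AE \<omega> in M. \<omega> \<in> {\<omega>\<in>space M. B t \<omega> \<in> half_space' \<and> B t \<omega> \<notin> half_space} \<longrightarrow> \<omega> \<in> (\<Union>n. C n)"
      using AE_B_0
    proof eventually_elim
      case (elim \<omega>)
      show ?case
      proof
        assume "\<omega> \<in> {\<omega>\<in>space M. B t \<omega> \<in> half_space' \<and> B t \<omega> \<notin> half_space}"
        then have w: "\<omega> \<in> space M" "(\<lambda>n. blinfun_apply (k n) (B t \<omega>)) \<longlonglongrightarrow> g (B t \<omega>)" "\<bar>g (B t \<omega>)\<bar> \<le> a"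
          by (auto simp: half_space'_def half_space_def Cauchy_k_iff)
        \<comment> \<open>The strict gap between \<open>a\<close> and \<open>c\<^sup>2\<close> lets
          the bound on the limit pass to all late \<open>k m\<close>.\<close>
        have "\<bar>g (B t \<omega>)\<bar> < c\<^sup>2" using w(3) c_pos by (simp add: field_simps) (smt (verit) zero_less_power)
        from order_tendstoD(2)[OF tendsto_rabs[OF w(2)] this]
        obtain n where "\<And>m. m \<ge> n \<Longrightarrow> \<bar>blinfun_apply (k m) (B t \<omega>)\<bar> < c\<^sup>2" by (auto simp: eventually_sequentially)
        then have "\<omega> \<in> C n" using w(1) elim by (auto simp: C_def A_def intro: less_imp_le)
        then show "\<omega> \<in> (\<Union>n. C n)" by blast
      qed
    qed
  qed auto
  then have "c * M.prob {\<omega>\<in>space M. B t \<omega> \<in> half_space' \<and> B t \<omega> \<notin> half_space} \<le> c * M.prob (\<Union>n. C n)"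
    using c_pos by (intro mult_left_mono) auto
  ultimately show ?thesis by (simp add: r_def)
qed

text \<open>Since \<open>Rfl t - x\<close> and \<open>B t\<close> have the same law, the survival probability of \<open>T\<close> is the mass
  which \<open>N t\<close> puts on the interval \<open>[-a, a)\<close>.\<close>

lemma prob_less_T:
  assumes t: "t > 0"
  shows "c * M.prob {\<omega>\<in>space M. ereal t < T \<omega>} \<le> c\<^sup>2 / sqrt t"
proof -
  have m: "Rfl t \<in> borel_measurable M" "Rfl 0 \<in> borel_measurable M" "B t \<in> borel_measurable M" "B 0 \<in> borel_measurable M"
    using t by (auto intro: measurable_reflection)
  have ev: "{\<omega>\<in>space M. f \<omega> \<in> A} \<in> sets M" if "f \<in> borel_measurable M" "A \<in> sets borel" for f :: "'w \<Rightarrow> 'a" and A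
    using measurable_sets[OF that] by (simp add: vimage_def Int_def conj_commute)
  have md: "measure (distr M borel f) A = M.prob {\<omega>\<in>space M. f \<omega> \<in> A}" if "f \<in> borel_measurable M" "A \<in> sets borel" for f :: "'w \<Rightarrow> 'a" and A
    using measure_distr[OF that] by (simp add: vimage_def Int_def conj_commute)
  have dm: "(\<lambda>\<omega>. Rfl t \<omega> - Rfl 0 \<omega>) \<in> borel_measurable M" "(\<lambda>\<omega>. B t \<omega> - B 0 \<omega>) \<in> borel_measurable M"
    by (intro borel_measurable_diff m)+
  have "measure (distr M borel (Rfl t)) half_space = M.prob {\<omega>\<in>space M. Rfl t \<omega> - Rfl 0 \<omega> \<in> half_space'}"
    unfolding md[OF m(1) half_space_borel]
  proof (rule M.finite_measure_eq_AE)
    show "AE \<omega> in M. (\<omega> \<in> {\<omega>\<in>space M. Rfl t \<omega> \<in> half_space}) = (\<omega> \<in> {\<omega>\<in>space M. Rfl t \<omega> - Rfl 0 \<omega> \<in> half_space'})"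
      using AE_reflection_0 by eventually_elim (simp add: half_space_shift)
  qed (auto intro: ev m half_space_borel ev[OF dm(1) half_space'_borel])
  also have "\<dots> = M.prob {\<omega>\<in>space M. B t \<omega> - B 0 \<omega> \<in> half_space'}"
    unfolding md[OF dm(1) half_space'_borel, symmetric] md[OF dm(2) half_space'_borel, symmetric]
    using distr_reflection_increment[of 0 t] t by simp
  also have "\<dots> = M.prob {\<omega>\<in>space M. B t \<omega> \<in> half_space'}"
  proof (rule M.finite_measure_eq_AE)
    show "AE \<omega> in M. (\<omega> \<in> {\<omega>\<in>space M. B t \<omega> - B 0 \<omega> \<in> half_space'}) = (\<omega> \<in> {\<omega>\<in>space M. B t \<omega> \<in> half_space'})"
      using AE_B_0 by eventually_elim simp
  qed (auto intro: ev[OF m(3) half_space'_borel] ev[OF dm(2) half_space'_borel])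
  finally have "M.prob {\<omega>\<in>space M. ereal t < T \<omega>} = M.prob {\<omega>\<in>space M. B t \<omega> \<in> half_space'} - M.prob {\<omega>\<in>space M. B t \<omega> \<in> half_space}"
    using prob_half_space_diff[of t] t md[OF m(3) half_space_borel] by simp
  also have "\<dots> = M.prob ({\<omega>\<in>space M. B t \<omega> \<in> half_space'} - {\<omega>\<in>space M. B t \<omega> \<in> half_space})"
  proof (rule M.finite_measure_Diff[symmetric])
    have "- a \<le> r" if "a \<le> r" for r
    proof -
      have "0 \<le> c\<^sup>2" by simp
      then show ?thesis using that by linarith
    qed
    then show "{\<omega>\<in>space M. B t \<omega> \<in> half_space} \<subseteq> {\<omega>\<in>space M. B t \<omega> \<in> half_space'}"
      by (auto simp del: divide_minus_left simp: half_space_def half_space'_def)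
  qed (auto intro: ev[OF m(3) half_space'_borel] ev[OF m(3) half_space_borel])
  also have "{\<omega>\<in>space M. B t \<omega> \<in> half_space'} - {\<omega>\<in>space M. B t \<omega> \<in> half_space} = {\<omega>\<in>space M. B t \<omega> \<in> half_space' \<and> B t \<omega> \<notin> half_space}" by auto
  finally show ?thesis using prob_small_pairing[OF t] by simp
qed

lemma AE_T_finite: "AE \<omega> in M. T \<omega> < \<infinity>"
proof -
  define Z where "Z = {\<omega>\<in>space M. T \<omega> = \<infinity>}"
  note [measurable] = measurable_T
  have Z: "Z \<in> sets M" unfolding Z_def by measurable
  have "c * M.prob Z \<le> c\<^sup>2 / sqrt (real (Suc n))" for n
  proof -
    have "M.prob Z \<le> M.prob {\<omega>\<in>space M. ereal (real (Suc n)) < T \<omega>}"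
      by (rule M.finite_measure_mono) (auto simp: Z_def intro: less_T_measurable)
    then have "c * M.prob Z \<le> c * M.prob {\<omega>\<in>space M. ereal (real (Suc n)) < T \<omega>}" using c_pos by (intro mult_left_mono) auto
    also have "\<dots> \<le> c\<^sup>2 / sqrt (real (Suc n))" by (rule prob_less_T) simp
    finally show ?thesis .
  qed
  moreover have "(\<lambda>n. c\<^sup>2 / sqrt (real (Suc n))) \<longlonglongrightarrow> 0"
    by (intro tendsto_divide_0[OF tendsto_const] filterlim_at_top_imp_at_infinity
        filterlim_compose[OF sqrt_at_top] filterlim_compose[OF filterlim_real_sequentially filterlim_Suc])
  ultimately have "c * M.prob Z \<le> 0" by (intro LIMSEQ_le_const[where X="\<lambda>n. c\<^sup>2 / sqrt (real (Suc n))"]) auto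
  then have "M.prob Z = 0" using c_pos measure_nonneg[of M Z] by (simp add: mult_le_0_iff)
  then have "Z \<in> null_sets M" using Z by (simp add: null_sets_def M.emeasure_eq_measure)
  then have "AE \<omega> in M. \<omega> \<notin> Z" by (rule AE_not_in)
  with AE_space show ?thesis by eventually_elim (auto simp: Z_def)
qed

lemma AE_meets: "AE \<omega> in M. meets_in_finite_time B Rfl \<omega>"
  using AE_T_finite AE_space
proof eventually_elim
  case (elim \<omega>)
  then obtain h where h: "T \<omega> = ereal h" using T_nonneg[of \<omega>] by (cases "T \<omega>") auto
  then have "meets_by B Rfl h \<omega>" using meets_by_iff[OF elim(2), of h] N_at_T(1)[OF elim(2) h] by simp
  then show ?case by (auto simp: meets_in_finite_time_def)
qed

end

section \<open>The reflection for an arbitrary version of the pairing\<close>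

lemma cm_reflection_coupling:
  assumes nd: "nondegenerate_gaussian \<mu>" and bm: "brownian_motion M \<mu> 0 B"
    and x: "x \<in> cm_space \<mu>" "x \<noteq> 0" and N: "paley_wiener M \<mu> B x N"
  shows "maximal_coupling M \<mu> B 0 (cm_reflection \<mu> x N B) x"
    and "AE \<omega> in M. meets_in_finite_time B (cm_reflection \<mu> x N B) \<omega>"
    and "cm_reflection_time \<mu> x N \<in> borel_measurable M"
    and "\<And>\<omega>. \<omega> \<in> space M \<Longrightarrow> coupling_time B (cm_reflection \<mu> x N B) \<omega> = cm_reflection_time \<mu> x N \<omega>"
proof -
  interpret brownian \<mu> M 0 B using nd bm by (simp add: brownian_iff)
  obtain u where "\<forall>n. u n \<in> pre_cm_space \<mu>" "(\<lambda>n. cm_norm \<mu> (u n - x)) \<longlonglongrightarrow> 0"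
      "\<forall>t\<ge>0. (\<lambda>n. \<integral>\<^sup>+\<omega>. ennreal ((blinfun_apply (cm_star \<mu> (u n)) (B t \<omega>) - N t \<omega>)\<^sup>2) \<partial>M) \<longlonglongrightarrow> 0"
    using N unfolding paley_wiener_def by (elim conjE exE)
  note u = this(1)[rule_format] this(2) this(3)[THEN spec, THEN mp]
  \<comment> \<open>The sequence behind the pairing may converge slowly; a fast subsequence still
    has the pairing as its mean-square limit.\<close>
  obtain r where r: "strict_mono r" "cm_vector \<mu> x (\<lambda>n. cm_star \<mu> (u (r n)))"
    using ex_cm_vector_subseq[OF x u(1,2)] by blast
  interpret cm_brownian \<mu> x "\<lambda>n. cm_star \<mu> (u (r n))" M B
    using r(2) brownian_axioms by (simp add: cm_brownian_def)
  have Nm: "N t \<in> borel_measurable M" if "t \<ge> 0" for t using N that by (simp add: paley_wiener_def)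
  have ax: "cm_reflection_process_axioms (\<lambda>n. cm_star \<mu> (u (r n))) M B N"
  proof (intro cm_reflection_process_axioms.intro Nm)
    show "continuous_on {0..} (\<lambda>t. N t \<omega>)" if "\<omega> \<in> space M" for \<omega> using N that by (simp add: paley_wiener_def)
    show "AE \<omega> in M. N t \<omega> = g (B t \<omega>)" if "t \<ge> 0" for t
      by (rule AE_N_eq_g[OF that Nm[OF that]])
         (use LIMSEQ_subseq_LIMSEQ[OF u(3)[OF that] r(1)] in \<open>simp add: comp_def\<close>)
  qed
  interpret cm_reflection_process \<mu> x "\<lambda>n. cm_star \<mu> (u (r n))" M B N
    by (intro cm_reflection_process.intro cm_brownian_axioms ax)
  have T: "T = cm_reflection_time \<mu> x N" by (simp add: T_def cm_reflection_time_def)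
  show "maximal_coupling M \<mu> B 0 (cm_reflection \<mu> x N B) x" by (rule maximal_coupling_reflection)
  show "AE \<omega> in M. meets_in_finite_time B (cm_reflection \<mu> x N B) \<omega>" by (rule AE_meets)
  show "cm_reflection_time \<mu> x N \<in> borel_measurable M" using measurable_T by (simp add: T)
  show "coupling_time B (cm_reflection \<mu> x N B) \<omega> = cm_reflection_time \<mu> x N \<omega>" if "\<omega> \<in> space M" for \<omega>
    using coupling_time_eq[OF that] by (simp add: T)
qed

theorem theorem10:
  fixes M :: "'w measure"
    and \<mu> :: "'a::{banach,second_countable_topology} measure"
    and B :: "real \<Rightarrow> 'w \<Rightarrow> 'a"
    and x :: 'a
  assumes "centered_gaussian \<mu>" and "nondegenerate_gaussian \<mu>"
    and "brownian_motion M \<mu> 0 B"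
    and "\<mu> = distr M borel (B 1)"
    and "x \<noteq> 0"
  shows "((\<exists>(P :: 'w measure) B1 B2. coupling P \<mu> B1 0 B2 x \<and>
             measure P {\<omega>\<in>space P. meets_in_finite_time B1 B2 \<omega>} > 0)
          \<longleftrightarrow> x \<in> cm_space \<mu>)
       \<and> (x \<in> cm_space \<mu> \<longrightarrow>
            (\<exists>B'. maximal_coupling M \<mu> B 0 B' x \<and>
                  (AE \<omega> in M. meets_in_finite_time B B' \<omega>)) \<and>
            (\<exists>N. paley_wiener M \<mu> B x N) \<and>
            (\<forall>N. paley_wiener M \<mu> B x N \<longrightarrow>
               maximal_coupling M \<mu> B 0 (cm_reflection \<mu> x N B) x \<and>
               (AE \<omega> in M. meets_in_finite_time B (cm_reflection \<mu> x N B) \<omega>) \<and>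
               coupling_time B (cm_reflection \<mu> x N B) \<in> borel_measurable M \<and>
               cm_reflection_time \<mu> x N \<in> borel_measurable M \<and>
               distr M borel (coupling_time B (cm_reflection \<mu> x N B))
                 = distr M borel (cm_reflection_time \<mu> x N)))"
proof -
  note nd = assms(2) and bm = assms(3)
  interpret M: prob_space M using bm by (simp add: brownian_motion_def)
  have ex: "\<exists>N. paley_wiener M \<mu> B x N" if "x \<in> cm_space \<mu>"
    by (rule ex_paley_wiener[OF nd bm that assms(5)])
  note refl = cm_reflection_coupling[OF nd bm _ assms(5)]
  have full: "maximal_coupling M \<mu> B 0 (cm_reflection \<mu> x N B) x \<and>
               (AE \<omega> in M. meets_in_finite_time B (cm_reflection \<mu> x N B) \<omega>) \<and>
               coupling_time B (cm_reflection \<mu> x N B) \<in> borel_measurable M \<and>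
               cm_reflection_time \<mu> x N \<in> borel_measurable M \<and>
               distr M borel (coupling_time B (cm_reflection \<mu> x N B))
                 = distr M borel (cm_reflection_time \<mu> x N)"
    if x: "x \<in> cm_space \<mu>" and N: "paley_wiener M \<mu> B x N" for N
  proof (intro conjI refl(1-3)[OF x N])
    show "coupling_time B (cm_reflection \<mu> x N B) \<in> borel_measurable M"
      using refl(3)[OF x N] by (rule measurable_cong[THEN iffD2, rotated]) (rule refl(4)[OF x N])
    show "distr M borel (coupling_time B (cm_reflection \<mu> x N B)) = distr M borel (cm_reflection_time \<mu> x N)"
      by (rule distr_cong) (simp_all add: refl(4)[OF x N])
  qed
  have "\<exists>(P :: 'w measure) B1 B2. coupling P \<mu> B1 0 B2 x \<and> measure P {\<omega>\<in>space P. meets_in_finite_time B1 B2 \<omega>} > 0"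
    if x: "x \<in> cm_space \<mu>"
  proof -
    obtain N where N: "paley_wiener M \<mu> B x N" using ex[OF x] by blast
    let ?R = "cm_reflection \<mu> x N B" and ?T = "cm_reflection_time \<mu> x N"
    have cp: "coupling M \<mu> B 0 ?R x" using full[OF x N] by (simp add: maximal_coupling_def)
    \<comment> \<open>The meeting event is thereby the event that \<open>T\<close> is finite, hence
      measurable; only then does its almost sure occurrence give it positive measure.\<close>
    have fin: "meets_in_finite_time B ?R \<omega> \<longleftrightarrow> coupling_time B ?R \<omega> < \<infinity>" for \<omega>
      unfolding coupling_time_def Inf_less_iff meets_in_finite_time_def meets_by_def by auto
    have "{\<omega>\<in>space M. meets_in_finite_time B ?R \<omega>} = ?T -` {..<\<infinity>} \<inter> space M"
      by (auto simp: fin refl(4)[OF x N])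
    then have "{\<omega>\<in>space M. meets_in_finite_time B ?R \<omega>} \<in> sets M"
      using measurable_sets[OF refl(3)[OF x N], of "{..<\<infinity>}"] by simp
    then have "measure M {\<omega>\<in>space M. meets_in_finite_time B ?R \<omega>} = 1"
      using refl(2)[OF x N] by (subst M.prob_Collect_eq_1) auto
    then show ?thesis using cp by (intro exI[of _ M] exI[of _ B] exI[of _ ?R]) simp
  qed
  then show ?thesis using meeting_imp_cm_space[OF nd] ex full by blast
qed

end
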